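(* Let $\mathcal{E}$ be a finite biordered set, and let $\mathbf{x}=(i_1,a_1,\lambda_1)\dots(i_m,a_m,\lambda_m)\in\mathsf{IG}(\mathcal{E})$ be of $\mathscr{D}$-fingerprint $(D_1,\dots,D_m)$, where $D_k$ has maximal subgroup $G_k$ and $\mathscr{R}$- and $\mathscr{L}$-classes indexed by $I_k$ and $\Lambda_k$. Write $\mathbf{1}$ for the trivial subgroup (of $G_1$ or of $G_m$), and $(G:K)$ for the index of a subgroup $K$ in a group $G$. (1) The number of $\mathscr{R}$-classes contained in $D_\mathbf{x}$ is $|I_1|\cdot\left(G_1:\overline\theta(\mathbf{x},\mathbf{x},G_m)\right)$. (2) The number of $\mathscr{L}$-classes contained in $D_\mathbf{x}$ is $|\Lambda_m|\cdot\left(G_m:(G_1,\mathbf{x},\mathbf{x})\theta\right)$. (3) \begin{align*} |H_\mathbf{x}| &= \left((G_1,\mathbf{x},\mathbf{x})\theta:(\mathbf{1},\mathbf{x},\mathbf{x})\theta\right)=\left(\overline\theta(\mathbf{x},\mathbf{x},G_m):\overline\theta(\mathbf{x},\mathbf{x},\mathbf{1})\right),\\ |R_\mathbf{x}| &= |\Lambda_m| \cdot \left(G_m:(\mathbf{1},\mathbf{x},\mathbf{x})\theta\right),\\ |L_\mathbf{x}| &= |I_1| \cdot \left(G_1:\overline\theta(\mathbf{x},\mathbf{x},\mathbf{1})\right),\\ |D_\mathbf{x}| &= |I_1| \cdot |\Lambda_m| \cdot \left(G_1:\overline\theta(\mathbf{x},\mathbf{x},\mathbf{1})\right)\cdot \left(G_m:(G_1,\mathbf{x},\mathbf{x})\theta\right)\\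 &= |I_1| \cdot |\Lambda_m| \cdot \left(G_1:\overline\theta(\mathbf{x},\mathbf{x},G_m)\right)\cdot \left(G_m:(\mathbf{1},\mathbf{x},\mathbf{x})\theta\right). \end{align*} In particular, if both groups $G_1,G_m$ are finite then the $\mathscr{D}$-class $D_\mathbf{x}$ is finite as well.
   Context: Biordered sets and $\mathsf{IG}(\mathcal{E})$. For a semigroup $S$ with set of idempotents $E(S)$, $\mathcal{E}_S$ is the partial algebra on $E(S)$ retaining the product $ef$ exactly when $\{ef,fe\}\cap\{e,f\}\neq\varnothing$ (then both $ef,fe$ are idempotents, and $\{e,f\}$ is called a basic pair). A biordered set is a partial algebra $\mathcal{E}=(E,\cdot)$ isomorphic to some $\mathcal{E}_S$. The free idempotent generated semigroup is $\mathsf{IG}(\mathcal{E})=\langle \overline{E}\mid \overline{e}\,\overline{f}=\overline{e\cdot f}\text{ whenever }\{e,f\}\text{ is a basic pair in }\mathcal{E}\rangle$, $\overline E=\{\overline e:e\in E\}$. For a word $w=e_1\dots e_n\in E^+$ put $\overline{w}=\overline{e_1}\dots\overline{e_n}\in\mathsf{IG}(\mathcal{E})$. $H_\mathbf{x},R_\mathbf{x},L_\mathbf{x},D_\mathbf{x}$ are the Green's classes of $\mathbf{x}$ in $\mathsf{IG}(\mathcal{E})$. Triples. For finite $\mathcal{E}$, every regular $\mathscr{D}$-class $D$ of $\mathsf{IG}(\mathcal{E})$ is a $\mathscr{J}$-class with completely $0$-simple principal factor; for each $D$ fix an identification of this principal factor with a Rees matrix semigroup $\mathcal{M}^0[G;I,\Lambda;P]$,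 where $G$ is (isomorphic to) the maximal subgroup of $D$, and $I,\Lambda$ are finite sets indexing the $\mathscr{R}$- and $\mathscr{L}$-classes of $D$. Elements of $D$ are thus written as triples $(i,g,\lambda)$, $i\in I$, $g\in G$, $\lambda\in\Lambda$. For $D_k$ the data are denoted $G_k,I_k,\Lambda_k$. Juxtaposed triples are multiplied in $\mathsf{IG}(\mathcal{E})$. Fingerprints. An r-factorisation of $w\in E^+$ is a factorisation $w=w_1\dots w_m$ into nonempty words with every $\overline{w_i}$ regular in $\mathsf{IG}(\mathcal{E})$; it is minimal if $\overline{w_i\dots w_j}$ is non-regular whenever $i<j$. The sequence $(D_{\overline{w_1}},\dots,D_{\overline{w_m}})$ of $\mathscr{D}$-classes for a minimal r-factorisation depends only on the element $\overline{w}$, and is its $\mathscr{D}$-fingerprint. Writing $\mathbf{x}=(i_1,a_1,\lambda_1)\dots(i_m,a_m,\lambda_m)$ for an element of $\mathscr{D}$-fingerprint $(D_1,\dots,D_m)$ means that there is a word $p_1\dots p_m$ representing $\mathbf{x}$, written as a minimal r-factorisation, with $\overline{p_k}=(i_k,a_k,\lambda_k)\in D_k$ for all $k$. Contact automaton. $G^\partial$ is the dual group of $G$, with $g\ast h=hg$. For $e\in E$, $i\in I_k$: if $\overline{e}(i,g,\lambda)\in D_k$ for some (equivalently all) $g,\lambda$, there are unique $\sigma_e^{(k)}i\in I_k$ and $\alpha_k(e,i)\in G_k$ with $\overline{e}(i,g,\lambda)=(\sigma_e^{(k)}i,\alpha_k(e,i)g,\lambda)$ for all $g,\lambda$; otherwise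 $\sigma_e^{(k)}i$ is undefined. Dually, if $(i,g,\lambda)\overline{e}\in D_k$ then $(i,g,\lambda)\overline{e}=(i,g\beta_k(\lambda,e),\lambda\tau_e^{(k)})$; otherwise $\lambda\tau^{(k)}_e$ is undefined. For regular $\mathscr{D}$-classes $D_1,D_2$ the contact automaton $\mathcal{A}(D_1,D_2)$ has vertex set $\Lambda_1\times I_2$ and an edge labelled by $e$ from $(\lambda,i)$ to $(\mu,j)$ iff either (a) $\lambda=\mu\tau_e^{(1)}$ and $\sigma_e^{(2)}i=j$, or (b) $\lambda\tau_e^{(1)}=\mu$ and $i=\sigma_e^{(2)}j$. The group label of the edge, in $G_1\times G_2^\partial$, is $(\beta_1(\mu,e)^{-1},\alpha_2(e,i))$ in case (a) and $(\beta_1(\lambda,e),\alpha_2(e,j)^{-1})$ in case (b); edges may be traversed in both directions, with inverse labels. The label of a walk is the product in $G_1\times G_2^\partial$ of its edge labels in order (the empty walk has label $(1,1)$). The vertex group $W_{(\lambda,i)}\leq G_1\times G_2^\partial$ is the group of labels of all closed walks based at $(\lambda,i)$. Here $W_{(\lambda_k,i_{k+1})}$ is the vertex group in $\mathcal{A}(D_k,D_{k+1})$. The maps $\theta$ and $\overline\theta$ (with both parameters equal to $\mathbf{x}$, same decomposition). For $A\subseteq G_1$, define $A_k\subseteq G_k$, $1\le k\le m$, by $A_1=A$; $B_{1,2}=(A\times G_2)\cap W_{(\lambda_1,i_2)}$; for $1<k<m$, $B_{k,k+1}=(a_k^{-1}A_k^{-1}a_k\times G_{k+1})\cap W_{(\lambda_k,i_{k+1})}$;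 and $A_{k+1}=B_{k,k+1}\pi_2$ (second projection) for $1\le k<m$. Then $(A,\mathbf{x},\mathbf{x})\theta=A_m\subseteq G_m$. For $B\subseteq G_m$, define $B_k\subseteq G_{m+1-k}$, $1\le k\le m$, by $B_1=B$; $C_{m-1,m}=(G_{m-1}\times B)\cap W_{(\lambda_{m-1},i_m)}$; for $1<k<m$, $C_{m-k,m+1-k}=(G_{m-k}\times a_{m+1-k}B_k^{-1}a_{m+1-k}^{-1})\cap W_{(\lambda_{m-k},i_{m+1-k})}$; and $B_{k+1}=C_{m-k,m+1-k}\pi_1$ (first projection) for $1\le k<m$. Then $\overline\theta(\mathbf{x},\mathbf{x},B)=B_m\subseteq G_1$. On subgroups of $G_1$ (resp. $G_m$), these maps return subgroups of $G_m$ (resp. $G_1$). *)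

theory Defs
  imports "HOL-Algebra.Coset" "HOL-Library.Equipollence"
begin

section \<open>Semigroups and Green's relations\<close>

record 'a semigrp = "'a partial_object" +
  smult :: "'a \<Rightarrow> 'a \<Rightarrow> 'a" (infixl \<open>\<cdot>\<index>\<close> 70)

definition is_semigrp :: "('a, 'b) semigrp_scheme \<Rightarrow> bool" where
  "is_semigrp S \<longleftrightarrow>
     (\<forall>x\<in>carrier S. \<forall>y\<in>carrier S. x \<cdot>\<^bsub>S\<^esub> y \<in> carrier S) \<and>
     (\<forall>x\<in>carrier S. \<forall>y\<in>carrier S. \<forall>z\<in>carrier S.
        (x \<cdot>\<^bsub>S\<^esub> y) \<cdot>\<^bsub>S\<^esub> z = x \<cdot>\<^bsub>S\<^esub> (y \<cdot>\<^bsub>S\<^esub> z))"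

definition semigrp_iso ::
  "('a \<Rightarrow> 'b) \<Rightarrow> ('a, 'c) semigrp_scheme \<Rightarrow> ('b, 'd) semigrp_scheme \<Rightarrow> bool" where
  "semigrp_iso f S T \<longleftrightarrow> bij_betw f (carrier S) (carrier T) \<and>
     (\<forall>x\<in>carrier S. \<forall>y\<in>carrier S. f (x \<cdot>\<^bsub>S\<^esub> y) = f x \<cdot>\<^bsub>T\<^esub> f y)"

definition idempotents :: "('a, 'b) semigrp_scheme \<Rightarrow> 'a set" where
  "idempotents S = {e \<in> carrier S. e \<cdot>\<^bsub>S\<^esub> e = e}"

definition regular_elem :: "('a, 'b) semigrp_scheme \<Rightarrow> 'a \<Rightarrow> bool" where
  "regular_elem S x \<longleftrightarrow> x \<in> carrier S \<and> (\<exists>y\<in>carrier S. x \<cdot>\<^bsub>S\<^esub> y \<cdot>\<^bsub>S\<^esub> x = x)"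

definition right_ideal_of :: "('a, 'b) semigrp_scheme \<Rightarrow> 'a \<Rightarrow> 'a set" where
  "right_ideal_of S x = insert x {x \<cdot>\<^bsub>S\<^esub> s |s. s \<in> carrier S}"

definition left_ideal_of :: "('a, 'b) semigrp_scheme \<Rightarrow> 'a \<Rightarrow> 'a set" where
  "left_ideal_of S x = insert x {s \<cdot>\<^bsub>S\<^esub> x |s. s \<in> carrier S}"

definition R_class :: "('a, 'b) semigrp_scheme \<Rightarrow> 'a \<Rightarrow> 'a set" where
  "R_class S x = {y \<in> carrier S. right_ideal_of S y = right_ideal_of S x}"

definition L_class :: "('a, 'b) semigrp_scheme \<Rightarrow> 'a \<Rightarrow> 'a set" where
  "L_class S x = {y \<in> carrier S. left_ideal_of S y = left_ideal_of S x}"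

definition H_class :: "('a, 'b) semigrp_scheme \<Rightarrow> 'a \<Rightarrow> 'a set" where
  "H_class S x = R_class S x \<inter> L_class S x"

text \<open>\<open>\<D>\<close> is the composite of the commuting equivalences \<open>\<R>\<close> and \<open>\<L>\<close>.\<close>

definition D_class :: "('a, 'b) semigrp_scheme \<Rightarrow> 'a \<Rightarrow> 'a set" where
  "D_class S x = (\<Union>z\<in>R_class S x. L_class S z)"

definition R_classes_in :: "('a, 'b) semigrp_scheme \<Rightarrow> 'a set \<Rightarrow> 'a set set" where
  "R_classes_in S D = {X. (\<exists>y\<in>carrier S. X = R_class S y) \<and> X \<subseteq> D}"

definition L_classes_in :: "('a, 'b) semigrp_scheme \<Rightarrow> 'a set \<Rightarrow> 'a set set" where
  "L_classes_in S D = {X. (\<exists>y\<in>carrier S. X = L_class S y) \<and> X \<subseteq> D}"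

definition regular_D_class :: "('a, 'b) semigrp_scheme \<Rightarrow> 'a set \<Rightarrow> bool" where
  "regular_D_class S D \<longleftrightarrow> (\<exists>x. regular_elem S x \<and> D = D_class S x)"


section \<open>Biordered sets\<close>

record 'e partial_alg = "'e partial_object" +
  pmult :: "'e \<Rightarrow> 'e \<Rightarrow> 'e option"

definition is_partial_alg :: "'e partial_alg \<Rightarrow> bool" where
  "is_partial_alg \<E> \<longleftrightarrow>
     (\<forall>e\<in>carrier \<E>. \<forall>f\<in>carrier \<E>. \<forall>g. pmult \<E> e f = Some g \<longrightarrow> g \<in> carrier \<E>)"

definition partial_alg_iso ::
  "('e \<Rightarrow> 'f) \<Rightarrow> 'e partial_alg \<Rightarrow> 'f partial_alg \<Rightarrow> bool" where
  "partial_alg_iso \<phi> \<E> \<F> \<longleftrightarrow> bij_betw \<phi> (carrier \<E>) (carrier \<F>) \<and>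
     (\<forall>e\<in>carrier \<E>. \<forall>f\<in>carrier \<E>. pmult \<F> (\<phi> e) (\<phi> f) = map_option \<phi> (pmult \<E> e f))"

definition idempotent_alg :: "('s, 'b) semigrp_scheme \<Rightarrow> 's partial_alg" where
  "idempotent_alg S =
     \<lparr>carrier = idempotents S,
      pmult = (\<lambda>e f. if {e \<cdot>\<^bsub>S\<^esub> f, f \<cdot>\<^bsub>S\<^esub> e} \<inter> {e, f} \<noteq> {} then Some (e \<cdot>\<^bsub>S\<^esub> f) else None)\<rparr>"

text \<open>HOL cannot quantify existentially over the type in which the semigroup lives, so that
  type is a parameter.\<close>

definition biordered_set :: "'s itself \<Rightarrow> 'e partial_alg \<Rightarrow> bool" where
  "biordered_set (_ :: 's itself) \<E> \<longleftrightarrow> is_partial_alg \<E> \<and>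
     (\<exists>(S :: 's semigrp) \<phi>. is_semigrp S \<and> partial_alg_iso \<phi> \<E> (idempotent_alg S))"


section \<open>The free idempotent generated semigroup\<close>

definition words :: "'e partial_alg \<Rightarrow> 'e list set" where
  "words \<E> = {w. w \<noteq> [] \<and> set w \<subseteq> carrier \<E>}"

text \<open>The congruence on the free semigroup generated by the defining relations; a product is
  defined in \<open>\<E>\<close> exactly on the basic pairs.\<close>

inductive_set ig_cong :: "'e partial_alg \<Rightarrow> ('e list \<times> 'e list) set" for \<E> where
  basic: "\<lbrakk>e \<in> carrier \<E>; f \<in> carrier \<E>; pmult \<E> e f = Some g; g \<in> carrier \<E>\<rbrakk>
    \<Longrightarrow> ([e, f], [g]) \<in> ig_cong \<E>"
| refl: "u \<in> words \<E> \<Longrightarrow> (u, u) \<in> ig_cong \<E>"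
| sym: "(u, v) \<in> ig_cong \<E> \<Longrightarrow> (v, u) \<in> ig_cong \<E>"
| trans: "\<lbrakk>(u, v) \<in> ig_cong \<E>; (v, w) \<in> ig_cong \<E>\<rbrakk> \<Longrightarrow> (u, w) \<in> ig_cong \<E>"
| mult: "\<lbrakk>(u, v) \<in> ig_cong \<E>; (u', v') \<in> ig_cong \<E>\<rbrakk> \<Longrightarrow> (u @ u', v @ v') \<in> ig_cong \<E>"

definition bar :: "'e partial_alg \<Rightarrow> 'e list \<Rightarrow> 'e list set" where
  "bar \<E> w = ig_cong \<E> `` {w}"

definition IG :: "'e partial_alg \<Rightarrow> 'e list set semigrp" where
  "IG \<E> =
     \<lparr>carrier = words \<E> // ig_cong \<E>,
      smult = (\<lambda>X Y. \<Union>u\<in>X. \<Union>v\<in>Y. bar \<E> (u @ v))\<rparr>"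

lemma ig_cong_words: "(u, v) \<in> ig_cong \<E> \<Longrightarrow> u \<in> words \<E> \<and> v \<in> words \<E>"
  by (induction rule: ig_cong.induct) (auto simp: words_def)

lemma equiv_ig_cong: "equiv (words \<E>) (ig_cong \<E>)"
proof (rule equivI)
  show "ig_cong \<E> \<subseteq> words \<E> \<times> words \<E>" using ig_cong_words by fastforce
  show "refl_on (words \<E>) (ig_cong \<E>)" by (simp add: refl_on_def ig_cong.refl)
  show "sym (ig_cong \<E>)" by (rule symI) (rule ig_cong.sym)
  show "trans (ig_cong \<E>)" by (rule transI) (rule ig_cong.trans)
qed

lemma bar_eq_iff: "u \<in> words \<E> \<Longrightarrow> v \<in> words \<E> \<Longrightarrow> bar \<E> u = bar \<E> v \<longleftrightarrow> (u, v) \<in> ig_cong \<E>"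
  unfolding bar_def using eq_equiv_class_iff[OF equiv_ig_cong] by blast

lemma carrier_IG: "carrier (IG \<E>) = bar \<E> ` words \<E>"
  by (auto simp: IG_def quotient_def bar_def)

lemma bar_mult:
  assumes "u \<in> words \<E>" "v \<in> words \<E>"
  shows "bar \<E> u \<cdot>\<^bsub>IG \<E>\<^esub> bar \<E> v = bar \<E> (u @ v)"
proof -
  have eq: "bar \<E> (u' @ v') = bar \<E> (u @ v)" if "u' \<in> bar \<E> u" "v' \<in> bar \<E> v" for u' v'
    unfolding bar_def
  proof (rule equiv_class_eq[OF equiv_ig_cong])
    have "(u, u') \<in> ig_cong \<E>" "(v, v') \<in> ig_cong \<E>"
      using that by (simp_all add: bar_def)
    then show "(u' @ v', u @ v) \<in> ig_cong \<E>"
      by (rule ig_cong.sym[OF ig_cong.mult])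
  qed
  have "u \<in> bar \<E> u" "v \<in> bar \<E> v"
    using assms by (simp_all add: bar_def ig_cong.refl)
  then have ne: "bar \<E> u \<noteq> {}" "bar \<E> v \<noteq> {}" by blast+
  have "bar \<E> u \<cdot>\<^bsub>IG \<E>\<^esub> bar \<E> v = (\<Union>u'\<in>bar \<E> u. \<Union>v'\<in>bar \<E> v. bar \<E> (u' @ v'))"
    by (simp add: IG_def)
  also have "\<dots> = (\<Union>u'\<in>bar \<E> u. \<Union>v'\<in>bar \<E> v. bar \<E> (u @ v))"
    by (intro SUP_cong HOL.refl eq)
  also have "\<dots> = bar \<E> (u @ v)"
    by (simp only: UN_constant ne if_False)
  finally show ?thesis .
qed

lemma is_semigrp_IG: "is_semigrp (IG \<E>)"
proof -
  have "u @ v \<in> words \<E>" if "u \<in> words \<E>" "v \<in> words \<E>" for u v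
    using that by (auto simp: words_def)
  then show ?thesis
    by (auto simp: is_semigrp_def carrier_IG bar_mult)
qed


section \<open>Coordinates for regular \<open>\<D>\<close>-classes\<close>

text \<open>\<open>None\<close> plays the role of the adjoined zero. It is adjoined even when \<open>D\<close> is the
  minimal ideal.\<close>

definition principal_factor :: "('a, 'b) semigrp_scheme \<Rightarrow> 'a set \<Rightarrow> 'a option semigrp" where
  "principal_factor S D =
     \<lparr>carrier = insert None (Some ` D),
      smult = (\<lambda>X Y. case (X, Y) of
         (Some x, Some y) \<Rightarrow> if x \<cdot>\<^bsub>S\<^esub> y \<in> D then Some (x \<cdot>\<^bsub>S\<^esub> y) else None
       | _ \<Rightarrow> None)\<rparr>"

definition rees_matrix ::
  "'g monoid \<Rightarrow> 'i set \<Rightarrow> 'l set \<Rightarrow> ('l \<Rightarrow> 'i \<Rightarrow> 'g option) \<Rightarrow> ('i \<times> 'g \<times> 'l) option semigrp" where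
  "rees_matrix G I \<Lambda> P =
     \<lparr>carrier = insert None (Some ` (I \<times> carrier G \<times> \<Lambda>)),
      smult = (\<lambda>X Y. case (X, Y) of
         (Some (i, a, l), Some (j, b, m)) \<Rightarrow>
           (case P l j of
              None \<Rightarrow> None
            | Some q \<Rightarrow> Some (i, a \<otimes>\<^bsub>G\<^esub> q \<otimes>\<^bsub>G\<^esub> b, m))
       | _ \<Rightarrow> None)\<rparr>"

definition regular_matrix ::
  "'g monoid \<Rightarrow> 'i set \<Rightarrow> 'l set \<Rightarrow> ('l \<Rightarrow> 'i \<Rightarrow> 'g option) \<Rightarrow> bool" where
  "regular_matrix G I \<Lambda> P \<longleftrightarrow>
     (\<forall>l\<in>\<Lambda>. \<forall>i\<in>I. \<forall>q. P l i = Some q \<longrightarrow> q \<in> carrier G) \<and>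
     (\<forall>l\<in>\<Lambda>. \<exists>i\<in>I. P l i \<noteq> None) \<and> (\<forall>i\<in>I. \<exists>l\<in>\<Lambda>. P l i \<noteq> None)"

record ('a, 'g, 'i, 'l) rees_coords =
  GG :: "'g monoid"
  II :: "'i set"
  LL :: "'l set"
  PP :: "'l \<Rightarrow> 'i \<Rightarrow> 'g option"
  triple :: "'i \<times> 'g \<times> 'l \<Rightarrow> 'a"

definition is_rees_coords ::
  "('a, 'b) semigrp_scheme \<Rightarrow> 'a set \<Rightarrow> ('a, 'g, 'i, 'l) rees_coords \<Rightarrow> bool" where
  "is_rees_coords S D C \<longleftrightarrow>
     group (GG C) \<and> finite (II C) \<and> finite (LL C) \<and>
     regular_matrix (GG C) (II C) (LL C) (PP C) \<and>
     semigrp_iso (map_option (triple C))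
       (rees_matrix (GG C) (II C) (LL C) (PP C)) (principal_factor S D)"

text \<open>A choice of coordinates for every regular \<open>\<D>\<close>-class.\<close>

type_synonym ('e, 'g, 'i, 'l) coord_choice =
  "'e list set set \<Rightarrow> ('e list set, 'g, 'i, 'l) rees_coords"

definition is_coord_choice :: "'e partial_alg \<Rightarrow> ('e, 'g, 'i, 'l) coord_choice \<Rightarrow> bool" where
  "is_coord_choice \<E> c \<longleftrightarrow>
     (\<forall>D. regular_D_class (IG \<E>) D \<longrightarrow> is_rees_coords (IG \<E>) D (c D))"


section \<open>Minimal r-factorisations and fingerprints\<close>

definition factors :: "(nat \<Rightarrow> 'e list) \<Rightarrow> nat \<Rightarrow> nat \<Rightarrow> 'e list" where
  "factors p j k = concat (map p [j..<Suc k])"  \<comment> \<open>\<open>p\<^sub>j \<dots> p\<^sub>k\<close>\<close>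

definition r_factorisation :: "'e partial_alg \<Rightarrow> nat \<Rightarrow> (nat \<Rightarrow> 'e list) \<Rightarrow> 'e list \<Rightarrow> bool" where
  "r_factorisation \<E> m p w \<longleftrightarrow> 1 \<le> m \<and> w = factors p 1 m \<and>
     (\<forall>k\<in>{1..m}. p k \<in> words \<E> \<and> regular_elem (IG \<E>) (bar \<E> (p k)))"

definition minimal_r_factorisation ::
  "'e partial_alg \<Rightarrow> nat \<Rightarrow> (nat \<Rightarrow> 'e list) \<Rightarrow> 'e list \<Rightarrow> bool" where
  "minimal_r_factorisation \<E> m p w \<longleftrightarrow> r_factorisation \<E> m p w \<and>
     (\<forall>j k. 1 \<le> j \<and> j < k \<and> k \<le> m \<longrightarrow> \<not> regular_elem (IG \<E>) (bar \<E> (factors p j k)))"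

text \<open>\<open>x = (i\<^sub>1, a\<^sub>1, \<lambda>\<^sub>1) \<dots> (i\<^sub>m, a\<^sub>m, \<lambda>\<^sub>m)\<close> is of fingerprint \<open>(D\<^sub>1, \<dots>, D\<^sub>m)\<close>. Sequences are
  functions of which only the values at \<open>1, \<dots>, m\<close> matter.\<close>

definition is_decomposition ::
  "'e partial_alg \<Rightarrow> ('e, 'g, 'i, 'l) coord_choice \<Rightarrow> nat \<Rightarrow> (nat \<Rightarrow> 'e list set set) \<Rightarrow>
   (nat \<Rightarrow> 'i) \<Rightarrow> (nat \<Rightarrow> 'g) \<Rightarrow> (nat \<Rightarrow> 'l) \<Rightarrow> 'e list set \<Rightarrow> bool" where
  "is_decomposition \<E> c m D i a l x \<longleftrightarrow>
     (\<exists>p w. minimal_r_factorisation \<E> m p w \<and> bar \<E> w = x \<and>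
       (\<forall>k\<in>{1..m}. D k = D_class (IG \<E>) (bar \<E> (p k)) \<and>
          i k \<in> II (c (D k)) \<and> a k \<in> carrier (GG (c (D k))) \<and> l k \<in> LL (c (D k)) \<and>
          bar \<E> (p k) = triple (c (D k)) (i k, a k, l k)))"


section \<open>Contact automata and vertex groups\<close>

definition dual_group :: "'g monoid \<Rightarrow> 'g monoid" where
  "dual_group G = G\<lparr>mult := (\<lambda>x y. y \<otimes>\<^bsub>G\<^esub> x)\<rparr>"

text \<open>The pair \<open>(\<sigma>\<^sub>e i, \<alpha>(e, i))\<close> for the class \<open>D\<close>, and dually \<open>(\<lambda>\<tau>\<^sub>e, \<beta>(\<lambda>, e))\<close>.\<close>

definition left_action ::
  "'e partial_alg \<Rightarrow> ('e, 'g, 'i, 'l) coord_choice \<Rightarrow> 'e list set set \<Rightarrow> 'e \<Rightarrow> 'i \<Rightarrow> ('i \<times> 'g) option" where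
  "left_action \<E> c D e i =
     (if \<exists>g\<in>carrier (GG (c D)). \<exists>l\<in>LL (c D). bar \<E> [e] \<cdot>\<^bsub>IG \<E>\<^esub> triple (c D) (i, g, l) \<in> D
      then Some (THE (j, h). j \<in> II (c D) \<and> h \<in> carrier (GG (c D)) \<and>
        (\<forall>g\<in>carrier (GG (c D)). \<forall>l\<in>LL (c D).
           bar \<E> [e] \<cdot>\<^bsub>IG \<E>\<^esub> triple (c D) (i, g, l) = triple (c D) (j, h \<otimes>\<^bsub>GG (c D)\<^esub> g, l)))
      else None)"

definition right_action ::
  "'e partial_alg \<Rightarrow> ('e, 'g, 'i, 'l) coord_choice \<Rightarrow> 'e list set set \<Rightarrow> 'l \<Rightarrow> 'e \<Rightarrow> ('l \<times> 'g) option" where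
  "right_action \<E> c D l e =
     (if \<exists>i\<in>II (c D). \<exists>g\<in>carrier (GG (c D)). triple (c D) (i, g, l) \<cdot>\<^bsub>IG \<E>\<^esub> bar \<E> [e] \<in> D
      then Some (THE (m, h). m \<in> LL (c D) \<and> h \<in> carrier (GG (c D)) \<and>
        (\<forall>i\<in>II (c D). \<forall>g\<in>carrier (GG (c D)).
           triple (c D) (i, g, l) \<cdot>\<^bsub>IG \<E>\<^esub> bar \<E> [e] = triple (c D) (i, g \<otimes>\<^bsub>GG (c D)\<^esub> h, m)))
      else None)"

definition sigma ::
  "'e partial_alg \<Rightarrow> ('e, 'g, 'i, 'l) coord_choice \<Rightarrow> 'e list set set \<Rightarrow> 'e \<Rightarrow> 'i \<Rightarrow> 'i option" where
  "sigma \<E> c D e i = map_option fst (left_action \<E> c D e i)"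

definition alpha ::
  "'e partial_alg \<Rightarrow> ('e, 'g, 'i, 'l) coord_choice \<Rightarrow> 'e list set set \<Rightarrow> 'e \<Rightarrow> 'i \<Rightarrow> 'g" where
  "alpha \<E> c D e i = snd (the (left_action \<E> c D e i))"

definition tau ::
  "'e partial_alg \<Rightarrow> ('e, 'g, 'i, 'l) coord_choice \<Rightarrow> 'e list set set \<Rightarrow> 'l \<Rightarrow> 'e \<Rightarrow> 'l option" where
  "tau \<E> c D l e = map_option fst (right_action \<E> c D l e)"

definition beta ::
  "'e partial_alg \<Rightarrow> ('e, 'g, 'i, 'l) coord_choice \<Rightarrow> 'e list set set \<Rightarrow> 'l \<Rightarrow> 'e \<Rightarrow> 'g" where
  "beta \<E> c D l e = snd (the (right_action \<E> c D l e))"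

abbreviation contact_group ::
  "('e, 'g, 'i, 'l) coord_choice \<Rightarrow> 'e list set set \<Rightarrow> 'e list set set \<Rightarrow> ('g \<times> 'g) monoid" where
  "contact_group c D1 D2 \<equiv> GG (c D1) \<times>\<times> dual_group (GG (c D2))"

text \<open>\<open>contact_edge \<E> c D1 D2 u e g v\<close>: an edge from \<open>u\<close> to \<open>v\<close> with letter \<open>e\<close> and group
  label \<open>g\<close>.\<close>

inductive contact_edge ::
  "'e partial_alg \<Rightarrow> ('e, 'g, 'i, 'l) coord_choice \<Rightarrow> 'e list set set \<Rightarrow> 'e list set set \<Rightarrow>
   'l \<times> 'i \<Rightarrow> 'e \<Rightarrow> 'g \<times> 'g \<Rightarrow> 'l \<times> 'i \<Rightarrow> bool"
  for \<E> c D1 D2 where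
  edge_a: "\<lbrakk>e \<in> carrier \<E>; l \<in> LL (c D1); m \<in> LL (c D1); i \<in> II (c D2); j \<in> II (c D2);
      tau \<E> c D1 m e = Some l; sigma \<E> c D2 e i = Some j\<rbrakk>
    \<Longrightarrow> contact_edge \<E> c D1 D2 (l, i) e
          (inv\<^bsub>GG (c D1)\<^esub> (beta \<E> c D1 m e), alpha \<E> c D2 e i) (m, j)"
| edge_b: "\<lbrakk>e \<in> carrier \<E>; l \<in> LL (c D1); m \<in> LL (c D1); i \<in> II (c D2); j \<in> II (c D2);
      tau \<E> c D1 l e = Some m; sigma \<E> c D2 e j = Some i\<rbrakk>
    \<Longrightarrow> contact_edge \<E> c D1 D2 (l, i) e
          (beta \<E> c D1 l e, inv\<^bsub>GG (c D2)\<^esub> (alpha \<E> c D2 e j)) (m, j)"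

inductive walk ::
  "'e partial_alg \<Rightarrow> ('e, 'g, 'i, 'l) coord_choice \<Rightarrow> 'e list set set \<Rightarrow> 'e list set set \<Rightarrow>
   'l \<times> 'i \<Rightarrow> 'g \<times> 'g \<Rightarrow> 'l \<times> 'i \<Rightarrow> bool"
  for \<E> c D1 D2 where
  empty: "u \<in> LL (c D1) \<times> II (c D2) \<Longrightarrow> walk \<E> c D1 D2 u \<one>\<^bsub>contact_group c D1 D2\<^esub> u"
| forward: "\<lbrakk>walk \<E> c D1 D2 u g v; contact_edge \<E> c D1 D2 v e h w\<rbrakk>
    \<Longrightarrow> walk \<E> c D1 D2 u (g \<otimes>\<^bsub>contact_group c D1 D2\<^esub> h) w"
| backward: "\<lbrakk>walk \<E> c D1 D2 u g v; contact_edge \<E> c D1 D2 w e h v\<rbrakk>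
    \<Longrightarrow> walk \<E> c D1 D2 u (g \<otimes>\<^bsub>contact_group c D1 D2\<^esub> inv\<^bsub>contact_group c D1 D2\<^esub> h) w"

definition vertex_group ::
  "'e partial_alg \<Rightarrow> ('e, 'g, 'i, 'l) coord_choice \<Rightarrow> 'e list set set \<Rightarrow> 'e list set set \<Rightarrow>
   'l \<times> 'i \<Rightarrow> ('g \<times> 'g) set" where
  "vertex_group \<E> c D1 D2 u = {g. walk \<E> c D1 D2 u g u}"


section \<open>The maps \<open>\<theta>\<close> and its dual\<close>

text \<open>\<open>theta_seq \<dots> A k\<close> is \<open>A\<^sub>k\<close> and \<open>theta_dual_seq \<dots> m B k\<close> is \<open>B\<^sub>k\<close>, for \<open>k \<ge> 1\<close>; the values at
  \<open>0\<close> are irrelevant.\<close>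

fun theta_seq ::
  "'e partial_alg \<Rightarrow> ('e, 'g, 'i, 'l) coord_choice \<Rightarrow> (nat \<Rightarrow> 'e list set set) \<Rightarrow>
   (nat \<Rightarrow> 'i) \<Rightarrow> (nat \<Rightarrow> 'g) \<Rightarrow> (nat \<Rightarrow> 'l) \<Rightarrow> 'g set \<Rightarrow> nat \<Rightarrow> 'g set" where
  "theta_seq \<E> c D i a l A 0 = A"
| "theta_seq \<E> c D i a l A (Suc 0) = A"
| "theta_seq \<E> c D i a l A (Suc (Suc n)) =
     (let k = Suc n; G = GG (c (D k)); A\<^sub>k = theta_seq \<E> c D i a l A k in
      snd ` (((if k = 1 then A\<^sub>k else (\<lambda>g. inv\<^bsub>G\<^esub> (a k) \<otimes>\<^bsub>G\<^esub> inv\<^bsub>G\<^esub> g \<otimes>\<^bsub>G\<^esub> a k) ` A\<^sub>k)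
               \<times> carrier (GG (c (D (k + 1)))))
             \<inter> vertex_group \<E> c (D k) (D (k + 1)) (l k, i (k + 1))))"

definition theta ::
  "'e partial_alg \<Rightarrow> ('e, 'g, 'i, 'l) coord_choice \<Rightarrow> nat \<Rightarrow> (nat \<Rightarrow> 'e list set set) \<Rightarrow>
   (nat \<Rightarrow> 'i) \<Rightarrow> (nat \<Rightarrow> 'g) \<Rightarrow> (nat \<Rightarrow> 'l) \<Rightarrow> 'g set \<Rightarrow> 'g set" where
  "theta \<E> c m D i a l A = theta_seq \<E> c D i a l A m"

fun theta_dual_seq ::
  "'e partial_alg \<Rightarrow> ('e, 'g, 'i, 'l) coord_choice \<Rightarrow> nat \<Rightarrow> (nat \<Rightarrow> 'e list set set) \<Rightarrow>
   (nat \<Rightarrow> 'i) \<Rightarrow> (nat \<Rightarrow> 'g) \<Rightarrow> (nat \<Rightarrow> 'l) \<Rightarrow> 'g set \<Rightarrow> nat \<Rightarrow> 'g set" where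
  "theta_dual_seq \<E> c m D i a l B 0 = B"
| "theta_dual_seq \<E> c m D i a l B (Suc 0) = B"
| "theta_dual_seq \<E> c m D i a l B (Suc (Suc n)) =
     (let k = Suc n; r = m + 1 - k; G = GG (c (D r));
          B\<^sub>k = theta_dual_seq \<E> c m D i a l B k in
      fst ` ((carrier (GG (c (D (m - k)))) \<times>
               (if k = 1 then B\<^sub>k else (\<lambda>g. a r \<otimes>\<^bsub>G\<^esub> inv\<^bsub>G\<^esub> g \<otimes>\<^bsub>G\<^esub> inv\<^bsub>G\<^esub> (a r)) ` B\<^sub>k))
             \<inter> vertex_group \<E> c (D (m - k)) (D r) (l (m - k), i r)))"

definition theta_dual ::
  "'e partial_alg \<Rightarrow> ('e, 'g, 'i, 'l) coord_choice \<Rightarrow> nat \<Rightarrow> (nat \<Rightarrow> 'e list set set) \<Rightarrow>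
   (nat \<Rightarrow> 'i) \<Rightarrow> (nat \<Rightarrow> 'g) \<Rightarrow> (nat \<Rightarrow> 'l) \<Rightarrow> 'g set \<Rightarrow> 'g set" where
  "theta_dual \<E> c m D i a l B = theta_dual_seq \<E> c m D i a l B m"

text \<open>The set of right cosets of \<open>K\<close> in \<open>H\<close>, for \<open>K \<le> H \<le> G\<close>; its cardinality is the index
  \<open>(H : K)\<close>, which may be infinite. Cardinal identities are therefore stated as equipollences
  with (products of) these sets.\<close>

abbreviation index_set :: "'g monoid \<Rightarrow> 'g set \<Rightarrow> 'g set \<Rightarrow> 'g set set" where
  "index_set G H K \<equiv> rcosets\<^bsub>G\<lparr>carrier := H\<rparr>\<^esub> K"

end

theory Submission
  imports Defs
begin

text \<open>A word is regular in \<open>IG(\<E>)\<close> iff it contains a seed: a letter \<open>e\<close> with \<open>ue \<L> e \<R> ev\<close> for the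
  factorisation \<open>uev\<close> of the word. Having a seed is invariant under the defining relations, and a
  product \<open>xy\<close> with a seed is \<open>\<R>\<close>-related to \<open>x\<close> or \<open>\<L>\<close>-related to \<open>y\<close>. Hence merging adjacent
  seeded blocks of a word into a seeded block is a terminating rewriting system that is confluent
  modulo sliding a letter \<open>e\<close> across a cut, \<open>xe|y \<leftrightarrow> x|ey\<close> with \<open>xe \<R> x\<close> and \<open>ey \<L> y\<close>. The
  normal forms are the minimal r-factorisations, and in Rees coordinates a slide is an edge of the
  contact automaton. So two decompositions represent the same element iff they are linked by
  walks in consecutive contact automata. Stability of the Rees coordinates shows that moving inside
  the \<open>\<R>\<close>-class (\<open>\<L>\<close>-class) of an element changes only its last (first) triple, and the numbers
  in the theorem count the orbits of closed walks on the remaining choices.\<close>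

section \<open>Words modulo the defining relations\<close>

text \<open>Regularity, w = wvw, refers to an unknown v of arbitrary length, so it cannot be
  followed through a single use of a defining relation. A seed is a certificate at one letter of the
  word, and it can. The easy direction, that seeded words are regular, comes early enough to give
  them Rees coordinates, and these yield stability of their \<D>-classes. The converse needs both
  confluence and stability: if the normal form of w had two or more blocks, then w = wvw would force
  the first two of them to merge. The counting rests on one relation \<Gamma> between G_1 and G_m.
  Walks multiply the first group entry on the right and the last one on the left, and \<Gamma>
  records which pairs of such multiplications leave the element fixed. It is a subgroup of the
  product of G_1 with the dual of G_m. The values of \<theta> and its dual at the full groups are
  its projections, those at the trivial groups its fibres over the identity. Equality, \<R> and \<L>
  among the elements of one \<R>-class or \<L>-class then become membership of a quotient in one of
  these four subgroups.\<close>

definition basic_step :: "'e partial_alg \<Rightarrow> 'e list \<Rightarrow> 'e list \<Rightarrow> bool" where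
  "basic_step \<E> u v \<longleftrightarrow> (\<exists>p q e f g. e \<in> carrier \<E> \<and> f \<in> carrier \<E> \<and> g \<in> carrier \<E> \<and>
     pmult \<E> e f = Some g \<and> u = p @ [e, f] @ q \<and> v = p @ [g] @ q)"

text \<open>This is what the seed calculus takes from an ambient semigroup: letters are idempotent,
  and one of the two products of a basic pair is a member of the pair. The second fact makes ef
  \<R>-related to e or \<L>-related to f.\<close>

locale biorder =
  fixes \<E> :: "'e partial_alg"
  assumes pmult_idem: "e \<in> carrier \<E> \<Longrightarrow> pmult \<E> e e = Some e"
    and basic_pair: "\<lbrakk>e \<in> carrier \<E>; f \<in> carrier \<E>; pmult \<E> e f = Some g\<rbrakk>
      \<Longrightarrow> g = e \<or> g = f \<or> pmult \<E> f e = Some e \<or> pmult \<E> f e = Some f"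
begin

text \<open>Letters outside \<open>carrier \<E>\<close> are free generators here, and the empty word is a unit; this
  keeps the word calculus free of side conditions and changes nothing on words over
  \<open>carrier \<E>\<close>.\<close>

definition cong :: "'e list \<Rightarrow> 'e list \<Rightarrow> bool" (infix \<open>\<doteq>\<close> 50) where
  "cong = equivclp (basic_step \<E>)"

lemma cong_refl [simp, intro]: "u \<doteq> u"
  by (simp add: cong_def)

lemma cong_sym: "u \<doteq> v \<Longrightarrow> v \<doteq> u"
  unfolding cong_def by (rule equivclp_sym)

lemma cong_trans [trans]: "u \<doteq> v \<Longrightarrow> v \<doteq> w \<Longrightarrow> u \<doteq> w"
  unfolding cong_def by (rule equivclp_trans)

lemma cong_step: "basic_step \<E> u v \<Longrightarrow> u \<doteq> v"
  unfolding cong_def by (rule r_into_equivclp)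

lemma cong_induct [consumes 1, case_names base fwd bwd]:
  assumes "u \<doteq> v" and "P u"
    and "\<And>v w. u \<doteq> v \<Longrightarrow> P v \<Longrightarrow> basic_step \<E> v w \<Longrightarrow> P w"
    and "\<And>v w. u \<doteq> v \<Longrightarrow> P v \<Longrightarrow> basic_step \<E> w v \<Longrightarrow> P w"
  shows "P v"
  using assms(1) unfolding cong_def
proof (induction rule: equivclp_induct)
  case base
  show ?case by (fact assms(2))
next
  case (step y z)
  then show ?case using assms(3,4) unfolding cong_def by blast
qed

lemma basic_step_context: "basic_step \<E> u v \<Longrightarrow> basic_step \<E> (p @ u @ q) (p @ v @ q)"
  unfolding basic_step_def by (elim exE conjE) (metis append.assoc)

lemma cong_context: "u \<doteq> v \<Longrightarrow> p @ u @ q \<doteq> p @ v @ q"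
  by (induction rule: cong_induct)
    (blast intro: cong_refl cong_trans cong_sym cong_step basic_step_context)+

lemma cong_append: "u \<doteq> v \<Longrightarrow> u' \<doteq> v' \<Longrightarrow> u @ u' \<doteq> v @ v'"
  using cong_context[of u v "[]" u'] cong_context[of u' v' v "[]"] cong_trans by auto

lemma cong_append_left: "u \<doteq> v \<Longrightarrow> p @ u \<doteq> p @ v"
  and cong_append_right: "u \<doteq> v \<Longrightarrow> u @ q \<doteq> v @ q"
  by (auto intro: cong_append)

lemma cong_words: "u \<doteq> v \<Longrightarrow> u \<in> words \<E> \<longleftrightarrow> v \<in> words \<E>"
  by (induction rule: cong_induct) (auto simp: words_def basic_step_def)

lemma cong_set: "u \<doteq> v \<Longrightarrow> set u \<subseteq> carrier \<E> \<longleftrightarrow> set v \<subseteq> carrier \<E>"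
  by (induction rule: cong_induct) (auto simp: basic_step_def)

lemma cong_Nil: "u \<doteq> v \<Longrightarrow> u = [] \<longleftrightarrow> v = []"
  by (induction rule: cong_induct) (auto simp: basic_step_def)

lemma cong_if_ig_cong: "(u, v) \<in> ig_cong \<E> \<Longrightarrow> u \<doteq> v"
proof (induction rule: ig_cong.induct)
  case (basic e f g)
  then have "basic_step \<E> ([] @ [e, f] @ []) ([] @ [g] @ [])"
    unfolding basic_step_def by blast
  then show ?case by (auto intro: cong_step)
qed (auto intro: cong_sym cong_trans cong_append)

text \<open>The empty word is not related to itself by \<open>ig_cong\<close>, so an empty side of
  the context cannot go through the product rule and is split off.\<close>

lemma ig_cong_context:
  assumes "(u, v) \<in> ig_cong \<E>" "p @ u @ q \<in> words \<E>"
  shows "(p @ u @ q, p @ v @ q) \<in> ig_cong \<E>"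
proof -
  have "(p @ u, p @ v) \<in> ig_cong \<E>"
  proof (cases "p = []")
    case False
    then have "(p, p) \<in> ig_cong \<E>" using assms(2) by (intro ig_cong.refl) (auto simp: words_def)
    then show ?thesis using assms(1) by (rule ig_cong.mult)
  qed (use assms(1) in simp)
  then have "((p @ u) @ q, (p @ v) @ q) \<in> ig_cong \<E>"
  proof (cases "q = []")
    case False
    then have "(q, q) \<in> ig_cong \<E>" using assms(2) by (intro ig_cong.refl) (auto simp: words_def)
    with \<open>(p @ u, p @ v) \<in> ig_cong \<E>\<close> show ?thesis by (rule ig_cong.mult)
  qed simp
  then show ?thesis by simp
qed

lemma ig_cong_basic_step:
  assumes "basic_step \<E> v w" "v \<in> words \<E>"
  shows "(v, w) \<in> ig_cong \<E>"
proof -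
  obtain p q e f g where st: "e \<in> carrier \<E>" "f \<in> carrier \<E>" "pmult \<E> e f = Some g" "g \<in> carrier \<E>"
    and v: "v = p @ [e, f] @ q" and w: "w = p @ [g] @ q"
    using assms(1) unfolding basic_step_def by blast
  show ?thesis
    using ig_cong_context[OF ig_cong.basic[OF st], of p q] assms(2) unfolding v w by simp
qed

text \<open>Rewriting preserves membership in \<open>words \<E>\<close> in both directions, so a
  path of basic steps that starts there never meets a foreign letter or the empty word.\<close>

lemma ig_cong_if_cong:
  assumes "u \<doteq> v" "u \<in> words \<E>"
  shows "(u, v) \<in> ig_cong \<E>"
  using assms(1)
proof (induction rule: cong_induct)
  case base
  show ?case using assms(2) by (rule ig_cong.refl)
next
  case (fwd v w)
  have "v \<in> words \<E>" using assms(2) by (simp add: cong_words[OF fwd.hyps(1)])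
  from ig_cong_basic_step[OF fwd.hyps(2) this] show ?case
    by (rule ig_cong.trans[OF fwd.IH])
next
  case (bwd v w)
  have "u \<doteq> w" using cong_trans[OF bwd.hyps(1) cong_sym[OF cong_step[OF bwd.hyps(2)]]] .
  then have "w \<in> words \<E>" using assms(2) by (simp add: cong_words[OF \<open>u \<doteq> w\<close>])
  then have "(w, v) \<in> ig_cong \<E>" by (rule ig_cong_basic_step[OF bwd.hyps(2)])
  then have "(v, w) \<in> ig_cong \<E>" by (rule ig_cong.sym)
  with bwd.IH show ?case by (rule ig_cong.trans)
qed

lemma ig_cong_iff: "u \<in> words \<E> \<Longrightarrow> (u, v) \<in> ig_cong \<E> \<longleftrightarrow> u \<doteq> v"
  using cong_if_ig_cong ig_cong_if_cong by blast

lemma bar_eq_cong: "u \<in> words \<E> \<Longrightarrow> v \<in> words \<E> \<Longrightarrow> bar \<E> u = bar \<E> v \<longleftrightarrow> u \<doteq> v"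
  by (simp add: bar_eq_iff ig_cong_iff)

section \<open>Green's relations on words\<close>

text \<open>The multipliers may be empty, which replaces the adjoined identity in the usual
  definition of Green's relations.\<close>

definition Rw :: "'e list \<Rightarrow> 'e list \<Rightarrow> bool" where
  "Rw u v \<longleftrightarrow> (\<exists>s. u @ s \<doteq> v) \<and> (\<exists>t. v @ t \<doteq> u)"

definition Lw :: "'e list \<Rightarrow> 'e list \<Rightarrow> bool" where
  "Lw u v \<longleftrightarrow> (\<exists>s. s @ u \<doteq> v) \<and> (\<exists>t. t @ v \<doteq> u)"

definition Dw :: "'e list \<Rightarrow> 'e list \<Rightarrow> bool" where
  "Dw u v \<longleftrightarrow> (\<exists>z. Rw u z \<and> Lw z v)"

lemma Rw_sym: "Rw u v \<Longrightarrow> Rw v u" and Lw_sym: "Lw u v \<Longrightarrow> Lw v u"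
  by (auto simp: Rw_def Lw_def)

lemma Rw_cong: "u \<doteq> v \<Longrightarrow> Rw u v" and Lw_cong: "u \<doteq> v \<Longrightarrow> Lw u v"
  unfolding Rw_def Lw_def by (rule conjI; rule exI[of _ "[]"]; simp; erule cong_sym)+

lemma Rw_refl [simp, intro]: "Rw u u" and Lw_refl [simp, intro]: "Lw u u"
  by (auto intro: Rw_cong Lw_cong)

lemma cong_append_right_trans: "u @ s \<doteq> v \<Longrightarrow> v @ t \<doteq> w \<Longrightarrow> u @ s @ t \<doteq> w"
  using cong_append_right[of "u @ s" v t] by (auto intro: cong_trans)

lemma cong_append_left_trans: "s @ u \<doteq> v \<Longrightarrow> t @ v \<doteq> w \<Longrightarrow> (t @ s) @ u \<doteq> w"
  using cong_append_left[of "s @ u" v t] by (auto intro: cong_trans)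

lemma Rw_trans [trans]: "Rw u v \<Longrightarrow> Rw v w \<Longrightarrow> Rw u w"
  unfolding Rw_def by (blast intro: cong_append_right_trans)

lemma Lw_trans [trans]: "Lw u v \<Longrightarrow> Lw v w \<Longrightarrow> Lw u w"
  unfolding Lw_def by (blast intro: cong_append_left_trans)

lemma Rw_append: "Rw u v \<Longrightarrow> Rw (p @ u) (p @ v)"
  unfolding Rw_def using cong_append_left[of _ _ p] by auto

lemma Lw_append: "Lw u v \<Longrightarrow> Lw (u @ q) (v @ q)"
  unfolding Lw_def using cong_append_right[of _ _ q] by fastforce

text \<open>The principal right ideal of uv lies between those of uvw and u, so it collapses with
  them.\<close>

lemma Rw_prefix: "Rw (u @ v @ w) u \<Longrightarrow> Rw (u @ v) u"
  unfolding Rw_def by (auto intro: exI[of _ "w @ _"])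

lemma Lw_suffix: "Lw (w @ v @ u) u \<Longrightarrow> Lw (v @ u) u"
proof -
  assume "Lw (w @ v @ u) u"
  then obtain s where "(s @ w) @ v @ u \<doteq> u" by (auto simp: Lw_def)
  then show "Lw (v @ u) u" unfolding Lw_def by blast
qed

text \<open>Write v = su: then vw = s(uw) \<R> su = v, as \<R> is a left congruence. This moves the
  action of a suffix from one word to any \<L>-related one.\<close>

lemma Rw_transport:
  assumes "Rw (u @ w) u" "Lw u v"
  shows "Rw (v @ w) v"
proof -
  obtain s where s: "s @ u \<doteq> v" using assms(2) by (auto simp: Lw_def)
  have "Rw (v @ w) (s @ u @ w)" using cong_append_right[OF s, of w] by (auto intro: Rw_cong cong_sym)
  also have "Rw (s @ u @ w) (s @ u)" using assms(1) by (rule Rw_append)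
  also have "Rw (s @ u) v" using s by (rule Rw_cong)
  finally show ?thesis .
qed

lemma Lw_transport:
  assumes "Lw (w @ u) u" "Rw u v"
  shows "Lw (w @ v) v"
proof -
  obtain s where s: "u @ s \<doteq> v" using assms(2) by (auto simp: Rw_def)
  have "Lw (w @ v) (w @ u @ s)" using cong_append_left[OF s, of w] by (auto intro: Lw_cong cong_sym)
  also have "Lw (w @ u @ s) (u @ s)" using Lw_append[OF assms(1)] by simp
  also have "Lw (u @ s) v" using s by (rule Lw_cong)
  finally show ?thesis .
qed

text \<open>The fourth corner of the egg box is vt, where t takes z back to u.\<close>

lemma Rw_Lw_commute: "Rw u z \<Longrightarrow> Lw z v \<Longrightarrow> \<exists>y. Lw u y \<and> Rw y v"
proof -
  assume uz: "Rw u z" and zv: "Lw z v"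
  obtain s t where s: "s @ z \<doteq> v" and t: "z @ t \<doteq> u" using uz zv by (auto simp: Rw_def Lw_def)
  have "Lw u (v @ t)"
    by (rule Lw_trans[OF Lw_cong[OF cong_sym[OF t]] Lw_append[OF zv]])
  moreover have "Rw (v @ t) v"
  proof (rule Rw_transport[OF _ zv])
    show "Rw (z @ t) z" using Rw_trans[OF Rw_cong[OF t] uz] .
  qed
  ultimately show ?thesis by blast
qed

lemma Lw_Rw_commute: "Lw u z \<Longrightarrow> Rw z v \<Longrightarrow> \<exists>y. Rw u y \<and> Lw y v"
  using Rw_Lw_commute[OF Rw_sym Lw_sym] Rw_sym Lw_sym by blast

lemma Dw_Rw: "Rw u v \<Longrightarrow> Dw u v" and Dw_Lw: "Lw u v \<Longrightarrow> Dw u v"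
  by (auto simp: Dw_def)

lemma Dw_sym: "Dw u v \<Longrightarrow> Dw v u"
proof -
  assume "Dw u v"
  then obtain z where z: "Rw u z" "Lw z v" by (auto simp: Dw_def)
  obtain y where "Lw u y" "Rw y v" using Rw_Lw_commute[OF z] by blast
  then show "Dw v u" unfolding Dw_def using Rw_sym Lw_sym by blast
qed

lemma Dw_trans: "Dw u v \<Longrightarrow> Dw v w \<Longrightarrow> Dw u w"
proof -
  assume "Dw u v" "Dw v w"
  then obtain y z where yz: "Rw u y" "Lw y v" "Rw v z" "Lw z w" by (auto simp: Dw_def)
  obtain t where "Rw y t" "Lw t z" using Lw_Rw_commute[OF yz(2,3)] by blast
  then show "Dw u w" unfolding Dw_def using Rw_trans[OF yz(1)] Lw_trans[OF _ yz(4)] by blast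
qed

section \<open>Seeds\<close>

text \<open>Such a word is \<D>-related to the letter e, because uev \<L> ev \<R> e; a letter of
  \<open>carrier \<E>\<close> is idempotent.\<close>

definition seed :: "'e list \<Rightarrow> bool" where
  "seed w \<longleftrightarrow> (\<exists>u e v. w = u @ [e] @ v \<and> Lw (u @ [e]) [e] \<and> Rw ([e] @ v) [e])"

lemma seedI: "Lw (u @ [e]) [e] \<Longrightarrow> Rw ([e] @ v) [e] \<Longrightarrow> seed (u @ [e] @ v)"
  unfolding seed_def by blast

lemma seed_letter [simp]: "seed [e]"
  using seedI[of "[]" e "[]"] by simp

lemma letters_cong:
  "\<lbrakk>e \<in> carrier \<E>; f \<in> carrier \<E>; g \<in> carrier \<E>; pmult \<E> e f = Some g\<rbrakk> \<Longrightarrow> [e, f] \<doteq> [g]"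
  by (blast intro: cong_if_ig_cong ig_cong.basic)

text \<open>Expanding the seed letter g into ef keeps a seed because e or f can take over. If ef = e
  or fe = e then ef \<R> e, in the latter case through efe = ee = e, and e is a seed letter; if ef =
  f or fe = f then ef \<L> f and f is one.\<close>

lemma seed_split:
  assumes mem: "e \<in> carrier \<E>" "f \<in> carrier \<E>" "g \<in> carrier \<E>" and ef: "pmult \<E> e f = Some g"
    and L: "Lw (p @ [g]) [g]" and R: "Rw ([g] @ q) [g]"
  shows "seed (p @ [e, f] @ q)"
proof -
  have g: "[e, f] \<doteq> [g]" by (rule letters_cong) (use mem ef in auto)
  have pg: "Lw (p @ [e, f]) [e, f]"
    using Lw_trans[OF Lw_trans[OF Lw_cong[OF cong_append_left[OF g]] L] Lw_sym[OF Lw_cong[OF g]]] .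
  have gq: "Rw ([e, f] @ q) [e, f]"
    using Rw_trans[OF Rw_trans[OF Rw_cong[OF cong_append_right[OF g]] R] Rw_sym[OF Rw_cong[OF g]]] .
  have left: "seed (p @ [e, f] @ q)" if R': "Rw [e, f] [e]"
  proof -
    have "Lw (p @ [e]) [e]" using Lw_transport[OF pg R'] .
    moreover have "Rw ([e] @ [f] @ q) [e]" using Rw_trans[OF gq R'] by simp
    ultimately show ?thesis using seedI[of p e "[f] @ q"] by simp
  qed
  have right: "seed (p @ [e, f] @ q)" if L': "Lw [e, f] [f]"
  proof -
    have "Rw ([f] @ q) [f]" using Rw_transport[OF gq L'] .
    moreover have "Lw ((p @ [e]) @ [f]) [f]" using Lw_trans[OF pg L'] by simp
    ultimately show ?thesis using seedI[of "p @ [e]" f q] by simp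
  qed
  have idem: "[e, e] \<doteq> [e]" "[f, f] \<doteq> [f]"
    using mem by (auto intro: letters_cong pmult_idem)
  consider "g = e" | "g = f" | "pmult \<E> f e = Some e" | "pmult \<E> f e = Some f"
    using basic_pair[OF mem(1,2) ef] by blast
  then show ?thesis
  proof cases
    case 1
    then show ?thesis using g left Rw_cong by blast
  next
    case 2
    then show ?thesis using g right Lw_cong by blast
  next
    case 3
    then have "[f, e] \<doteq> [e]" using mem by (intro letters_cong) auto
    then have "[e, f] @ [e] \<doteq> [e]"
      using cong_append_left[of "[f, e]" "[e]" "[e]"] idem cong_trans by auto
    moreover have "[e] @ [f] \<doteq> [e, f]" by simp
    ultimately show ?thesis by (intro left) (auto simp: Rw_def intro: exI[of _ "[e]"] exI[of _ "[f]"])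
  next
    case 4
    then have "[f, e] \<doteq> [f]" using mem by (intro letters_cong) auto
    then have "[f] @ [e, f] \<doteq> [f]"
      using cong_append_right[of "[f, e]" "[f]" "[f]"] idem cong_trans by auto
    moreover have "[e] @ [f] \<doteq> [e, f]" by simp
    ultimately show ?thesis by (intro right) (auto simp: Lw_def intro: exI[of _ "[e]"] exI[of _ "[f]"])
  qed
qed

text \<open>Everything depends on the side of the cut on which the seed letter lies. If it lies in
  x, the part of the word behind it, and with it all of y, acts within an \<R>-class.\<close>

lemma seed_append_cases:
  assumes "seed (x @ y)"
  shows "(Rw (x @ y) x \<and> seed x) \<or> (Lw (x @ y) y \<and> seed y)"
proof -
  obtain u e v where w: "x @ y = u @ [e] @ v" and L: "Lw (u @ [e]) [e]" and R: "Rw ([e] @ v) [e]"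
    using assms unfolding seed_def by blast
  \<comment> \<open>The word r fills the gap between the seed letter and the cut.\<close>
  consider r where "x = u @ [e] @ r" "v = r @ y" | r where "y = r @ [e] @ v" "u = x @ r"
    using w by (auto simp: append_eq_append_conv2 append_eq_Cons_conv Cons_eq_append_conv)
  then show ?thesis
  proof cases
    case 1
    have r: "Rw ([e] @ r) [e]" using R Rw_prefix 1 by blast
    have "Rw ([e] @ r @ y) ([e] @ r)" using Rw_trans[OF R Rw_sym[OF r]] 1 by simp
    then have "Rw (x @ y) x" using Rw_append[of _ _ u] 1 by fastforce
    then show ?thesis using seedI[OF L r] 1 by simp
  next
    case 2
    have r: "Lw (r @ [e]) [e]" using L Lw_suffix[of x r "[e]"] 2 by simp
    have "Lw (x @ r @ [e]) (r @ [e])" using Lw_trans[OF L Lw_sym[OF r]] 2 by simp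
    then have "Lw (x @ y) y" using Lw_append[of _ _ v] 2 by fastforce
    then show ?thesis using seedI[OF r R] 2 by simp
  qed
qed

text \<open>The seed letter of x stays one. Since x is \<L>-related to its suffix ev, the action of
  y on x can be transported to ev, and evy \<R> ev \<R> e follows.\<close>

lemma seed_extend_right:
  assumes "seed x" "Rw (x @ y) x"
  shows "seed (x @ y)"
proof -
  obtain u e v where x: "x = u @ [e] @ v" and L: "Lw (u @ [e]) [e]" and R: "Rw ([e] @ v) [e]"
    using assms(1) unfolding seed_def by blast
  have "Lw x ([e] @ v)" using Lw_append[OF L] x by simp
  then have "Rw (([e] @ v) @ y) ([e] @ v)" by (rule Rw_transport[OF assms(2)])
  then have "Rw ([e] @ v @ y) [e]" using R Rw_trans by fastforce
  then show ?thesis using seedI[OF L] x by simp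
qed

lemma seed_extend_left:
  assumes "seed x" "Lw (y @ x) x"
  shows "seed (y @ x)"
proof -
  obtain u e v where x: "x = u @ [e] @ v" and L: "Lw (u @ [e]) [e]" and R: "Rw ([e] @ v) [e]"
    using assms(1) unfolding seed_def by blast
  have "Rw x (u @ [e])" using Rw_append[OF R] x by simp
  then have "Lw (y @ u @ [e]) (u @ [e])" by (rule Lw_transport[OF assms(2)])
  then have "Lw ((y @ u) @ [e]) [e]" using L Lw_trans by fastforce
  then show ?thesis using seedI[OF _ R] x by fastforce
qed

text \<open>If the part left or right of the relation carries the seed, the extension lemmas apply,
  since the whole words are congruent. Otherwise the seed letter lies in the rewritten factor: a
  contraction makes g the seed letter, and an expansion is \<open>seed_split\<close>.\<close>

lemma seed_basic_step:
  assumes "basic_step \<E> w w'"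
  shows "seed w \<longleftrightarrow> seed w'"
proof -
  obtain p q e f g where mem: "e \<in> carrier \<E>" "f \<in> carrier \<E>" "g \<in> carrier \<E>"
    and ef: "pmult \<E> e f = Some g" and w: "w = p @ [e, f] @ q" and w': "w' = p @ [g] @ q"
    using assms unfolding basic_step_def by blast
  have g: "[e, f] \<doteq> [g]" by (rule letters_cong) (use mem ef in auto)
  have pq: "p @ [e, f] \<doteq> p @ [g]" "[e, f] @ q \<doteq> [g] @ q" "w \<doteq> w'"
    using g cong_append_left cong_append_right w w' by blast+
  show ?thesis
  proof
    assume "seed w"
    then have "(Rw w p \<and> seed p) \<or> (Lw w ([e, f] @ q) \<and> seed ([e, f] @ q))"
      unfolding w by (rule seed_append_cases)
    then show "seed w'"
    proof (elim disjE conjE)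
      assume "Rw w p" "seed p"
      then show "seed w'"
        unfolding w' using seed_extend_right[of p "[g] @ q"] Rw_trans[OF Rw_sym[OF Rw_cong[OF pq(3)]]] w' by blast
    next
      assume L: "Lw w ([e, f] @ q)" and "seed ([e, f] @ q)"
      then consider "Rw ([e, f] @ q) [e, f]" "seed [e, f]" | "Lw ([e, f] @ q) q" "seed q"
        using seed_append_cases[of "[e, f]" q] by blast
      then show "seed w'"
      proof cases
        case 1
        have "Lw w ([g] @ q)" by (rule Lw_trans[OF L Lw_cong[OF pq(2)]])
        then have L': "Lw w' ([g] @ q)" by (rule Lw_trans[OF Lw_sym[OF Lw_cong[OF pq(3)]]])
        have "Rw ([g] @ q) [g]"
          using Rw_trans[OF Rw_trans[OF Rw_sym[OF Rw_cong[OF pq(2)]] 1(1)] Rw_cong[OF g]] .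
        then have "seed ([g] @ q)" by (rule seed_extend_right[OF seed_letter])
        then show ?thesis using L' unfolding w' by (rule seed_extend_left)
      next
        case 2
        then have "Lw w q" using L Lw_trans by blast
        then have "Lw ((p @ [g]) @ q) q"
          using Lw_trans[OF Lw_sym[OF Lw_cong[OF pq(3)]]] w' by simp
        then show ?thesis using seed_extend_left[OF 2(2), of "p @ [g]"] w' by simp
      qed
    qed
  next
    assume "seed w'"
    then have "(Rw w' p \<and> seed p) \<or> (Lw w' ([g] @ q) \<and> seed ([g] @ q))"
      unfolding w' by (rule seed_append_cases)
    then show "seed w"
    proof (elim disjE conjE)
      assume "Rw w' p" "seed p"
      then show "seed w"
        unfolding w using seed_extend_right[of p "[e, f] @ q"] Rw_trans[OF Rw_cong[OF pq(3)]] w by blast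
    next
      assume L: "Lw w' ([g] @ q)" and "seed ([g] @ q)"
      then consider "Rw ([g] @ q) [g]" | "Lw ([g] @ q) q" "seed q"
        using seed_append_cases[of "[g]" q] by blast
      then show "seed w"
      proof cases
        case 1
        have "Lw (p @ [g]) [g]"
        proof -
          have "Lw (p @ ([g] @ q)) ([g] @ q)" using L w' by simp
          from Lw_transport[OF this 1] show ?thesis .
        qed
        then show ?thesis unfolding w using seed_split[OF mem ef _ 1] by simp
      next
        case 2
        then have "Lw w' q" using L Lw_trans by blast
        then have "Lw ((p @ [e, f]) @ q) q"
          using Lw_trans[OF Lw_cong[OF pq(3)]] w by simp
        then show ?thesis using seed_extend_left[OF 2(2), of "p @ [e, f]"] w by simp
      qed
    qed
  qed
qed

lemma seed_cong: "u \<doteq> v \<Longrightarrow> seed u \<longleftrightarrow> seed v"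
  by (induction rule: cong_induct) (auto simp: seed_basic_step)

text \<open>Together with the \<L>-version this makes having a seed a property of whole
  \<D>-classes, as regularity is.\<close>

lemma seed_Rw: "Rw u v \<Longrightarrow> seed u \<longleftrightarrow> seed v"
proof -
  have "seed v" if uv: "Rw u v" "seed u" for u v
  proof -
    obtain s where s: "u @ s \<doteq> v" using uv(1) by (auto simp: Rw_def)
    then have "Rw (u @ s) u" using Rw_trans[OF Rw_cong[OF s] Rw_sym[OF uv(1)]] by blast
    then show ?thesis using seed_extend_right[OF uv(2)] s seed_cong by blast
  qed
  then show "Rw u v \<Longrightarrow> seed u \<longleftrightarrow> seed v" using Rw_sym by blast
qed

lemma seed_Lw: "Lw u v \<Longrightarrow> seed u \<longleftrightarrow> seed v"
proof -
  have "seed v" if uv: "Lw u v" "seed u" for u v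
  proof -
    obtain s where s: "s @ u \<doteq> v" using uv(1) by (auto simp: Lw_def)
    then have "Lw (s @ u) u" using Lw_trans[OF Lw_cong[OF s] Lw_sym[OF uv(1)]] by blast
    then show ?thesis using seed_extend_left[OF uv(2)] s seed_cong by blast
  qed
  then show "Lw u v \<Longrightarrow> seed u \<longleftrightarrow> seed v" using Lw_sym by blast
qed

lemma seed_Dw: "Dw u v \<Longrightarrow> seed u \<longleftrightarrow> seed v"
  unfolding Dw_def using seed_Lw seed_Rw by blast

lemma seed_not_Nil: "seed w \<Longrightarrow> w \<noteq> []"
  by (auto simp: seed_def)

end

section \<open>Merging blocks\<close>

context biorder
begin

inductive merge1 :: "'e list list \<Rightarrow> 'e list list \<Rightarrow> bool" where
  head: "seed (x @ y) \<Longrightarrow> merge1 (x # y # q) ((x @ y) # q)"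
| tail: "merge1 q q' \<Longrightarrow> merge1 (x # q) (x # q')"

text \<open>The side conditions keep the left block in its \<R>-class and the right block in its
  \<L>-class. These classes decide whether the left block merges with its left neighbour and the
  right block with its right neighbour, so a slide never changes which merges are possible.\<close>

inductive slide1 :: "'e list list \<Rightarrow> 'e list list \<Rightarrow> bool" where
  same: "x \<doteq> x' \<Longrightarrow> slide1 (x # q) (x' # q)"
| right: "\<lbrakk>x \<doteq> x' @ [e]; y' \<doteq> [e] @ y; Rw x x'; Lw y y'\<rbrakk> \<Longrightarrow> slide1 (x # y # q) (x' # y' # q)"
| left: "\<lbrakk>x' \<doteq> x @ [e]; y \<doteq> [e] @ y'; Rw x x'; Lw y y'\<rbrakk> \<Longrightarrow> slide1 (x # y # q) (x' # y' # q)"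
| tail: "slide1 q q' \<Longrightarrow> slide1 (x # q) (x # q')"

abbreviation merge :: "'e list list \<Rightarrow> 'e list list \<Rightarrow> bool" where
  "merge \<equiv> merge1\<^sup>*\<^sup>*"

abbreviation slide :: "'e list list \<Rightarrow> 'e list list \<Rightarrow> bool" where
  "slide \<equiv> slide1\<^sup>*\<^sup>*"

definition irred :: "'e list list \<Rightarrow> bool" where
  "irred xs \<longleftrightarrow> (\<nexists>ys. merge1 xs ys)"

inductive_cases merge1_ConsE [consumes 1, case_names head tail]: "merge1 (x # q) z"
inductive_cases merge1_NilE: "merge1 [] z"
inductive_cases slide1_ConsE [consumes 1, case_names same right left tail]: "slide1 (x # q) z"

lemma slide1_sym: "slide1 xs ys \<Longrightarrow> slide1 ys xs"
  by (induction rule: slide1.induct) (auto intro: slide1.intros cong_sym Rw_sym Lw_sym)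

lemma slide_sym: "slide xs ys \<Longrightarrow> slide ys xs"
  by (induction rule: rtranclp_induct)
    (auto intro: converse_rtranclp_into_rtranclp slide1_sym)

lemma slide_Cons: "slide q q' \<Longrightarrow> slide (x # q) (x # q')"
  by (induction rule: rtranclp_induct) (auto intro: slide1.tail rtranclp.rtrancl_into_rtrancl)

lemma slide_same: "x \<doteq> x' \<Longrightarrow> slide (x # q) (x' # q)"
  by (rule r_into_rtranclp) (rule slide1.same)

lemma slide_length: "slide xs ys \<Longrightarrow> length ys = length xs"
proof (induction rule: rtranclp_induct)
  case (step y z)
  have "slide1 y z \<Longrightarrow> length z = length y" by (induction rule: slide1.induct) auto
  with step show ?case by simp
qed simp

text \<open>This is the invariance of the \<D>-fingerprint under slides.\<close>

lemma slide_Dw: "slide xs ys \<Longrightarrow> list_all2 Dw xs ys"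
proof (induction rule: rtranclp_induct)
  case base
  then show ?case by (simp add: list_all2_refl Dw_Rw)
next
  case (step y z)
  from step.hyps(2) have "list_all2 Dw y z"
  proof (induction rule: slide1.induct)
    case (same x x' q)
    then show ?case using Dw_Rw[OF Rw_cong] by (simp add: list_all2_refl Dw_Rw)
  next
    case (right x x' e y' y q)
    then show ?case by (simp add: list_all2_refl Dw_Rw) (blast intro: Dw_Lw)
  next
    case (left x' x e y y' q)
    then show ?case by (simp add: list_all2_refl Dw_Rw) (blast intro: Dw_Lw)
  next
    case (tail q q' x)
    then show ?case by (simp add: Dw_Rw)
  qed
  with step.IH show ?case by (rule list_all2_trans[rotated]) (rule Dw_trans)
qed

text \<open>The last letter of y crosses the cut first. The prefix and suffix lemmas supply the
  \<R>- and \<L>-conditions for every intermediate position of the cut.\<close>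

lemma slide_word:
  assumes "Rw (x @ y) x" "Lw (y @ z) z"
  shows "slide ((x @ y) # z # q) (x # (y @ z) # q)"
  using assms
proof (induction y arbitrary: z rule: rev_induct)
  case (snoc e y)
  have R: "Rw (x @ y) x" using snoc.prems(1) Rw_prefix[of x y "[e]"] by simp
  have "Lw ([e] @ z) z" using snoc.prems(2) Lw_suffix[of y "[e]" z] by simp
  note L = this Lw_trans[OF snoc.prems(2) Lw_sym[OF this]]
  have "slide1 ((x @ y @ [e]) # z # q) ((x @ y) # ([e] @ z) # q)"
  proof (rule slide1.right)
    show "Rw (x @ y @ [e]) (x @ y)" by (rule Rw_trans[OF snoc.prems(1) Rw_sym[OF R]])
    show "Lw z ([e] @ z)" by (rule Lw_sym[OF L(1)])
  qed auto
  moreover have "slide ((x @ y) # ([e] @ z) # q) (x # (y @ [e] @ z) # q)"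
    by (rule snoc.IH[OF R]) (use L(2) in simp)
  ultimately show ?case by (simp add: converse_rtranclp_into_rtranclp)
qed simp

text \<open>If the two blocks of the slide are merged with each other, the result is the same up to
  congruence. If one of them is merged with an outer neighbour, the \<R>- or \<L>-condition keeps
  the seed and the same letter slides afterwards. Other merges do not interact with the
  slide.\<close>

lemma slide1_merge1:
  assumes "slide1 xs ys" "merge1 xs z"
  shows "\<exists>z'. merge1 ys z' \<and> slide z z'"
  using assms
proof (induction arbitrary: z rule: slide1.induct)
  case (same x x' q)
  from same.prems show ?case
  proof (cases rule: merge1_ConsE)
    case (head y r)
    have c: "x @ y \<doteq> x' @ y" using same.hyps by (rule cong_append_right)
    then have "seed (x' @ y)" using head seed_cong by blast
    then show ?thesis using head slide_same[OF c] merge1.head by blast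
  next
    case (tail q')
    then show ?thesis using slide_same[OF same.hyps] merge1.tail by blast
  qed
next
  case (right x x' e y' y q)
  from right.prems show ?case
  proof (cases rule: merge1_ConsE)
    case (head y0 r)
    have "x @ y \<doteq> x' @ [e] @ y" using cong_append_right[OF right.hyps(1), of y] by simp
    also have "\<dots> \<doteq> x' @ y'" using right.hyps(2) by (intro cong_append_left) (rule cong_sym)
    finally have c: "x @ y \<doteq> x' @ y'" .
    then have "seed (x' @ y')" using head seed_cong by blast
    then show ?thesis using head slide_same[OF c] merge1.head by blast
  next
    case (tail q')
    from tail(2) show ?thesis
    proof (cases rule: merge1_ConsE)
      case (head v r)
      have L: "Lw (y @ v) (y' @ v)" using right.hyps(4) by (rule Lw_append)
      then have "seed (y' @ v)" using head seed_Lw by blast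
      then have "merge1 (x' # y' # q) (x' # (y' @ v) # r)"
        using head merge1.intros by blast
      moreover have "y' @ v \<doteq> [e] @ y @ v"
        using cong_append_right[OF right.hyps(2), of v] by simp
      then have "slide1 z (x' # (y' @ v) # r)"
        unfolding tail head using right.hyps(1,3) L by (intro slide1.right)
      ultimately show ?thesis by blast
    next
      case (tail r)
      then show ?thesis using slide1.right[OF right.hyps, of r] merge1.tail[OF merge1.tail, of q r x' y']
        \<open>z = x # q'\<close> by blast
    qed
  qed
next
  case (left x' x e y y' q)
  from left.prems show ?case
  proof (cases rule: merge1_ConsE)
    case (head y0 r)
    have "x @ y \<doteq> x @ [e] @ y'" using left.hyps(2) by (rule cong_append_left)
    also have "\<dots> \<doteq> x' @ y'" using cong_append_right[OF cong_sym[OF left.hyps(1)], of y'] by simp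
    finally have c: "x @ y \<doteq> x' @ y'" .
    then have "seed (x' @ y')" using head seed_cong by blast
    then show ?thesis using head slide_same[OF c] merge1.head by blast
  next
    case (tail q')
    from tail(2) show ?thesis
    proof (cases rule: merge1_ConsE)
      case (head v r)
      have L: "Lw (y @ v) (y' @ v)" using left.hyps(4) by (rule Lw_append)
      then have "seed (y' @ v)" using head seed_Lw by blast
      then have "merge1 (x' # y' # q) (x' # (y' @ v) # r)"
        using head merge1.intros by blast
      moreover have "y @ v \<doteq> [e] @ y' @ v"
        using cong_append_right[OF left.hyps(2), of v] by simp
      then have "slide1 z (x' # (y' @ v) # r)"
        unfolding tail head using left.hyps(1,3) L by (intro slide1.left)
      ultimately show ?thesis by blast
    next
      case (tail r)
      then show ?thesis using slide1.left[OF left.hyps, of r] merge1.tail[OF merge1.tail, of q r x' y']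
        \<open>z = x # q'\<close> by blast
    qed
  qed
next
  case (tail q q' x)
  from tail.prems show ?case
  proof (cases rule: merge1_ConsE)
    case (head y r)
    have ex: "\<exists>z'. merge1 (x # q') z' \<and> slide z z'"
      if q': "q' = y' # r'" and R: "Rw y y'" and sl: "slide1 ((x @ y) # r) ((x @ y') # r')" for y' r'
    proof -
      have "seed (x @ y')" using head(3) seed_Rw[OF Rw_append[OF R]] by blast
      then show ?thesis using q' sl head(2) merge1.head by blast
    qed
    from tail.hyps[unfolded head(1)] show ?thesis
    proof (cases rule: slide1_ConsE)
      case (same y')
      then show ?thesis
        using ex Rw_cong slide1.same[OF cong_append_left] by blast
    next
      case (right y' e v' v s)
      have c: "x @ y \<doteq> (x @ y') @ [e]" using cong_append_left[OF right(3), of x] by simp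
      have "slide1 ((x @ y) # v # s) ((x @ y') # v' # s)"
        by (rule slide1.right[OF c _ Rw_append[OF right(5)] right(6)]) (use right(4) in simp)
      then show ?thesis using ex[OF right(2) right(5)] right(1) by blast
    next
      case (left y' e v v' s)
      have c: "x @ y' \<doteq> (x @ y) @ [e]" using cong_append_left[OF left(3), of x] by simp
      have "slide1 ((x @ y) # v # s) ((x @ y') # v' # s)"
        by (rule slide1.left[OF c _ Rw_append[OF left(5)] left(6)]) (use left(4) in simp)
      then show ?thesis using ex[OF left(2) left(5)] left(1) by blast
    next
      case (tail r')
      then show ?thesis using ex slide1.tail by blast
    qed
  next
    case inner: (tail r)
    obtain z' where "merge1 q' z'" "slide r z'" using tail.IH[OF inner(2)] by blast
    then show ?thesis using inner(1) merge1.tail slide_Cons by blast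
  qed
qed

lemma slide_merge1:
  assumes "slide xs ys" "merge1 xs z"
  shows "\<exists>z'. merge1 ys z' \<and> slide z z'"
  using assms(1)
proof (induction rule: rtranclp_induct)
  case base
  then show ?case using assms(2) by blast
next
  case (step y y')
  then obtain z1 where z1: "merge1 y z1" "slide z z1" by blast
  obtain z2 where "merge1 y' z2" "slide z1 z2" using slide1_merge1[OF step.hyps(2) z1(1)] by blast
  then show ?case using rtranclp_trans[OF z1(2)] by blast
qed

section \<open>Confluence modulo slides\<close>

definition joinable :: "'e list list \<Rightarrow> 'e list list \<Rightarrow> bool" where
  "joinable xs ys \<longleftrightarrow> slide xs ys \<or> (\<exists>xs' ys'. merge1 xs xs' \<and> merge1 ys ys' \<and> slide xs' ys')"

lemma joinable_sym: "joinable xs ys \<Longrightarrow> joinable ys xs"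
  unfolding joinable_def using slide_sym by blast

text \<open>The overlapping merges \<open>xy|v\<close> and \<open>x|yv\<close>: either \<open>xyv\<close> is again seeded, or \<open>y\<close> acts
  within the \<open>\<R>\<close>-class of \<open>x\<close> and the \<open>\<L>\<close>-class of \<open>v\<close> and can be slid across letter by
  letter.\<close>

lemma joinable_overlap:
  assumes xy: "seed (x @ y)" and yv: "seed (y @ v)"
  shows "joinable ((x @ y) # v # q) (x # (y @ v) # q)"
proof -
  have join: ?thesis if "seed (x @ y @ v)"
    using that merge1.head[of "x @ y" v q] merge1.head[of x "y @ v" q] by (auto simp: joinable_def)
  consider "Lw (x @ y) y" | "Rw (y @ v) y" | "Rw (x @ y) x" "Lw (y @ v) v"
    using seed_append_cases[OF xy] seed_append_cases[OF yv] by blast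
  then show ?thesis
  proof cases
    case 1
    then have "Lw (x @ y @ v) (y @ v)" using Lw_append[OF 1, of v] by simp
    then show ?thesis using join yv seed_Lw by blast
  next
    case 2
    then have "Rw (x @ y @ v) (x @ y)" by (rule Rw_append)
    then show ?thesis using join xy seed_Rw by blast
  next
    case 3
    then show ?thesis using slide_word by (simp add: joinable_def)
  qed
qed

text \<open>Merges that share no block commute. Those that share a block are the overlaps treated in
  \<open>joinable_overlap\<close>.\<close>

lemma joinable_peak: "merge1 xs ys \<Longrightarrow> merge1 xs zs \<Longrightarrow> joinable ys zs"
proof (induction arbitrary: zs rule: merge1.induct)
  case (head x y q)
  from head.prems show ?case
  proof (cases rule: merge1_ConsE)
    case (head y' q')
    then show ?thesis by (simp add: joinable_def)
  next
    case (tail r)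
    from tail(2) show ?thesis
    proof (cases rule: merge1_ConsE)
      case inner: (head v q')
      then show ?thesis using joinable_overlap[OF head.hyps] tail by simp
    next
      case inner: (tail q')
      then have "merge1 ((x @ y) # q) ((x @ y) # q')" "merge1 zs ((x @ y) # q')"
        using tail head.hyps merge1.intros by blast+
      then show ?thesis unfolding joinable_def by blast
    qed
  qed
next
  case (tail q q' x)
  from tail.prems show ?case
  proof (cases rule: merge1_ConsE)
    case (head y r)
    from tail.hyps[unfolded head(1)] show ?thesis
    proof (cases rule: merge1_ConsE)
      case inner: (head v s)
      then show ?thesis using joinable_overlap[of x y v s] head joinable_sym by simp
    next
      case inner: (tail s)
      then have "merge1 (x # q') ((x @ y) # s)" "merge1 zs ((x @ y) # s)"
        using head merge1.intros by blast+
      then show ?thesis unfolding joinable_def by blast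
    qed
  next
    case inner: (tail r)
    have "joinable q' r" by (rule tail.IH[OF inner(2)])
    then show ?thesis unfolding inner joinable_def using slide_Cons merge1.tail by blast
  qed
qed

lemma merge1_length: "merge1 xs ys \<Longrightarrow> length xs = Suc (length ys)"
  by (induction rule: merge1.induct) auto

lemma merge1_concat: "merge1 xs ys \<Longrightarrow> concat ys = concat xs"
  by (induction rule: merge1.induct) auto

lemma merge_concat: "merge xs ys \<Longrightarrow> concat ys = concat xs"
  by (induction rule: rtranclp_induct) (auto simp: merge1_concat)

lemma irred_exists: "\<exists>ys. merge xs ys \<and> irred ys"
proof (induction "length xs" arbitrary: xs rule: less_induct)
  case less
  show ?case
  proof (cases "irred xs")
    case False
    then obtain zs where z: "merge1 xs zs" by (auto simp: irred_def)
    then obtain ys where "merge zs ys" "irred ys" using less merge1_length by force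
    then show ?thesis using converse_rtranclp_into_rtranclp[of merge1, OF z] by blast
  qed blast
qed

lemma merge_irred: "merge xs ys \<Longrightarrow> irred xs \<Longrightarrow> ys = xs"
  by (erule converse_rtranclpE) (auto simp: irred_def)

text \<open>Newman's lemma modulo the slide equivalence. Each merge shortens the list by one, so
  induction on its length replaces a termination argument.\<close>

lemma merge_irred_unique:
  "\<lbrakk>slide xs ys; merge xs as; irred as; merge ys bs; irred bs\<rbrakk> \<Longrightarrow> slide as bs"
proof (induction "length xs" arbitrary: xs ys as bs rule: less_induct)
  case less
  have IH: "slide as' bs'"
    if "length xs' < length xs" "slide xs' ys'" "merge xs' as'" "irred as'" "merge ys' bs'" "irred bs'"
    for xs' ys' as' bs' using less.hyps that by blast
  show ?case
  proof (cases "irred xs")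
    case True
    then have "irred ys"
      using slide_merge1[OF slide_sym[OF less.prems(1)]] by (auto simp: irred_def)
    then show ?thesis
      using merge_irred[OF less.prems(2) True] merge_irred[OF less.prems(4)] less.prems(1) by simp
  next
    case False
    then have "\<not> irred ys" using slide_merge1[OF less.prems(1)] by (auto simp: irred_def)
    then have "ys \<noteq> bs" "xs \<noteq> as" using False less.prems by blast+
    then obtain x1 y1 where x1: "merge1 xs x1" "merge x1 as" and y1: "merge1 ys y1" "merge y1 bs"
      using converse_rtranclpE[OF less.prems(2)] converse_rtranclpE[OF less.prems(4)] by metis
    \<comment> \<open>The first merge of \<open>ys\<close> is mirrored at \<open>xs\<close>, so that
      both merges start from the same list and local confluence applies.\<close>
    obtain x2 where x2: "merge1 xs x2" "slide y1 x2"
      using slide_merge1[OF slide_sym[OF less.prems(1)] y1(1)] by blast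
    have len: "length x1 < length xs" "length x2 < length xs"
      using merge1_length x1(1) x2(1) by fastforce+
    from joinable_peak[OF x1(1) x2(1)] show ?thesis
      unfolding joinable_def
    proof (elim disjE exE conjE)
      assume "slide x1 x2"
      then have "slide x1 y1" by (rule rtranclp_trans[OF _ slide_sym[OF x2(2)]])
      then show ?thesis using IH[OF len(1) _ x1(2) less.prems(3) y1(2) less.prems(5)] by blast
    next
      fix u v
      assume uv: "merge1 x1 u" "merge1 x2 v" "slide u v"
      obtain u' v' where u': "merge u u'" "irred u'" and v': "merge v v'" "irred v'"
        using irred_exists by blast
      have "slide as u'"
        by (rule IH[OF len(1) rtranclp.rtrancl_refl x1(2) less.prems(3)
              converse_rtranclp_into_rtranclp[of merge1, OF uv(1) u'(1)] u'(2)])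
      also have "slide u' v'"
        using IH[OF _ uv(3) u' v'] len(1) merge1_length[OF uv(1)] by simp
      also have "slide v' bs"
        by (rule IH[OF len(2) slide_sym[OF x2(2)] converse_rtranclp_into_rtranclp[of merge1, OF uv(2) v'(1)]
              v'(2) y1(2) less.prems(5)])
      finally show ?thesis .
    qed
  qed
qed

section \<open>Normal forms of words\<close>

definition singles :: "'e list \<Rightarrow> 'e list list" where
  "singles w = map (\<lambda>e. [e]) w"

lemma concat_singles [simp]: "concat (singles w) = w"
  by (induction w) (auto simp: singles_def)

lemma merge_Cons: "merge q q' \<Longrightarrow> merge (x # q) (x # q')"
  by (induction rule: rtranclp_induct) (auto intro: merge1.tail rtranclp.rtrancl_into_rtrancl)

lemma merge_append_left: "merge q q' \<Longrightarrow> merge (p @ q) (p @ q')"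
  by (induction p) (auto intro: merge_Cons)

lemma merge_seeds: "merge xs ys \<Longrightarrow> \<forall>x\<in>set xs. seed x \<Longrightarrow> \<forall>y\<in>set ys. seed y"
proof (induction rule: rtranclp_induct)
  case (step y z)
  have "merge1 y z \<Longrightarrow> \<forall>x\<in>set y. seed x \<Longrightarrow> \<forall>y\<in>set z. seed y"
    by (induction rule: merge1.induct) auto
  with step show ?case by blast
qed

text \<open>Build the block outwards from its seed letter. Removing the last letter behind the seed,
  or the first letter before it, leaves a seeded word, so each merge on the way is legal.\<close>

lemma merge_singles_seed: "seed x \<Longrightarrow> merge (singles x @ q) (x # q)"
proof (induction "length x" arbitrary: x q rule: less_induct)
  case less
  obtain u e v where x: "x = u @ [e] @ v" and L: "Lw (u @ [e]) [e]" and R: "Rw ([e] @ v) [e]"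
    using less.prems unfolding seed_def by blast
  consider f v' where "v = v' @ [f]" | f u' where "v = []" "u = f # u'" | "u = []" "v = []"
    by (metis list.exhaust rev_exhaust)
  then show ?case
  proof cases
    case 1
    have "seed (u @ [e] @ v')"
      using seedI[OF L Rw_prefix] R 1 by blast
    then have "merge (singles (u @ [e] @ v') @ [f] # q) ((u @ [e] @ v') # [f] # q)"
      using less.hyps x 1 by simp
    moreover have "merge1 ((u @ [e] @ v') # [f] # q) (x # q)"
      using merge1.head[of "u @ [e] @ v'" "[f]" q] less.prems x 1 by simp
    ultimately show ?thesis
      using x 1 by (simp add: singles_def rtranclp.rtrancl_into_rtrancl)
  next
    case 2
    have "Lw (u' @ [e]) [e]" using Lw_suffix[of "[f]" u' "[e]"] L 2 by simp
    then have "seed (u' @ [e])" using seedI[of u' e "[]"] by simp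
    then have "merge (singles (u' @ [e]) @ q) ((u' @ [e]) # q)"
      using less.hyps x 2 by simp
    then have "merge ([f] # singles (u' @ [e]) @ q) ([f] # (u' @ [e]) # q)" by (rule merge_Cons)
    moreover have "merge1 ([f] # (u' @ [e]) # q) (x # q)"
      using merge1.head[of "[f]" "u' @ [e]" q] less.prems x 2 by simp
    ultimately show ?thesis
      using x 2 by (simp add: singles_def rtranclp.rtrancl_into_rtrancl)
  next
    case 3
    then show ?thesis using x by (simp add: singles_def)
  qed
qed

lemma merge_singles: "\<forall>x\<in>set xs. seed x \<Longrightarrow> merge (singles (concat xs)) xs"
proof (induction xs)
  case (Cons x xs)
  have "merge (singles x @ singles (concat xs)) (x # singles (concat xs))"
    using Cons.prems by (intro merge_singles_seed) simp
  also have "merge \<dots> (x # xs)" using Cons by (intro merge_Cons) simp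
  finally show ?case by (simp add: singles_def)
qed (simp add: singles_def)

text \<open>The letters e and f may be merged, because ef is congruent to the letter g; the merged
  block then becomes g by a slide of kind \<open>same\<close>. So both lists of letters lead to the
  same normal form up to slides.\<close>

lemma singles_basic_step:
  assumes "basic_step \<E> v w" "merge (singles v) as" "irred as" "merge (singles w) bs" "irred bs"
  shows "slide as bs"
proof -
  obtain p q e f g where ef: "[e, f] \<doteq> [g]" and v: "v = p @ [e, f] @ q" and w: "w = p @ [g] @ q"
    using assms(1) letters_cong unfolding basic_step_def by blast
  have "seed ([e] @ [f])" using seed_cong[OF ef] by simp
  then have "merge1 ([e] # [f] # singles q) (([e] @ [f]) # singles q)" by (rule merge1.head)
  then have m: "merge (singles v) (singles p @ [e, f] # singles q)"
    using merge_append_left[of "[e] # [f] # singles q" "[e, f] # singles q" "singles p"]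
    by (simp add: v singles_def r_into_rtranclp)
  have s: "slide (singles p @ [e, f] # singles q) (singles w)"
    using slide_same[OF ef, of "singles q"]
    by (simp add: w singles_def) (induction p; simp add: slide_Cons)
  obtain cs where cs: "merge (singles p @ [e, f] # singles q) cs" "irred cs"
    using irred_exists by blast
  have "slide as cs"
    by (rule merge_irred_unique[OF rtranclp.rtrancl_refl assms(2,3) rtranclp_trans[OF m cs(1)] cs(2)])
  also have "slide cs bs" by (rule merge_irred_unique[OF s cs assms(4,5)])
  finally show ?thesis .
qed

text \<open>A list of seeded blocks can be built from its letters, so an irreducible one is a normal
  form of the underlying word. Along a path of basic steps this normal form changes only by
  slides.\<close>

theorem irred_unique:
  assumes "concat xs \<doteq> concat ys" "\<forall>x\<in>set xs. seed x" "\<forall>y\<in>set ys. seed y" "irred xs" "irred ys"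
  shows "slide xs ys"
proof -
  \<comment> \<open>All normal forms of the current word are covered, since a basic step gives no
    control over which one is reached.\<close>
  have "\<forall>bs. merge (singles w) bs \<longrightarrow> irred bs \<longrightarrow> slide xs bs" if "concat xs \<doteq> w" for w
    using that
  proof (induction rule: cong_induct)
    case base
    then show ?case using merge_irred_unique merge_singles[OF assms(2)] assms(4) by blast
  next
    case (fwd v w)
    obtain as where as: "merge (singles v) as" "irred as" using irred_exists by blast
    then have "slide xs as" using fwd.IH by blast
    then show ?case
      using rtranclp_trans[OF _ singles_basic_step[OF fwd.hyps(2) as]] by blast
  next
    case (bwd v w)
    obtain as where as: "merge (singles v) as" "irred as" using irred_exists by blast
    then have "slide xs as" using bwd.IH by blast
    then show ?case
      using rtranclp_trans[OF _ slide_sym[OF singles_basic_step[OF bwd.hyps(2) _ _ as]]] by blast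
  qed
  from this[OF assms(1)] show ?thesis using merge_singles[OF assms(3)] assms(5) by blast
qed

lemma irred_Cons_Cons: "irred (x # y # q) \<longleftrightarrow> \<not> seed (x @ y) \<and> irred (y # q)"
  unfolding irred_def by (auto intro: merge1.intros elim: merge1_ConsE)

lemma irred_single [simp]: "irred [x]"
  unfolding irred_def by (auto elim: merge1_ConsE merge1_NilE)

lemma irred_Nil [simp]: "irred []"
  unfolding irred_def by (auto elim: merge1_NilE)

lemma irred_iff: "irred xs \<longleftrightarrow> (\<forall>k. Suc k < length xs \<longrightarrow> \<not> seed (xs ! k @ xs ! Suc k))"
proof (induction xs)
  case (Cons x xs)
  have all_nat: "(\<forall>k. P k) \<longleftrightarrow> P 0 \<and> (\<forall>k. P (Suc k))" for P
    by (metis not0_implies_Suc)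
  show ?case
  proof (cases xs)
    case (Cons y q)
    have "(\<forall>k. Suc k < length (x # xs) \<longrightarrow> \<not> seed ((x # xs) ! k @ (x # xs) ! Suc k)) \<longleftrightarrow>
      \<not> seed (x @ y) \<and> (\<forall>k. Suc k < length xs \<longrightarrow> \<not> seed (xs ! k @ xs ! Suc k))"
      unfolding all_nat[of "\<lambda>k. Suc k < length (x # xs) \<longrightarrow> _ k"] by (simp add: Cons)
    then show ?thesis using Cons Cons.IH irred_Cons_Cons by simp
  qed simp
qed simp

text \<open>Otherwise the one-block list would be a second normal form of the same word, while
  slides preserve the number of blocks.\<close>

lemma irred_not_seed:
  assumes "irred xs" "\<forall>x\<in>set xs. seed x" "length xs \<noteq> 1"
  shows "\<not> seed (concat xs)"
proof
  assume "seed (concat xs)"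
  then have "slide xs [concat xs]" using assms by (intro irred_unique) auto
  then show False using slide_length assms(3) by fastforce
qed

text \<open>Recording which original blocks make up each merged block lets the \<D>-classes of two
  normal forms be compared position by position.\<close>

lemma merge_partition:
  assumes "merge xs ys"
  shows "\<exists>pss. xs = concat pss \<and> ys = map concat pss \<and> [] \<notin> set pss"
  using assms
proof (induction rule: rtranclp_induct)
  case base
  show ?case by (rule exI[of _ "map (\<lambda>x. [x]) xs"]) (auto simp: o_def)
next
  case (step y z)
  have "\<exists>pss'. concat pss' = concat pss \<and> z = map concat pss' \<and> [] \<notin> set pss'"
    if "merge1 y z" "y = map concat pss" "[] \<notin> set pss" for pss
    using that
  proof (induction arbitrary: pss rule: merge1.induct)
    case (head u v q)
    then obtain a b r where "pss = a # b # r" "u = concat a" "v = concat b" "q = map concat r"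
      by (auto simp: Cons_eq_map_conv)
    then show ?case using head.prems by (intro exI[of _ "(a @ b) # r"]) auto
  next
    case (tail q q' u)
    then obtain a r where a: "pss = a # r" "u = concat a" "q = map concat r" by auto
    then obtain r' where "concat r' = concat r" "q' = map concat r'" "[] \<notin> set r'"
      using tail by auto
    then show ?case using a tail.prems by (intro exI[of _ "a # r'"]) auto
  qed
  with step show ?case by metis
qed

end

section \<open>Stability\<close>

text \<open>Stability of the \<D>-classes of seeded words: a multiple that stays in the \<D>-class
  stays in the \<R>-class or \<L>-class. It is isolated here from the coordinates that provide it
  later.\<close>

locale stable_biorder = biorder +
  assumes stable_R: "\<lbrakk>seed w; w \<in> words \<E>; Dw w (w @ t)\<rbrakk> \<Longrightarrow> Rw (w @ t) w"
    and stable_L: "\<lbrakk>seed w; w \<in> words \<E>; Dw w (t @ w)\<rbrakk> \<Longrightarrow> Lw (t @ w) w"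
begin

text \<open>The groups are as many as the blocks of \<open>xs\<close> and have the same
  \<D>-classes. By stability the group starting with x is \<R>-related to x, so it cannot also
  contain the next block y, or xy would be seeded. Hence every group but the last is a single block,
  and the last one absorbs all of \<open>zs\<close>.\<close>

lemma partition_last:
  assumes "irred xs" "\<forall>x\<in>set xs. seed x \<and> x \<in> words \<E>" "xs \<noteq> []" "concat pss = xs @ zs"
    "[] \<notin> set pss" "list_all2 Dw xs (map concat pss)"
  shows "Rw (last xs @ concat zs) (last xs)"
  using assms
proof (induction xs arbitrary: pss)
  case (Cons x xs)
  then obtain ps pss' where pss: "pss = ps # pss'" "Dw x (concat ps)" "list_all2 Dw xs (map concat pss')"
    by (auto simp: list_all2_Cons1 map_eq_Cons_conv)
  then obtain ps' where ps: "ps = x # ps'"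
    using Cons.prems(4,5) by (cases ps) auto
  have R: "Rw (x @ concat ps') x"
    using stable_R[of x "concat ps'"] Cons.prems(2) pss ps by simp
  show ?case
  proof (cases xs)
    case Nil
    then show ?thesis using pss ps Cons.prems(4) R by simp
  next
    case (Cons y q)
    \<comment> \<open>A further block in this group would have to be y, and then xy \<R> x
      contradicts irreducibility.\<close>
    have "ps' = []"
    proof (rule ccontr)
      assume "ps' \<noteq> []"
      then obtain r where "ps' = y # r" using Cons.prems(4) pss ps Cons by (cases ps') auto
      then have "Rw (x @ y) x" using R Rw_prefix by simp
      then have "seed (x @ y)" using Cons.prems(2) seed_Rw by simp
      then show False using Cons.prems(1) Cons by (simp add: irred_Cons_Cons)
    qed
    then show ?thesis using Cons.IH[of pss'] Cons.prems pss ps Cons by (simp add: irred_Cons_Cons)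
  qed
qed simp

lemma irred_snoc_snoc: "irred (q @ [x, y]) \<longleftrightarrow> irred (q @ [x]) \<and> \<not> seed (x @ y)"
proof (induction q)
  case (Cons z q)
  then show ?case by (cases q) (auto simp: irred_Cons_Cons)
qed (simp add: irred_Cons_Cons)

text \<open>The mirror image, read from the right end: here the first block absorbs
  \<open>zs\<close>.\<close>

lemma partition_first:
  assumes "irred xs" "\<forall>x\<in>set xs. seed x \<and> x \<in> words \<E>" "xs \<noteq> []" "concat pss = zs @ xs"
    "[] \<notin> set pss" "list_all2 Dw xs (map concat pss)"
  shows "Lw (concat zs @ hd xs) (hd xs)"
  using assms
proof (induction xs arbitrary: pss rule: rev_induct)
  case (snoc x xs)
  obtain pss' ps where pss: "pss = pss' @ [ps]" "Dw x (concat ps)" "list_all2 Dw xs (map concat pss')"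
  proof (cases pss rule: rev_cases)
    case Nil
    then show ?thesis using snoc.prems(6) by simp
  next
    case (snoc pss' ps)
    then show ?thesis
      using snoc.prems(6) that list_all2_lengthD[OF snoc.prems(6)]
      by (auto simp: list_all2_append)
  qed
  then obtain ps' where ps: "ps = ps' @ [x]"
    using snoc.prems(4,5) by (cases ps rule: rev_cases) (auto simp flip: append_assoc)
  have L: "Lw (concat ps' @ x) x"
    using stable_L[of x "concat ps'"] snoc.prems(2) pss ps by simp
  show ?case
  proof (cases xs rule: rev_cases)
    case Nil
    then have "pss' = []" using pss by simp
    then show ?thesis using pss ps snoc.prems(4) L Nil by simp
  next
    case (snoc q y)
    have "ps' = []"
    proof (rule ccontr)
      assume "ps' \<noteq> []"
      then obtain r where r: "ps' = r @ [y]"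
        using snoc.prems(4) pss ps snoc by (cases ps' rule: rev_cases) (auto simp flip: append_assoc)
      then have "Lw (y @ x) x" using L Lw_suffix[of "concat r" y x] by simp
      then have "seed (y @ x)" using snoc.prems(2) seed_Lw by simp
      then show False using snoc.prems(1) snoc by (simp add: irred_snoc_snoc)
    qed
    then have "concat pss' = zs @ xs" using snoc.prems(4) pss(1) ps by simp
    moreover have "irred xs" using snoc.prems(1) snoc by (simp add: irred_snoc_snoc)
    ultimately have "Lw (concat zs @ hd xs) (hd xs)"
      using snoc.IH[of pss'] snoc.prems(2,5) pss(1,3) snoc by simp
    then show ?thesis using snoc by (cases q) auto
  qed
qed simp

text \<open>Normalise the blocks of \<open>xs\<close> followed by the letters of z. The result
  represents the same element as \<open>xs\<close>, so it has the same \<D>-classes blockwise, and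
  \<open>partition_last\<close> says where the letters of z went.\<close>

lemma last_block:
  assumes "irred xs" "\<forall>x\<in>set xs. seed x \<and> x \<in> words \<E>" "xs \<noteq> []" "concat xs @ z \<doteq> concat xs"
  shows "Rw (last xs @ z) (last xs)"
proof -
  obtain ys where ys: "merge (xs @ singles z) ys" "irred ys" using irred_exists by blast
  have "\<forall>y\<in>set ys. seed y"
    using assms(2) by (intro merge_seeds[OF ys(1)]) (auto simp: singles_def)
  moreover have "concat xs \<doteq> concat ys"
    using merge_concat[OF ys(1)] cong_sym[OF assms(4)] by simp
  ultimately have "slide xs ys" using assms(1,2) ys(2) by (intro irred_unique) auto
  then have D: "list_all2 Dw xs ys" by (rule slide_Dw)
  obtain pss where "xs @ singles z = concat pss" "ys = map concat pss" "[] \<notin> set pss"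
    using merge_partition[OF ys(1)] by blast
  then show ?thesis using partition_last[OF assms(1-3), of pss "singles z"] D by simp
qed

lemma first_block:
  assumes "irred xs" "\<forall>x\<in>set xs. seed x \<and> x \<in> words \<E>" "xs \<noteq> []" "z @ concat xs \<doteq> concat xs"
  shows "Lw (z @ hd xs) (hd xs)"
proof -
  obtain ys where ys: "merge (singles z @ xs) ys" "irred ys" using irred_exists by blast
  have "\<forall>y\<in>set ys. seed y"
    using assms(2) by (intro merge_seeds[OF ys(1)]) (auto simp: singles_def)
  moreover have "concat xs \<doteq> concat ys"
    using merge_concat[OF ys(1)] cong_sym[OF assms(4)] by simp
  ultimately have "slide xs ys" using assms(1,2) ys(2) by (intro irred_unique) auto
  then have D: "list_all2 Dw xs ys" by (rule slide_Dw)
  obtain pss where "singles z @ xs = concat pss" "ys = map concat pss" "[] \<notin> set pss"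
    using merge_partition[OF ys(1)] by blast
  then show ?thesis using partition_first[OF assms(1-3), of pss "singles z"] D by simp
qed

text \<open>Suppose the normal form of w has first blocks x1, x2 and last block k. From w = wvw the
  last block gives kvw \<R> k and the first block gives wvx1 \<L> x1. So q = kvx1 is \<R>-related to
  k and \<L>-related to x1. As qx2 is a prefix of kvw, also qx2 \<R> q, and transport along \<L>
  yields x1x2 \<R> x1, so x1 and x2 could be merged.\<close>

theorem seed_if_regular:
  assumes w: "w \<in> words \<E>" and reg: "w @ v @ w \<doteq> w"
  shows "seed w"
proof -
  obtain xs where xs: "merge (singles w) xs" "irred xs" using irred_exists by blast
  have cw: "concat xs = w" using merge_concat[OF xs(1)] by simp
  obtain pss where "singles w = concat pss" "xs = map concat pss" "[] \<notin> set pss"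
    using merge_partition[OF xs(1)] by blast
  have seeds: "\<forall>x\<in>set xs. seed x" using merge_seeds[OF xs(1)] by (auto simp: singles_def)
  have S: "\<forall>x\<in>set xs. seed x \<and> x \<in> words \<E>"
    using seeds w seed_not_Nil by (auto simp: words_def simp flip: cw)
  have ne: "xs \<noteq> []" using w cw by (auto simp: words_def)
  show ?thesis
  proof (cases xs)
    case (Cons x1 q)
    show ?thesis
    proof (cases q)
      case Nil
      then show ?thesis using Cons cw seeds by simp
    next
      case q: (Cons x2 r)
      let ?k = "last xs" and ?q = "last xs @ v @ x1"
      have R: "Rw (?k @ v @ concat xs) ?k"
        by (rule last_block[OF xs(2) S ne]) (use reg cw in simp)
      have L: "Lw ((concat xs @ v) @ hd xs) (hd xs)"
        by (rule first_block[OF xs(2) S ne]) (use reg cw in simp)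
      obtain t where t: "xs = t @ [?k]" using ne by (metis append_butlast_last_id)
      have ct: "concat xs = concat t @ ?k" using arg_cong[OF t, of concat] by simp
      have "Lw ?q x1"
        using Lw_suffix[of "concat t" "?k @ v" x1] L unfolding ct by (simp add: Cons)
      have R1: "Rw ?q ?k" using Rw_prefix[of ?k "v @ x1" "x2 @ concat r"] R Cons q by simp
      have "Rw (?q @ x2) ?k" using Rw_prefix[of ?k "v @ x1 @ x2" "concat r"] R Cons q by simp
      then have "Rw (?q @ x2) ?q" using R1 Rw_sym Rw_trans by blast
      then have "Rw (x1 @ x2) x1" using \<open>Lw ?q x1\<close> by (rule Rw_transport)
      then have "seed (x1 @ x2)" using seeds Cons seed_Rw by simp
      then show ?thesis using xs(2) Cons q by (simp add: irred_Cons_Cons)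
    qed
  qed (use ne in simp)
qed

end

section \<open>Rees coordinates\<close>

locale rees =
  fixes S :: "('a, 'b) semigrp_scheme" and D :: "'a set" and C :: "('a, 'g, 'i, 'l) rees_coords"
  assumes semigrp: "is_semigrp S"
    and coords: "is_rees_coords S D C"
    and D_carrier: "D \<subseteq> carrier S"
begin

sublocale grp: group "GG C"
  using coords by (simp add: is_rees_coords_def)

abbreviation G where "G \<equiv> carrier (GG C)"
abbreviation I where "I \<equiv> II C"
abbreviation \<Lambda> where "\<Lambda> \<equiv> LL C"
abbreviation T where "T i a l \<equiv> triple C (i, a, l)"
abbreviation gmult (infixl \<open>\<odot>\<close> 70) where "a \<odot> b \<equiv> a \<otimes>\<^bsub>GG C\<^esub> b"
abbreviation ginv where "ginv a \<equiv> inv\<^bsub>GG C\<^esub> a"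

lemma S_assoc: "\<lbrakk>x \<in> carrier S; y \<in> carrier S; z \<in> carrier S\<rbrakk> \<Longrightarrow>
    (x \<cdot>\<^bsub>S\<^esub> y) \<cdot>\<^bsub>S\<^esub> z = x \<cdot>\<^bsub>S\<^esub> (y \<cdot>\<^bsub>S\<^esub> z)"
  using semigrp by (simp add: is_semigrp_def)

lemma triple_bij: "bij_betw (triple C) (I \<times> G \<times> \<Lambda>) D"
proof -
  have b: "bij_betw (map_option (triple C)) (insert None (Some ` (I \<times> G \<times> \<Lambda>))) (insert None (Some ` D))"
    using coords by (simp add: is_rees_coords_def semigrp_iso_def rees_matrix_def principal_factor_def)
  show ?thesis
    unfolding bij_betw_def
  proof
    show "inj_on (triple C) (I \<times> G \<times> \<Lambda>)"
      using bij_betw_imp_inj_on[OF b] by (force simp: inj_on_def)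
    have "map_option (triple C) ` insert None (Some ` (I \<times> G \<times> \<Lambda>)) = insert None (Some ` D)"
      using b by (simp add: bij_betw_def)
    then have "Some ` triple C ` (I \<times> G \<times> \<Lambda>) = Some ` D" by (simp add: image_image) blast
    then show "triple C ` (I \<times> G \<times> \<Lambda>) = D" by (simp add: inj_image_eq_iff)
  qed
qed

lemma triple_in: "i \<in> I \<Longrightarrow> a \<in> G \<Longrightarrow> l \<in> \<Lambda> \<Longrightarrow> T i a l \<in> D"
  using bij_betwE[OF triple_bij] by blast

lemma triple_carrier: "i \<in> I \<Longrightarrow> a \<in> G \<Longrightarrow> l \<in> \<Lambda> \<Longrightarrow> T i a l \<in> carrier S"
  using triple_in D_carrier by blast

lemma triple_cases:
  assumes "x \<in> D"
  obtains i a l where "i \<in> I" "a \<in> G" "l \<in> \<Lambda>" "x = T i a l"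
  using assms bij_betw_imp_surj_on[OF triple_bij] by auto

lemma triple_eq_iff:
  "\<lbrakk>i \<in> I; a \<in> G; l \<in> \<Lambda>; j \<in> I; b \<in> G; k \<in> \<Lambda>\<rbrakk> \<Longrightarrow> T i a l = T j b k \<longleftrightarrow> i = j \<and> a = b \<and> l = k"
  using bij_betw_imp_inj_on[OF triple_bij] by (auto simp: inj_on_def)

lemma triple_mult:
  assumes "i \<in> I" "a \<in> G" "l \<in> \<Lambda>" "j \<in> I" "b \<in> G" "k \<in> \<Lambda>"
  shows "PP C l j = Some q \<Longrightarrow> q \<in> G \<and> T i a l \<cdot>\<^bsub>S\<^esub> T j b k = T i (a \<odot> q \<odot> b) k"
    and "PP C l j = None \<Longrightarrow> T i a l \<cdot>\<^bsub>S\<^esub> T j b k \<notin> D"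
proof -
  let ?M = "rees_matrix (GG C) I \<Lambda> (PP C)" and ?F = "principal_factor S D"
  have mem: "Some (i, a, l) \<in> carrier ?M" "Some (j, b, k) \<in> carrier ?M"
    using assms by (auto simp: rees_matrix_def)
  have hom: "map_option (triple C) (Some (i, a, l) \<cdot>\<^bsub>?M\<^esub> Some (j, b, k)) =
      Some (T i a l) \<cdot>\<^bsub>?F\<^esub> Some (T j b k)"
    using coords mem unfolding is_rees_coords_def semigrp_iso_def by force
  then show "PP C l j = None \<Longrightarrow> T i a l \<cdot>\<^bsub>S\<^esub> T j b k \<notin> D"
    by (auto simp: rees_matrix_def principal_factor_def split: if_splits)
  assume q: "PP C l j = Some q"
  then have "q \<in> G"
    using coords assms unfolding is_rees_coords_def regular_matrix_def by blast
  then show "q \<in> G \<and> T i a l \<cdot>\<^bsub>S\<^esub> T j b k = T i (a \<odot> q \<odot> b) k"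
    using hom q by (auto simp: rees_matrix_def principal_factor_def split: if_splits)
qed

lemma triple_mult_in:
  assumes "i \<in> I" "a \<in> G" "l \<in> \<Lambda>" "j \<in> I" "b \<in> G" "k \<in> \<Lambda>" "T i a l \<cdot>\<^bsub>S\<^esub> T j b k \<in> D"
  obtains g where "g \<in> G" "T i a l \<cdot>\<^bsub>S\<^esub> T j b k = T i g k"
proof (cases "PP C l j")
  case (Some q)
  then show ?thesis using that[of "a \<odot> q \<odot> b"] triple_mult(1)[OF assms(1-6) Some] assms by simp
qed (use triple_mult(2)[OF assms(1-6)] assms(7) in simp)

text \<open>Regularity of the matrix provides a nonzero entry q in row l and some column j, and d is
  the inverse of q times g. The factor depends on neither i nor a, so it translates a whole
  \<L>-class at once.\<close>

lemma right_translation: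
  assumes "l \<in> \<Lambda>" "g \<in> G" "k \<in> \<Lambda>"
  obtains j d where "j \<in> I" "d \<in> G"
    "\<And>i a. i \<in> I \<Longrightarrow> a \<in> G \<Longrightarrow> T i a l \<cdot>\<^bsub>S\<^esub> T j d k = T i (a \<odot> g) k"
proof -
  obtain j q where j: "j \<in> I" "PP C l j = Some q"
    using coords assms unfolding is_rees_coords_def regular_matrix_def by blast
  then have q: "q \<in> G"
    using coords assms unfolding is_rees_coords_def regular_matrix_def by blast
  have "T i a l \<cdot>\<^bsub>S\<^esub> T j (ginv q \<odot> g) k = T i (a \<odot> g) k" if "i \<in> I" "a \<in> G" for i a
    using triple_mult(1)[OF that assms(1) j(1) _ assms(3) j(2), of "ginv q \<odot> g"] q that assms
    by (simp add: grp.m_assoc) (simp add: grp.m_assoc[symmetric])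
  then show ?thesis using that[of j "ginv q \<odot> g"] j q assms by simp
qed

lemma left_translation:
  assumes "i \<in> I" "g \<in> G" "j \<in> I"
  obtains k d where "k \<in> \<Lambda>" "d \<in> G"
    "\<And>a l. a \<in> G \<Longrightarrow> l \<in> \<Lambda> \<Longrightarrow> T j d k \<cdot>\<^bsub>S\<^esub> T i a l = T j (g \<odot> a) l"
proof -
  obtain k q where k: "k \<in> \<Lambda>" "PP C k i = Some q"
    using coords assms unfolding is_rees_coords_def regular_matrix_def by blast
  then have q: "q \<in> G"
    using coords assms unfolding is_rees_coords_def regular_matrix_def by blast
  have "T j (g \<odot> ginv q) k \<cdot>\<^bsub>S\<^esub> T i a l = T j (g \<odot> a) l" if "a \<in> G" "l \<in> \<Lambda>" for a l
    using triple_mult(1)[OF assms(3) _ k(1) assms(1) that k(2), of "g \<odot> ginv q"] q that assms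
    by (simp add: grp.m_assoc)
  then show ?thesis using that[of k "g \<odot> ginv q"] k q assms by simp
qed

text \<open>The factor y need not lie in D, so the matrix product does not apply. But the triple (i,
  d, h) is a left identity for all triples with first index i, hence also for the product with y;
  and a product of two triples inherits the first index of its left factor.\<close>

lemma right_mult_in:
  assumes x: "i \<in> I" "a \<in> G" "l \<in> \<Lambda>" and y: "y \<in> carrier S" "T i a l \<cdot>\<^bsub>S\<^esub> y \<in> D"
  obtains b k where "b \<in> G" "k \<in> \<Lambda>" "T i a l \<cdot>\<^bsub>S\<^esub> y = T i b k"
proof -
  obtain h d where hd: "h \<in> \<Lambda>" "d \<in> G"
    "\<And>a l. a \<in> G \<Longrightarrow> l \<in> \<Lambda> \<Longrightarrow> T i d h \<cdot>\<^bsub>S\<^esub> T i a l = T i (\<one>\<^bsub>GG C\<^esub> \<odot> a) l"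
    using left_translation[OF x(1) grp.one_closed x(1)] by blast
  obtain j b k where jbk: "j \<in> I" "b \<in> G" "k \<in> \<Lambda>" "T i a l \<cdot>\<^bsub>S\<^esub> y = T j b k"
    using triple_cases[OF y(2)] by blast
  have "T i d h \<cdot>\<^bsub>S\<^esub> T j b k = (T i d h \<cdot>\<^bsub>S\<^esub> T i a l) \<cdot>\<^bsub>S\<^esub> y"
    unfolding jbk(4)[symmetric] using x hd(1,2) y(1) by (simp add: S_assoc triple_carrier)
  also have "\<dots> = T j b k" using hd(3) x jbk by simp
  finally have e: "T i d h \<cdot>\<^bsub>S\<^esub> T j b k = T j b k" .
  have "T i d h \<cdot>\<^bsub>S\<^esub> T j b k \<in> D" using e triple_in jbk by simp
  then obtain g where g: "g \<in> G" "T i d h \<cdot>\<^bsub>S\<^esub> T j b k = T i g k"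
    using triple_mult_in[OF x(1) hd(2,1) jbk(1-3)] by blast
  show ?thesis using that[OF g(1) jbk(3)] jbk(4) e g(2) by simp
qed

lemma left_mult_in:
  assumes x: "i \<in> I" "a \<in> G" "l \<in> \<Lambda>" and y: "y \<in> carrier S" "y \<cdot>\<^bsub>S\<^esub> T i a l \<in> D"
  obtains b j where "b \<in> G" "j \<in> I" "y \<cdot>\<^bsub>S\<^esub> T i a l = T j b l"
proof -
  obtain h d where hd: "h \<in> I" "d \<in> G"
    "\<And>i a. i \<in> I \<Longrightarrow> a \<in> G \<Longrightarrow> T i a l \<cdot>\<^bsub>S\<^esub> T h d l = T i (a \<odot> \<one>\<^bsub>GG C\<^esub>) l"
    using right_translation[OF x(3) grp.one_closed x(3)] by blast
  obtain j b k where jbk: "j \<in> I" "b \<in> G" "k \<in> \<Lambda>" "y \<cdot>\<^bsub>S\<^esub> T i a l = T j b k"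
    using triple_cases[OF y(2)] by blast
  have "T j b k \<cdot>\<^bsub>S\<^esub> T h d l = y \<cdot>\<^bsub>S\<^esub> (T i a l \<cdot>\<^bsub>S\<^esub> T h d l)"
    unfolding jbk(4)[symmetric] using x hd(1,2) y(1) by (simp add: S_assoc triple_carrier)
  also have "\<dots> = T j b k" using hd(3) x jbk by simp
  finally have e: "T j b k \<cdot>\<^bsub>S\<^esub> T h d l = T j b k" .
  have "T j b k \<cdot>\<^bsub>S\<^esub> T h d l \<in> D" using e triple_in jbk by simp
  then obtain g where g: "g \<in> G" "T j b k \<cdot>\<^bsub>S\<^esub> T h d l = T j g l"
    using triple_mult_in[OF jbk(1-3) hd(1,2) x(3)] by blast
  show ?thesis using that[OF g(1) jbk(1)] jbk(4) e g(2) by simp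
qed

text \<open>Any other triple with last index l is a left translate of the given one, and
  associativity carries the action of y along. The group element is a^{-1} d, read off at the given
  triple.\<close>

lemma right_mult_uniform:
  assumes x: "i \<in> I" "a \<in> G" "l \<in> \<Lambda>" and y: "y \<in> carrier S" "T i a l \<cdot>\<^bsub>S\<^esub> y \<in> D"
  obtains k g where "k \<in> \<Lambda>" "g \<in> G"
    "\<And>j b. j \<in> I \<Longrightarrow> b \<in> G \<Longrightarrow> T j b l \<cdot>\<^bsub>S\<^esub> y = T j (b \<odot> g) k"
proof -
  obtain d k where dk: "d \<in> G" "k \<in> \<Lambda>" "T i a l \<cdot>\<^bsub>S\<^esub> y = T i d k"
    using right_mult_in[OF assms] by blast
  have "T j b l \<cdot>\<^bsub>S\<^esub> y = T j (b \<odot> (ginv a \<odot> d)) k" if m: "j \<in> I" "b \<in> G" for j b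
  proof -
    obtain h u where hu: "h \<in> \<Lambda>" "u \<in> G" "\<And>f m. f \<in> G \<Longrightarrow> m \<in> \<Lambda> \<Longrightarrow>
        T j u h \<cdot>\<^bsub>S\<^esub> T i f m = T j (b \<odot> ginv a \<odot> f) m"
      using left_translation[OF x(1) _ m(1), of "b \<odot> ginv a"] m(2) x(2) by auto
    have "T j b l \<cdot>\<^bsub>S\<^esub> y = (T j u h \<cdot>\<^bsub>S\<^esub> T i a l) \<cdot>\<^bsub>S\<^esub> y"
      using hu(3)[OF x(2,3)] x m by (simp add: grp.m_assoc)
    also have "\<dots> = T j u h \<cdot>\<^bsub>S\<^esub> T i d k"
      unfolding dk(3)[symmetric] by (intro S_assoc triple_carrier) (use x y(1) hu m in auto)
    finally have "T j b l \<cdot>\<^bsub>S\<^esub> y = T j u h \<cdot>\<^bsub>S\<^esub> T i d k" .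
    then show ?thesis using hu(3)[OF dk(1,2)] x m dk by (simp add: grp.m_assoc)
  qed
  then show ?thesis using that[of k "ginv a \<odot> d"] dk x by simp
qed

lemma left_mult_uniform:
  assumes x: "i \<in> I" "a \<in> G" "l \<in> \<Lambda>" and y: "y \<in> carrier S" "y \<cdot>\<^bsub>S\<^esub> T i a l \<in> D"
  obtains j g where "j \<in> I" "g \<in> G"
    "\<And>b k. b \<in> G \<Longrightarrow> k \<in> \<Lambda> \<Longrightarrow> y \<cdot>\<^bsub>S\<^esub> T i b k = T j (g \<odot> b) k"
proof -
  obtain d j where dj: "d \<in> G" "j \<in> I" "y \<cdot>\<^bsub>S\<^esub> T i a l = T j d l"
    using left_mult_in[OF assms] by blast
  have "y \<cdot>\<^bsub>S\<^esub> T i b k = T j ((d \<odot> ginv a) \<odot> b) k" if m: "b \<in> G" "k \<in> \<Lambda>" for b k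
  proof -
    obtain h u where hu: "h \<in> I" "u \<in> G" "\<And>m f. m \<in> I \<Longrightarrow> f \<in> G \<Longrightarrow>
        T m f l \<cdot>\<^bsub>S\<^esub> T h u k = T m (f \<odot> (ginv a \<odot> b)) k"
      using right_translation[OF x(3) _ m(2), of "ginv a \<odot> b"] m(1) x(2) by auto
    have "y \<cdot>\<^bsub>S\<^esub> T i b k = y \<cdot>\<^bsub>S\<^esub> (T i a l \<cdot>\<^bsub>S\<^esub> T h u k)"
      using hu(3)[OF x(1,2)] x m by (simp flip: grp.m_assoc)
    also have "\<dots> = T j d l \<cdot>\<^bsub>S\<^esub> T h u k"
      unfolding dj(3)[symmetric] by (intro S_assoc[symmetric] triple_carrier) (use x y(1) hu m in auto)
    finally have "y \<cdot>\<^bsub>S\<^esub> T i b k = T j d l \<cdot>\<^bsub>S\<^esub> T h u k" .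
    then show ?thesis using hu(3)[OF dj(2,1)] x m dj by (simp add: grp.m_assoc)
  qed
  then show ?thesis using that[of j "d \<odot> ginv a"] dj x by simp
qed

end

section \<open>Green's relations of the free idempotent generated semigroup\<close>

context biorder
begin

lemma bar_mult_append:
  assumes "u \<in> words \<E>" "set s \<subseteq> carrier \<E>"
  shows "u @ s \<in> words \<E>" "s @ u \<in> words \<E>"
  using assms by (auto simp: words_def)

lemma right_ideal_bar:
  assumes u: "u \<in> words \<E>"
  shows "right_ideal_of (IG \<E>) (bar \<E> u) = (\<lambda>s. bar \<E> (u @ s)) ` {s. set s \<subseteq> carrier \<E>}"
proof -
  have "{bar \<E> u \<cdot>\<^bsub>IG \<E>\<^esub> s |s. s \<in> carrier (IG \<E>)} = (\<lambda>s. bar \<E> (u @ s)) ` words \<E>"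
    using bar_mult[OF u] by (force simp: carrier_IG)
  moreover have "{s. set s \<subseteq> carrier \<E>} = insert [] (words \<E>)" by (auto simp: words_def)
  ultimately show ?thesis by (simp add: right_ideal_of_def)
qed

lemma left_ideal_bar:
  assumes u: "u \<in> words \<E>"
  shows "left_ideal_of (IG \<E>) (bar \<E> u) = (\<lambda>s. bar \<E> (s @ u)) ` {s. set s \<subseteq> carrier \<E>}"
proof -
  have "{s \<cdot>\<^bsub>IG \<E>\<^esub> bar \<E> u |s. s \<in> carrier (IG \<E>)} = (\<lambda>s. bar \<E> (s @ u)) ` words \<E>"
    using bar_mult[OF _ u] by (force simp: carrier_IG)
  moreover have "{s. set s \<subseteq> carrier \<E>} = insert [] (words \<E>)" by (auto simp: words_def)
  ultimately show ?thesis by (simp add: left_ideal_of_def)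
qed

lemma Rw_words: "Rw u v \<Longrightarrow> u \<in> words \<E> \<Longrightarrow> v \<in> words \<E>"
proof -
  assume "Rw u v" "u \<in> words \<E>"
  then obtain s t where "u @ s \<doteq> v" "v @ t \<doteq> u" by (auto simp: Rw_def)
  then show ?thesis using \<open>u \<in> words \<E>\<close> cong_Nil[of "u @ s" v] cong_words[of "v @ t" u]
    by (auto simp: words_def)
qed

lemma Lw_words: "Lw u v \<Longrightarrow> u \<in> words \<E> \<Longrightarrow> v \<in> words \<E>"
proof -
  assume "Lw u v" "u \<in> words \<E>"
  then obtain s t where "s @ u \<doteq> v" "t @ v \<doteq> u" by (auto simp: Lw_def)
  then show ?thesis using \<open>u \<in> words \<E>\<close> cong_Nil[of "s @ u" v] cong_words[of "t @ v" u]
    by (auto simp: words_def)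
qed

lemma Dw_words: "Dw u v \<Longrightarrow> u \<in> words \<E> \<Longrightarrow> v \<in> words \<E>"
  unfolding Dw_def using Rw_words Lw_words by blast

lemma R_class_bar:
  assumes u: "u \<in> words \<E>" and v: "v \<in> words \<E>"
  shows "bar \<E> v \<in> R_class (IG \<E>) (bar \<E> u) \<longleftrightarrow> Rw u v"
proof
  let ?A = "{s. set s \<subseteq> carrier \<E>}"
  have sub: "(\<lambda>s. bar \<E> (v @ s)) ` ?A \<subseteq> (\<lambda>s. bar \<E> (u @ s)) ` ?A"
    if "u @ t \<doteq> v" "u \<in> words \<E>" "v \<in> words \<E>" for u v t
  proof
    have t: "set t \<subseteq> carrier \<E>" using cong_words[OF that(1)] that(3) by (auto simp: words_def)
    fix y assume "y \<in> (\<lambda>s. bar \<E> (v @ s)) ` ?A"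
    then obtain s where s: "set s \<subseteq> carrier \<E>" "y = bar \<E> (v @ s)" by blast
    have "bar \<E> (v @ s) = bar \<E> ((u @ t) @ s)"
      using cong_append_right[OF cong_sym[OF that(1)], of s] that s t
      by (subst bar_eq_cong) (auto simp: words_def)
    then show "y \<in> (\<lambda>s. bar \<E> (u @ s)) ` ?A" using s t by (intro image_eqI[of _ _ "t @ s"]) auto
  qed
  have mem: "\<exists>s. u @ s \<doteq> v" if "bar \<E> v \<in> (\<lambda>s. bar \<E> (u @ s)) ` ?A"
    "u \<in> words \<E>" "v \<in> words \<E>" for u v
    using that bar_eq_cong[of v] bar_mult_append(1) cong_sym by blast
  have self: "bar \<E> v \<in> (\<lambda>s. bar \<E> (v @ s)) ` ?A" for v
    by (rule image_eqI[of _ _ "[]"]) auto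
  {
    assume "bar \<E> v \<in> R_class (IG \<E>) (bar \<E> u)"
    then have eq: "(\<lambda>s. bar \<E> (v @ s)) ` ?A = (\<lambda>s. bar \<E> (u @ s)) ` ?A"
      using u v by (simp add: R_class_def right_ideal_bar)
    show "Rw u v" unfolding Rw_def using mem[OF _ u v] mem[OF _ v u] self[of u] self[of v] eq by simp
  next
    assume "Rw u v"
    then have "(\<lambda>s. bar \<E> (v @ s)) ` ?A = (\<lambda>s. bar \<E> (u @ s)) ` ?A"
      using sub[OF _ u v] sub[OF _ v u] unfolding Rw_def by blast
    then show "bar \<E> v \<in> R_class (IG \<E>) (bar \<E> u)"
      using u v by (simp add: R_class_def right_ideal_bar carrier_IG)
  }
qed

lemma L_class_bar:
  assumes u: "u \<in> words \<E>" and v: "v \<in> words \<E>"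
  shows "bar \<E> v \<in> L_class (IG \<E>) (bar \<E> u) \<longleftrightarrow> Lw u v"
proof
  let ?A = "{s. set s \<subseteq> carrier \<E>}"
  have sub: "(\<lambda>s. bar \<E> (s @ v)) ` ?A \<subseteq> (\<lambda>s. bar \<E> (s @ u)) ` ?A"
    if "t @ u \<doteq> v" "u \<in> words \<E>" "v \<in> words \<E>" for u v t
  proof
    have t: "set t \<subseteq> carrier \<E>" using cong_words[OF that(1)] that(3) by (auto simp: words_def)
    fix y assume "y \<in> (\<lambda>s. bar \<E> (s @ v)) ` ?A"
    then obtain s where s: "set s \<subseteq> carrier \<E>" "y = bar \<E> (s @ v)" by blast
    have "bar \<E> (s @ v) = bar \<E> (s @ t @ u)"
      using cong_append_left[OF cong_sym[OF that(1)], of s] that s t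
      by (subst bar_eq_cong) (auto simp: words_def)
    then show "y \<in> (\<lambda>s. bar \<E> (s @ u)) ` ?A" using s t by (intro image_eqI[of _ _ "s @ t"]) auto
  qed
  have mem: "\<exists>s. s @ u \<doteq> v" if "bar \<E> v \<in> (\<lambda>s. bar \<E> (s @ u)) ` ?A"
    "u \<in> words \<E>" "v \<in> words \<E>" for u v
    using that bar_eq_cong[of v] bar_mult_append(2) cong_sym by blast
  have self: "bar \<E> v \<in> (\<lambda>s. bar \<E> (s @ v)) ` ?A" for v
    by (rule image_eqI[of _ _ "[]"]) auto
  {
    assume "bar \<E> v \<in> L_class (IG \<E>) (bar \<E> u)"
    then have eq: "(\<lambda>s. bar \<E> (s @ v)) ` ?A = (\<lambda>s. bar \<E> (s @ u)) ` ?A"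
      using u v by (simp add: L_class_def left_ideal_bar)
    show "Lw u v" unfolding Lw_def using mem[OF _ u v] mem[OF _ v u] self[of u] self[of v] eq by simp
  next
    assume "Lw u v"
    then have "(\<lambda>s. bar \<E> (s @ v)) ` ?A = (\<lambda>s. bar \<E> (s @ u)) ` ?A"
      using sub[OF _ u v] sub[OF _ v u] unfolding Lw_def by blast
    then show "bar \<E> v \<in> L_class (IG \<E>) (bar \<E> u)"
      using u v by (simp add: L_class_def left_ideal_bar carrier_IG)
  }
qed

lemma R_class_cases:
  assumes "y \<in> R_class (IG \<E>) x"
  obtains v where "v \<in> words \<E>" "y = bar \<E> v"
  using assms by (auto simp: R_class_def carrier_IG)

lemma L_class_cases:
  assumes "y \<in> L_class (IG \<E>) x"
  obtains v where "v \<in> words \<E>" "y = bar \<E> v"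
  using assms by (auto simp: L_class_def carrier_IG)

lemma D_class_bar:
  assumes u: "u \<in> words \<E>" and v: "v \<in> words \<E>"
  shows "bar \<E> v \<in> D_class (IG \<E>) (bar \<E> u) \<longleftrightarrow> Dw u v"
proof
  assume "bar \<E> v \<in> D_class (IG \<E>) (bar \<E> u)"
  then obtain z where z: "z \<in> R_class (IG \<E>) (bar \<E> u)" "bar \<E> v \<in> L_class (IG \<E>) z"
    by (auto simp: D_class_def)
  obtain w where w: "w \<in> words \<E>" "z = bar \<E> w" using R_class_cases[OF z(1)] by blast
  then show "Dw u v" using z R_class_bar[OF u w(1)] L_class_bar[OF w(1) v] by (auto simp: Dw_def)
next
  assume "Dw u v"
  then obtain w where w: "Rw u w" "Lw w v" by (auto simp: Dw_def)
  then have "w \<in> words \<E>" using u Rw_words by blast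
  then show "bar \<E> v \<in> D_class (IG \<E>) (bar \<E> u)"
    using w R_class_bar[OF u] L_class_bar[OF _ v] by (auto simp: D_class_def)
qed

lemma D_class_carrier: "D_class (IG \<E>) x \<subseteq> carrier (IG \<E>)"
  by (auto simp: D_class_def L_class_def)

lemma D_class_eq:
  assumes u: "u \<in> words \<E>" and v: "v \<in> words \<E>"
  shows "D_class (IG \<E>) (bar \<E> u) = D_class (IG \<E>) (bar \<E> v) \<longleftrightarrow> Dw u v"
proof
  assume "D_class (IG \<E>) (bar \<E> u) = D_class (IG \<E>) (bar \<E> v)"
  then show "Dw u v" using D_class_bar[OF u v] D_class_bar[OF v v] Dw_Rw[OF Rw_refl] by simp
next
  assume uv: "Dw u v"
  have "y \<in> D_class (IG \<E>) (bar \<E> u) \<longleftrightarrow> y \<in> D_class (IG \<E>) (bar \<E> v)" if y: "y \<in> carrier (IG \<E>)" for y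
  proof -
    obtain w where "w \<in> words \<E>" "y = bar \<E> w" using y unfolding carrier_IG by blast
    then show ?thesis
      using D_class_bar[OF u] D_class_bar[OF v] Dw_trans[OF uv] Dw_trans[OF Dw_sym[OF uv]] by auto
  qed
  then show "D_class (IG \<E>) (bar \<E> u) = D_class (IG \<E>) (bar \<E> v)"
    using D_class_carrier by blast
qed

lemma regular_bar:
  assumes w: "w \<in> words \<E>"
  shows "regular_elem (IG \<E>) (bar \<E> w) \<longleftrightarrow> (\<exists>v\<in>words \<E>. w @ v @ w \<doteq> w)"
proof -
  have "bar \<E> w \<cdot>\<^bsub>IG \<E>\<^esub> bar \<E> v \<cdot>\<^bsub>IG \<E>\<^esub> bar \<E> w = bar \<E> w \<longleftrightarrow> w @ v @ w \<doteq> w" if "v \<in> words \<E>" for v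
    using that w bar_mult_append(1)[OF w] by (simp add: bar_mult bar_eq_cong words_def)
  then show ?thesis using w by (auto simp: regular_elem_def carrier_IG)
qed

text \<open>If s(ue) = e and (ev)t = e, then tes is an inverse of uev: the product (uev)(tes)(uev)
  collapses to ueeev and hence to uev.\<close>

lemma regular_if_seed:
  assumes w: "w \<in> words \<E>" and "seed w"
  shows "regular_elem (IG \<E>) (bar \<E> w)"
proof -
  obtain u e v where uev: "w = u @ [e] @ v" and L: "Lw (u @ [e]) [e]" and R: "Rw ([e] @ v) [e]"
    using assms(2) unfolding seed_def by blast
  obtain s t where s: "s @ u @ [e] \<doteq> [e]" and t: "([e] @ v) @ t \<doteq> [e]"
    using L R by (auto simp: Lw_def Rw_def)
  have e: "e \<in> carrier \<E>" using w uev by (auto simp: words_def)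
  have st: "t @ [e] @ s \<in> words \<E>"
    using cong_set[OF s] cong_set[OF t] e by (auto simp: words_def)
  have ee: "[e] @ [e] \<doteq> [e]" using letters_cong[OF e e e pmult_idem[OF e]] by simp
  have "w @ (t @ [e] @ s) @ w = u @ (([e] @ v) @ t) @ [e] @ (s @ u @ [e]) @ v" by (simp add: uev)
  also have "\<dots> \<doteq> u @ [e] @ [e] @ [e] @ v"
    by (intro cong_append cong_refl s t)
  also have "\<dots> = u @ ([e] @ [e]) @ [e] @ v" by simp
  also have "\<dots> \<doteq> u @ [e] @ [e] @ v"
    by (intro cong_append cong_refl ee)
  also have "\<dots> = u @ ([e] @ [e]) @ v" by simp
  also have "\<dots> \<doteq> u @ [e] @ v"
    by (intro cong_append cong_refl ee)
  also have "\<dots> = w" by (simp add: uev)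
  finally show ?thesis using regular_bar[OF w] st by blast
qed

end

section \<open>Coordinates of regular words\<close>

locale coord_biorder = biorder \<E> for \<E> :: "'e partial_alg" +
  fixes c :: "('e, 'g, 'i, 'l) coord_choice"
  assumes coord_choice: "is_coord_choice \<E> c"
begin

lemma rees: "regular_D_class (IG \<E>) D \<Longrightarrow> rees (IG \<E>) D (c D)"
  using coord_choice is_semigrp_IG D_class_carrier
  by unfold_locales (auto simp: is_coord_choice_def regular_D_class_def)

lemma D_class_seed: "\<lbrakk>w \<in> words \<E>; seed w\<rbrakk> \<Longrightarrow> regular_D_class (IG \<E>) (D_class (IG \<E>) (bar \<E> w))"
  using regular_if_seed regular_D_class_def by blast

lemma D_class_member:
  assumes "regular_D_class (IG \<E>) D" "u \<in> words \<E>" "bar \<E> u \<in> D"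
  shows "D_class (IG \<E>) (bar \<E> u) = D"
proof -
  obtain w where w: "w \<in> words \<E>" "D = D_class (IG \<E>) (bar \<E> w)"
    using assms(1) by (auto simp: regular_D_class_def regular_elem_def carrier_IG)
  then show ?thesis using assms D_class_bar D_class_eq by blast
qed

text \<open>Right multiplication inside D cannot change the first index, and right translations
  reach every triple that shares it. So the \<R>-class, and the right multiples that stay in D, are
  described by the same condition; this is stability in coordinates.\<close>

lemma Rw_triple:
  assumes D: "regular_D_class (IG \<E>) D" and u: "u \<in> words \<E>"
    and ial: "i \<in> II (c D)" "a \<in> carrier (GG (c D))" "l \<in> LL (c D)" "bar \<E> u = triple (c D) (i, a, l)"
  shows "v \<in> words \<E> \<and> (\<exists>t. v \<doteq> u @ t) \<and> bar \<E> v \<in> D \<longleftrightarrow>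
    v \<in> words \<E> \<and> (\<exists>b\<in>carrier (GG (c D)). \<exists>k\<in>LL (c D). bar \<E> v = triple (c D) (i, b, k))"
    and "v \<in> words \<E> \<and> Rw u v \<longleftrightarrow>
    v \<in> words \<E> \<and> (\<exists>b\<in>carrier (GG (c D)). \<exists>k\<in>LL (c D). bar \<E> v = triple (c D) (i, b, k))"
proof -
  interpret rees "IG \<E>" D "c D" by (rule rees[OF D])
  have 1: "\<exists>b\<in>G. \<exists>k\<in>\<Lambda>. bar \<E> v = T i b k" if v: "v \<in> words \<E>" "v \<doteq> u @ t" "bar \<E> v \<in> D" for v t
  proof (cases "t = []")
    case True
    then show ?thesis using v u ial bar_eq_cong[of v u] by auto
  next
    case False
    have "u @ t \<in> words \<E>" using v cong_words by blast
    then have t: "t \<in> words \<E>" using False by (auto simp: words_def)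
    then have "bar \<E> v = T i a l \<cdot>\<^bsub>IG \<E>\<^esub> bar \<E> t"
      using v u ial bar_mult[OF u t] bar_eq_cong[OF v(1) \<open>u @ t \<in> words \<E>\<close>] by simp
    moreover have "bar \<E> t \<in> carrier (IG \<E>)" using t by (simp add: carrier_IG)
    ultimately show ?thesis using right_mult_in[OF ial(1-3), of "bar \<E> t"] v(3) by metis
  qed
  have 2: "\<exists>t. v \<doteq> u @ t" if v: "v \<in> words \<E>" and bk: "b \<in> G" "k \<in> \<Lambda>" "bar \<E> v = T i b k"
    and u: "u \<in> words \<E>" and al: "a \<in> G" "l \<in> \<Lambda>" "bar \<E> u = T i a l" for u v a l b k
  proof -
    obtain j d where jd: "j \<in> I" "d \<in> G" "\<And>i f. i \<in> I \<Longrightarrow> f \<in> G \<Longrightarrow>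
        T i f l \<cdot>\<^bsub>IG \<E>\<^esub> T j d k = T i (f \<otimes>\<^bsub>GG (c D)\<^esub> (ginv a \<otimes>\<^bsub>GG (c D)\<^esub> b)) k"
      using right_translation[OF al(2) _ bk(2), of "ginv a \<otimes>\<^bsub>GG (c D)\<^esub> b"] al bk by auto
    obtain t where t: "t \<in> words \<E>" "T j d k = bar \<E> t"
      using triple_carrier[OF jd(1,2) bk(2)] by (auto simp: carrier_IG)
    have "bar \<E> (u @ t) = bar \<E> v"
      using jd(3)[OF ial(1) al(1)] bar_mult[OF u t(1)] t al bk by (simp flip: grp.m_assoc)
    then show ?thesis
      using bar_eq_cong[of v "u @ t"] v u t by (auto simp: words_def)
  qed
  have inD: "bar \<E> v \<in> D" if "b \<in> G" "k \<in> \<Lambda>" "bar \<E> v = T i b k" for v b k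
    using that triple_in ial by simp
  show "v \<in> words \<E> \<and> (\<exists>t. v \<doteq> u @ t) \<and> bar \<E> v \<in> D \<longleftrightarrow>
    v \<in> words \<E> \<and> (\<exists>b\<in>G. \<exists>k\<in>\<Lambda>. bar \<E> v = T i b k)"
    using 1 2[OF _ _ _ _ u ial(2-4)] inD by blast
  have 3: "bar \<E> v \<in> D" if "v \<in> words \<E>" "Rw u v"
    using that D_class_bar[OF u that(1)] D_class_member[OF D u] Dw_Rw ial triple_in by simp
  show "v \<in> words \<E> \<and> Rw u v \<longleftrightarrow> v \<in> words \<E> \<and> (\<exists>b\<in>G. \<exists>k\<in>\<Lambda>. bar \<E> v = T i b k)"
  proof (intro iffI conjI; elim conjE bexE)
    assume "v \<in> words \<E>" "Rw u v"
    moreover then obtain t where "v \<doteq> u @ t" unfolding Rw_def using cong_sym by blast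
    ultimately show "\<exists>b\<in>G. \<exists>k\<in>\<Lambda>. bar \<E> v = T i b k" using 1 3 by blast
  next
    fix b k assume v: "v \<in> words \<E>" "b \<in> G" "k \<in> \<Lambda>" "bar \<E> v = T i b k"
    show "Rw u v"
      unfolding Rw_def using 2[OF v u ial(2-4)] 2[OF u ial(2-4) v] cong_sym by blast
  qed
qed

lemma Lw_triple:
  assumes D: "regular_D_class (IG \<E>) D" and u: "u \<in> words \<E>"
    and ial: "i \<in> II (c D)" "a \<in> carrier (GG (c D))" "l \<in> LL (c D)" "bar \<E> u = triple (c D) (i, a, l)"
  shows "v \<in> words \<E> \<and> (\<exists>t. v \<doteq> t @ u) \<and> bar \<E> v \<in> D \<longleftrightarrow>
    v \<in> words \<E> \<and> (\<exists>j\<in>II (c D). \<exists>b\<in>carrier (GG (c D)). bar \<E> v = triple (c D) (j, b, l))"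
    and "v \<in> words \<E> \<and> Lw u v \<longleftrightarrow>
    v \<in> words \<E> \<and> (\<exists>j\<in>II (c D). \<exists>b\<in>carrier (GG (c D)). bar \<E> v = triple (c D) (j, b, l))"
proof -
  interpret rees "IG \<E>" D "c D" by (rule rees[OF D])
  have 1: "\<exists>j\<in>I. \<exists>b\<in>G. bar \<E> v = T j b l" if v: "v \<in> words \<E>" "v \<doteq> t @ u" "bar \<E> v \<in> D" for v t
  proof (cases "t = []")
    case True
    then show ?thesis using v u ial bar_eq_cong[of v u] by auto
  next
    case False
    have "t @ u \<in> words \<E>" using v cong_words by blast
    then have t: "t \<in> words \<E>" using False by (auto simp: words_def)
    then have "bar \<E> v = bar \<E> t \<cdot>\<^bsub>IG \<E>\<^esub> T i a l"
      using v u ial bar_mult[OF t u] bar_eq_cong[OF v(1) \<open>t @ u \<in> words \<E>\<close>] by simp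
    moreover have "bar \<E> t \<in> carrier (IG \<E>)" using t by (simp add: carrier_IG)
    ultimately show ?thesis using left_mult_in[OF ial(1-3), of "bar \<E> t"] v(3) by metis
  qed
  have 2: "\<exists>t. v \<doteq> t @ u" if v: "v \<in> words \<E>" and bk: "k \<in> I" "b \<in> G" "bar \<E> v = T k b l"
    and u: "u \<in> words \<E>" and al: "i \<in> I" "a \<in> G" "bar \<E> u = T i a l" for u v a i b k
  proof -
    obtain j d where jd: "j \<in> \<Lambda>" "d \<in> G"
      "\<And>f l. f \<in> G \<Longrightarrow> l \<in> \<Lambda> \<Longrightarrow>
        T k d j \<cdot>\<^bsub>IG \<E>\<^esub> T i f l = T k (b \<otimes>\<^bsub>GG (c D)\<^esub> ginv a \<otimes>\<^bsub>GG (c D)\<^esub> f) l"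
      using left_translation[OF al(1) _ bk(1), of "b \<otimes>\<^bsub>GG (c D)\<^esub> ginv a"] al bk by auto
    obtain t where t: "t \<in> words \<E>" "T k d j = bar \<E> t"
      using triple_carrier[OF bk(1) jd(2,1)] by (auto simp: carrier_IG)
    have "bar \<E> (t @ u) = bar \<E> v"
      using jd(3)[OF al(2) ial(3)] bar_mult[OF t(1) u] t al bk by (simp add: grp.m_assoc)
    then show ?thesis
      using bar_eq_cong[of v "t @ u"] v u t by (auto simp: words_def)
  qed
  have inD: "bar \<E> v \<in> D" if "k \<in> I" "b \<in> G" "bar \<E> v = T k b l" for v b k
    using that triple_in ial by simp
  show "v \<in> words \<E> \<and> (\<exists>t. v \<doteq> t @ u) \<and> bar \<E> v \<in> D \<longleftrightarrow>
    v \<in> words \<E> \<and> (\<exists>j\<in>I. \<exists>b\<in>G. bar \<E> v = T j b l)"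
    using 1 2[OF _ _ _ _ u ial(1,2,4)] inD by blast
  have 3: "bar \<E> v \<in> D" if "v \<in> words \<E>" "Lw u v"
    using that D_class_bar[OF u that(1)] D_class_member[OF D u] Dw_Lw ial triple_in by simp
  show "v \<in> words \<E> \<and> Lw u v \<longleftrightarrow> v \<in> words \<E> \<and> (\<exists>j\<in>I. \<exists>b\<in>G. bar \<E> v = T j b l)"
  proof (intro iffI conjI; elim conjE bexE)
    assume "v \<in> words \<E>" "Lw u v"
    moreover then obtain t where "v \<doteq> t @ u" unfolding Lw_def using cong_sym by blast
    ultimately show "\<exists>j\<in>I. \<exists>b\<in>G. bar \<E> v = T j b l" using 1 3 by blast
  next
    fix j b assume v: "v \<in> words \<E>" "j \<in> I" "b \<in> G" "bar \<E> v = T j b l"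
    show "Lw u v"
      unfolding Lw_def using 2[OF v u ial(1,2,4)] 2[OF u ial(1,2,4) v] cong_sym by blast
  qed
qed

text \<open>A seeded word is regular, so its \<D>-class has coordinates, and the two descriptions in
  \<open>Rw_triple\<close> and \<open>Lw_triple\<close> coincide.\<close>

sublocale stable_biorder
proof
  fix w t assume w: "seed w" "w \<in> words \<E>" and D: "Dw w (w @ t)"
  let ?D = "D_class (IG \<E>) (bar \<E> w)"
  have reg: "regular_D_class (IG \<E>) ?D" using D_class_seed w by blast
  interpret rees "IG \<E>" ?D "c ?D" by (rule rees[OF reg])
  have "bar \<E> w \<in> ?D" using D_class_bar[OF w(2,2)] Dw_Rw[OF Rw_refl] by blast
  then obtain i a l where ial: "i \<in> I" "a \<in> G" "l \<in> \<Lambda>" "bar \<E> w = T i a l" using triple_cases by metis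
  have wt: "w @ t \<in> words \<E>" using D w Dw_words by blast
  then have "bar \<E> (w @ t) \<in> ?D" using D_class_bar[OF w(2)] D by blast
  then have "Rw w (w @ t)"
    using Rw_triple[OF reg w(2) ial, of "w @ t"] wt cong_refl by blast
  then show "Rw (w @ t) w" by (rule Rw_sym)
next
  fix w t assume w: "seed w" "w \<in> words \<E>" and D: "Dw w (t @ w)"
  let ?D = "D_class (IG \<E>) (bar \<E> w)"
  have reg: "regular_D_class (IG \<E>) ?D" using D_class_seed w by blast
  interpret rees "IG \<E>" ?D "c ?D" by (rule rees[OF reg])
  have "bar \<E> w \<in> ?D" using D_class_bar[OF w(2,2)] Dw_Rw[OF Rw_refl] by blast
  then obtain i a l where ial: "i \<in> I" "a \<in> G" "l \<in> \<Lambda>" "bar \<E> w = T i a l" using triple_cases by metis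
  have wt: "t @ w \<in> words \<E>" using D w Dw_words by blast
  then have "bar \<E> (t @ w) \<in> ?D" using D_class_bar[OF w(2)] D by blast
  then have "Lw w (t @ w)"
    using Lw_triple[OF reg w(2) ial, of "t @ w"] wt cong_refl by blast
  then show "Lw (t @ w) w" by (rule Lw_sym)
qed

text \<open>With this, the regular factors of an r-factorisation are the seeded blocks.\<close>

lemma regular_iff_seed: "w \<in> words \<E> \<Longrightarrow> regular_elem (IG \<E>) (bar \<E> w) \<longleftrightarrow> seed w"
  using regular_if_seed seed_if_regular regular_bar by blast

end

section \<open>Contact automata\<close>

context coord_biorder
begin

text \<open>The definite description in \<open>right_action\<close> is resolved here: existence is
  \<open>right_mult_uniform\<close>, and uniqueness follows from comparing coordinates at the single
  triple (i, a, l).\<close>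

lemma right_action_total:
  assumes D: "regular_D_class (IG \<E>) D" and e: "e \<in> carrier \<E>"
    and ial: "i \<in> II (c D)" "a \<in> carrier (GG (c D))" "l \<in> LL (c D)"
    and mem: "triple (c D) (i, a, l) \<cdot>\<^bsub>IG \<E>\<^esub> bar \<E> [e] \<in> D"
  shows "\<exists>k\<in>LL (c D). \<exists>g\<in>carrier (GG (c D)). right_action \<E> c D l e = Some (k, g) \<and>
    (\<forall>j\<in>II (c D). \<forall>b\<in>carrier (GG (c D)).
       triple (c D) (j, b, l) \<cdot>\<^bsub>IG \<E>\<^esub> bar \<E> [e] = triple (c D) (j, b \<otimes>\<^bsub>GG (c D)\<^esub> g, k))"
proof -
  interpret rees "IG \<E>" D "c D" by (rule rees[OF D])
  have ec: "bar \<E> [e] \<in> carrier (IG \<E>)" using e by (auto simp: carrier_IG words_def)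
  obtain k g where kg: "k \<in> \<Lambda>" "g \<in> G" "\<And>j b. j \<in> I \<Longrightarrow> b \<in> G \<Longrightarrow>
      T j b l \<cdot>\<^bsub>IG \<E>\<^esub> bar \<E> [e] = T j (b \<otimes>\<^bsub>GG (c D)\<^esub> g) k"
    using right_mult_uniform[OF ial ec mem] by blast
  have "(THE (m, h). m \<in> \<Lambda> \<and> h \<in> G \<and> (\<forall>i\<in>I. \<forall>g\<in>G.
      T i g l \<cdot>\<^bsub>IG \<E>\<^esub> bar \<E> [e] = T i (g \<otimes>\<^bsub>GG (c D)\<^esub> h) m)) = (k, g)"
  proof (rule the_equality)
    fix u assume "case u of (m, h) \<Rightarrow> m \<in> \<Lambda> \<and> h \<in> G \<and> (\<forall>i\<in>I. \<forall>g\<in>G.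
      T i g l \<cdot>\<^bsub>IG \<E>\<^esub> bar \<E> [e] = T i (g \<otimes>\<^bsub>GG (c D)\<^esub> h) m)"
    then obtain m h where u: "u = (m, h)" "m \<in> \<Lambda>" "h \<in> G"
      "T i a l \<cdot>\<^bsub>IG \<E>\<^esub> bar \<E> [e] = T i (a \<otimes>\<^bsub>GG (c D)\<^esub> h) m"
      using ial by (cases u) auto
    then show "u = (k, g)"
      using kg(3)[OF ial(1,2)] kg(1,2) ial triple_eq_iff by simp
  qed (use kg in simp)
  then have "right_action \<E> c D l e = Some (k, g)"
    using mem ial unfolding right_action_def by auto
  then show ?thesis using kg by blast
qed

lemma left_action_total:
  assumes D: "regular_D_class (IG \<E>) D" and e: "e \<in> carrier \<E>"
    and ial: "i \<in> II (c D)" "a \<in> carrier (GG (c D))" "l \<in> LL (c D)"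
    and mem: "bar \<E> [e] \<cdot>\<^bsub>IG \<E>\<^esub> triple (c D) (i, a, l) \<in> D"
  shows "\<exists>j\<in>II (c D). \<exists>g\<in>carrier (GG (c D)). left_action \<E> c D e i = Some (j, g) \<and>
    (\<forall>b\<in>carrier (GG (c D)). \<forall>k\<in>LL (c D).
       bar \<E> [e] \<cdot>\<^bsub>IG \<E>\<^esub> triple (c D) (i, b, k) = triple (c D) (j, g \<otimes>\<^bsub>GG (c D)\<^esub> b, k))"
proof -
  interpret rees "IG \<E>" D "c D" by (rule rees[OF D])
  have ec: "bar \<E> [e] \<in> carrier (IG \<E>)" using e by (auto simp: carrier_IG words_def)
  obtain j g where jg: "j \<in> I" "g \<in> G" "\<And>b k. b \<in> G \<Longrightarrow> k \<in> \<Lambda> \<Longrightarrow>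
      bar \<E> [e] \<cdot>\<^bsub>IG \<E>\<^esub> T i b k = T j (g \<otimes>\<^bsub>GG (c D)\<^esub> b) k"
    using left_mult_uniform[OF ial ec mem] by blast
  have "(THE (j, h). j \<in> I \<and> h \<in> G \<and> (\<forall>g\<in>G. \<forall>l\<in>\<Lambda>.
      bar \<E> [e] \<cdot>\<^bsub>IG \<E>\<^esub> T i g l = T j (h \<otimes>\<^bsub>GG (c D)\<^esub> g) l)) = (j, g)"
  proof (rule the_equality)
    fix u assume "case u of (j, h) \<Rightarrow> j \<in> I \<and> h \<in> G \<and> (\<forall>g\<in>G. \<forall>l\<in>\<Lambda>.
      bar \<E> [e] \<cdot>\<^bsub>IG \<E>\<^esub> T i g l = T j (h \<otimes>\<^bsub>GG (c D)\<^esub> g) l)"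
    then obtain m h where u: "u = (m, h)" "m \<in> I" "h \<in> G"
      "bar \<E> [e] \<cdot>\<^bsub>IG \<E>\<^esub> T i a l = T m (h \<otimes>\<^bsub>GG (c D)\<^esub> a) l"
      using ial by (cases u) auto
    then show "u = (j, g)"
      using jg(3)[OF ial(2,3)] jg(1,2) ial triple_eq_iff by simp
  qed (use jg in simp)
  then have "left_action \<E> c D e i = Some (j, g)"
    using mem ial unfolding left_action_def by auto
  then show ?thesis using jg by blast
qed

lemma tau_eval:
  assumes D: "regular_D_class (IG \<E>) D" and e: "e \<in> carrier \<E>" and l: "l \<in> LL (c D)"
    and t: "tau \<E> c D l e = Some k"
  shows "k \<in> LL (c D)" "beta \<E> c D l e \<in> carrier (GG (c D))"
    "\<And>j b. j \<in> II (c D) \<Longrightarrow> b \<in> carrier (GG (c D)) \<Longrightarrow> triple (c D) (j, b, l) \<cdot>\<^bsub>IG \<E>\<^esub> bar \<E> [e] =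
      triple (c D) (j, b \<otimes>\<^bsub>GG (c D)\<^esub> beta \<E> c D l e, k)"
proof -
  obtain i a where "i \<in> II (c D)" "a \<in> carrier (GG (c D))"
    "triple (c D) (i, a, l) \<cdot>\<^bsub>IG \<E>\<^esub> bar \<E> [e] \<in> D"
    using t by (auto simp: tau_def right_action_def split: if_splits)
  from right_action_total[OF D e this(1,2) l this(3)] t
  show "k \<in> LL (c D)" "beta \<E> c D l e \<in> carrier (GG (c D))"
    "\<And>j b. j \<in> II (c D) \<Longrightarrow> b \<in> carrier (GG (c D)) \<Longrightarrow> triple (c D) (j, b, l) \<cdot>\<^bsub>IG \<E>\<^esub> bar \<E> [e] =
      triple (c D) (j, b \<otimes>\<^bsub>GG (c D)\<^esub> beta \<E> c D l e, k)"
    by (auto simp: tau_def beta_def)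
qed

text \<open>Because the action is uniform, one product of a triple with e already determines \<tau>
  and \<beta>.\<close>

lemma tau_intro:
  assumes D: "regular_D_class (IG \<E>) D" and e: "e \<in> carrier \<E>"
    and ial: "i \<in> II (c D)" "a \<in> carrier (GG (c D))" "l \<in> LL (c D)"
    and jbk: "j \<in> II (c D)" "b \<in> carrier (GG (c D))" "k \<in> LL (c D)"
    and eq: "triple (c D) (i, a, l) \<cdot>\<^bsub>IG \<E>\<^esub> bar \<E> [e] = triple (c D) (j, b, k)"
  shows "tau \<E> c D l e = Some k" "b = a \<otimes>\<^bsub>GG (c D)\<^esub> beta \<E> c D l e"
proof -
  interpret rees "IG \<E>" D "c D" by (rule rees[OF D])
  obtain m g where mg: "m \<in> \<Lambda>" "g \<in> G" "right_action \<E> c D l e = Some (m, g)"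
    "T i a l \<cdot>\<^bsub>IG \<E>\<^esub> bar \<E> [e] = T i (a \<otimes>\<^bsub>GG (c D)\<^esub> g) m"
    using right_action_total[OF D e ial] eq triple_in[OF jbk] ial by auto
  then have "m = k" "b = a \<otimes>\<^bsub>GG (c D)\<^esub> g" using eq triple_eq_iff ial jbk by auto
  then show "tau \<E> c D l e = Some k" "b = a \<otimes>\<^bsub>GG (c D)\<^esub> beta \<E> c D l e"
    using mg(3) by (auto simp: tau_def beta_def)
qed

lemma sigma_eval:
  assumes D: "regular_D_class (IG \<E>) D" and e: "e \<in> carrier \<E>" and i: "i \<in> II (c D)"
    and t: "sigma \<E> c D e i = Some j"
  shows "j \<in> II (c D)" "alpha \<E> c D e i \<in> carrier (GG (c D))"
    "\<And>b k. b \<in> carrier (GG (c D)) \<Longrightarrow> k \<in> LL (c D) \<Longrightarrow> bar \<E> [e] \<cdot>\<^bsub>IG \<E>\<^esub> triple (c D) (i, b, k) =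
      triple (c D) (j, alpha \<E> c D e i \<otimes>\<^bsub>GG (c D)\<^esub> b, k)"
proof -
  obtain a l where "a \<in> carrier (GG (c D))" "l \<in> LL (c D)"
    "bar \<E> [e] \<cdot>\<^bsub>IG \<E>\<^esub> triple (c D) (i, a, l) \<in> D"
    using t by (auto simp: sigma_def left_action_def split: if_splits)
  from left_action_total[OF D e i this] t
  show "j \<in> II (c D)" "alpha \<E> c D e i \<in> carrier (GG (c D))"
    "\<And>b k. b \<in> carrier (GG (c D)) \<Longrightarrow> k \<in> LL (c D) \<Longrightarrow> bar \<E> [e] \<cdot>\<^bsub>IG \<E>\<^esub> triple (c D) (i, b, k) =
      triple (c D) (j, alpha \<E> c D e i \<otimes>\<^bsub>GG (c D)\<^esub> b, k)"
    by (auto simp: sigma_def alpha_def)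
qed

lemma sigma_intro:
  assumes D: "regular_D_class (IG \<E>) D" and e: "e \<in> carrier \<E>"
    and ial: "i \<in> II (c D)" "a \<in> carrier (GG (c D))" "l \<in> LL (c D)"
    and jbk: "j \<in> II (c D)" "b \<in> carrier (GG (c D))" "k \<in> LL (c D)"
    and eq: "bar \<E> [e] \<cdot>\<^bsub>IG \<E>\<^esub> triple (c D) (i, a, l) = triple (c D) (j, b, k)"
  shows "sigma \<E> c D e i = Some j" "b = alpha \<E> c D e i \<otimes>\<^bsub>GG (c D)\<^esub> a"
proof -
  interpret rees "IG \<E>" D "c D" by (rule rees[OF D])
  obtain m g where mg: "m \<in> I" "g \<in> G" "left_action \<E> c D e i = Some (m, g)"
    "bar \<E> [e] \<cdot>\<^bsub>IG \<E>\<^esub> T i a l = T m (g \<otimes>\<^bsub>GG (c D)\<^esub> a) l"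
    using left_action_total[OF D e ial] eq triple_in[OF jbk] ial by auto
  then have "m = j" "b = g \<otimes>\<^bsub>GG (c D)\<^esub> a" using eq triple_eq_iff ial jbk by auto
  then show "sigma \<E> c D e i = Some j" "b = alpha \<E> c D e i \<otimes>\<^bsub>GG (c D)\<^esub> a"
    using mg(3) by (auto simp: sigma_def alpha_def)
qed

end

lemma dual_group_simps [simp]:
  "carrier (dual_group G) = carrier G" "\<one>\<^bsub>dual_group G\<^esub> = \<one>\<^bsub>G\<^esub>"
  "x \<otimes>\<^bsub>dual_group G\<^esub> y = y \<otimes>\<^bsub>G\<^esub> x"
  by (simp_all add: dual_group_def)

lemma group_dual_group: "group G \<Longrightarrow> group (dual_group G)"
proof -
  assume "group G"
  then interpret group G .
  show ?thesis
    by (rule groupI) (auto simp: m_assoc intro: bexI[of _ "inv\<^bsub>G\<^esub> _"])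
qed

lemma inv_dual_group:
  assumes "group G" "x \<in> carrier G"
  shows "inv\<^bsub>dual_group G\<^esub> x = inv\<^bsub>G\<^esub> x"
  using assms by (intro group.inv_equality group_dual_group) (auto simp: group.r_inv group.inv_closed)

context coord_biorder
begin

lemma group_GG: "regular_D_class (IG \<E>) D \<Longrightarrow> group (GG (c D))"
  using coord_choice by (auto simp: is_coord_choice_def is_rees_coords_def)

section \<open>Walks and vertex groups\<close>

context
  fixes D1 D2
  assumes D1: "regular_D_class (IG \<E>) D1" and D2: "regular_D_class (IG \<E>) D2"
begin

lemma group_contact: "group (contact_group c D1 D2)"
  using D1 D2 by (intro DirProd_group group_dual_group group_GG)

lemma inv_contact:
  "x \<in> carrier (GG (c D1)) \<Longrightarrow> y \<in> carrier (GG (c D2)) \<Longrightarrow>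
    inv\<^bsub>contact_group c D1 D2\<^esub> (x, y) = (inv\<^bsub>GG (c D1)\<^esub> x, inv\<^bsub>GG (c D2)\<^esub> y)"
  using D1 D2 by (simp add: inv_DirProd group_dual_group group_GG inv_dual_group)

lemma contact_edge_closed:
  assumes "contact_edge \<E> c D1 D2 u e g v"
  shows "g \<in> carrier (contact_group c D1 D2)" "u \<in> LL (c D1) \<times> II (c D2)" "v \<in> LL (c D1) \<times> II (c D2)"
  using assms tau_eval(2)[OF D1] sigma_eval(2)[OF D2] group.inv_closed group_GG[OF D1] group_GG[OF D2]
  by (auto elim!: contact_edge.cases)

text \<open>An edge is one use of associativity. In case (a) the letter e is split off the first
  triple and absorbed by the second, in case (b) it moves the other way. Labels act on the right of
  the first entry and on the left of the second.\<close>

lemma contact_edge_mult: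
  assumes "contact_edge \<E> c D1 D2 (l, i) e (x, y) (k, j)"
    and "h \<in> II (c D1)" "a \<in> carrier (GG (c D1))" "b \<in> carrier (GG (c D2))" "n \<in> LL (c D2)"
  shows "triple (c D1) (h, a, l) \<cdot>\<^bsub>IG \<E>\<^esub> triple (c D2) (i, b, n) =
    triple (c D1) (h, a \<otimes>\<^bsub>GG (c D1)\<^esub> x, k) \<cdot>\<^bsub>IG \<E>\<^esub> triple (c D2) (j, y \<otimes>\<^bsub>GG (c D2)\<^esub> b, n)"
proof -
  interpret A: rees "IG \<E>" D1 "c D1" by (rule rees[OF D1])
  interpret B: rees "IG \<E>" D2 "c D2" by (rule rees[OF D2])
  have ec: "bar \<E> [e] \<in> carrier (IG \<E>)" if "e \<in> carrier \<E>" using that by (auto simp: carrier_IG words_def)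
  from assms(1) show ?thesis
  proof (cases rule: contact_edge.cases)
    case edge_a
    let ?\<beta> = "beta \<E> c D1 k e"
    note t = tau_eval[OF D1 edge_a(3,5,8)] and s = sigma_eval[OF D2 edge_a(3,6,9)]
    have "A.T h a l = A.T h (a \<otimes>\<^bsub>GG (c D1)\<^esub> x) k \<cdot>\<^bsub>IG \<E>\<^esub> bar \<E> [e]"
      using t assms edge_a by (simp add: A.grp.m_assoc)
    then have "A.T h a l \<cdot>\<^bsub>IG \<E>\<^esub> B.T i b n =
        (A.T h (a \<otimes>\<^bsub>GG (c D1)\<^esub> x) k \<cdot>\<^bsub>IG \<E>\<^esub> bar \<E> [e]) \<cdot>\<^bsub>IG \<E>\<^esub> B.T i b n"
      by (rule arg_cong)
    also have "\<dots> = A.T h (a \<otimes>\<^bsub>GG (c D1)\<^esub> x) k \<cdot>\<^bsub>IG \<E>\<^esub> (bar \<E> [e] \<cdot>\<^bsub>IG \<E>\<^esub> B.T i b n)"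
      by (intro A.S_assoc A.triple_carrier B.triple_carrier) (use t(2) assms edge_a ec in auto)
    also have "bar \<E> [e] \<cdot>\<^bsub>IG \<E>\<^esub> B.T i b n = B.T j (y \<otimes>\<^bsub>GG (c D2)\<^esub> b) n"
      using s assms edge_a by simp
    finally show ?thesis .
  next
    case edge_b
    note t = tau_eval[OF D1 edge_b(3,4,8)] and s = sigma_eval[OF D2 edge_b(3,7,9)]
    have "B.T i b n = bar \<E> [e] \<cdot>\<^bsub>IG \<E>\<^esub> B.T j (y \<otimes>\<^bsub>GG (c D2)\<^esub> b) n"
      using s assms edge_b by (simp flip: B.grp.m_assoc)
    then have "A.T h a l \<cdot>\<^bsub>IG \<E>\<^esub> B.T i b n =
        (A.T h a l \<cdot>\<^bsub>IG \<E>\<^esub> bar \<E> [e]) \<cdot>\<^bsub>IG \<E>\<^esub> B.T j (y \<otimes>\<^bsub>GG (c D2)\<^esub> b) n"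
      using s assms edge_b ec by (simp add: A.S_assoc A.triple_carrier B.triple_carrier)
    also have "A.T h a l \<cdot>\<^bsub>IG \<E>\<^esub> bar \<E> [e] = A.T h (a \<otimes>\<^bsub>GG (c D1)\<^esub> x) k"
      using t assms edge_b by simp
    finally show ?thesis .
  qed
qed

lemma walk_closed:
  assumes "walk \<E> c D1 D2 u g v"
  shows "g \<in> carrier (contact_group c D1 D2)" "u \<in> LL (c D1) \<times> II (c D2)" "v \<in> LL (c D1) \<times> II (c D2)"
proof -
  interpret group "contact_group c D1 D2" by (rule group_contact)
  have "g \<in> carrier (contact_group c D1 D2) \<and> u \<in> LL (c D1) \<times> II (c D2) \<and> v \<in> LL (c D1) \<times> II (c D2)"
    using assms
  proof (induction rule: walk.induct)
    case (empty u)
    show ?case using empty one_closed by blast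
  next
    case (forward u g v e h w)
    then show ?case using contact_edge_closed[OF forward.hyps(2)] m_closed by blast
  next
    case (backward u g v w e h)
    then show ?case using contact_edge_closed[OF backward.hyps(2)] m_closed inv_closed by blast
  qed
  then show "g \<in> carrier (contact_group c D1 D2)" "u \<in> LL (c D1) \<times> II (c D2)" "v \<in> LL (c D1) \<times> II (c D2)"
    by blast+
qed

lemma walk_append:
  assumes "walk \<E> c D1 D2 v h w" "walk \<E> c D1 D2 u g v"
  shows "walk \<E> c D1 D2 u (g \<otimes>\<^bsub>contact_group c D1 D2\<^esub> h) w"
proof -
  interpret group "contact_group c D1 D2" by (rule group_contact)
  note g = walk_closed(1)[OF assms(2)]
  show ?thesis
    using assms
  proof (induction rule: walk.induct)
    case (empty u)
    then show ?case using r_one[OF g] by simp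
  next
    case (forward v h w e k z)
    then have "walk \<E> c D1 D2 u ((g \<otimes>\<^bsub>contact_group c D1 D2\<^esub> h) \<otimes>\<^bsub>contact_group c D1 D2\<^esub> k) z"
      by (intro walk.forward[OF _ forward.hyps(2)])
    then show ?case
      using m_assoc[OF g walk_closed(1)[OF forward.hyps(1)] contact_edge_closed(1)[OF forward.hyps(2)]]
      by metis
  next
    case (backward v h w z e k)
    then have "walk \<E> c D1 D2 u ((g \<otimes>\<^bsub>contact_group c D1 D2\<^esub> h) \<otimes>\<^bsub>contact_group c D1 D2\<^esub>
        inv\<^bsub>contact_group c D1 D2\<^esub> k) z"
      by (intro walk.backward[OF _ backward.hyps(2)])
    then show ?case
      using m_assoc[OF g walk_closed(1)[OF backward.hyps(1)] inv_closed[OF contact_edge_closed(1)[OF backward.hyps(2)]]]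
      by metis
  qed
qed

lemma walk_reverse:
  "walk \<E> c D1 D2 u g v \<Longrightarrow> walk \<E> c D1 D2 v (inv\<^bsub>contact_group c D1 D2\<^esub> g) u"
proof (induction rule: walk.induct)
  interpret group "contact_group c D1 D2" by (rule group_contact)
  {
    case (empty u)
    then show ?case using walk.empty inv_one by metis
  next
    case (forward u g v e h w)
    note cl = walk_closed[OF forward.hyps(1)] contact_edge_closed[OF forward.hyps(2)]
    have "walk \<E> c D1 D2 w (inv\<^bsub>contact_group c D1 D2\<^esub> h) v"
      using walk.backward[OF walk.empty[OF cl(6)] forward.hyps(2)] l_one inv_closed[OF cl(4)] by metis
    from walk_append[OF forward.IH this] show ?case using inv_mult_group[OF cl(1,4)] by metis
  next
    case (backward u g v w e h)
    note cl = walk_closed[OF backward.hyps(1)] contact_edge_closed[OF backward.hyps(2)]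
    have "walk \<E> c D1 D2 w h v"
      using walk.forward[OF walk.empty[OF cl(5)] backward.hyps(2)] l_one[OF cl(4)] by metis
    from walk_append[OF backward.IH this] show ?case
      using inv_mult_group[OF cl(1) inv_closed[OF cl(4)]] inv_inv[OF cl(4)] by metis
  }
qed

lemma subgroup_vertex_group:
  assumes "u \<in> LL (c D1) \<times> II (c D2)"
  shows "subgroup (vertex_group \<E> c D1 D2 u) (contact_group c D1 D2)"
proof -
  interpret group "contact_group c D1 D2" by (rule group_contact)
  show ?thesis
  proof
    show "vertex_group \<E> c D1 D2 u \<subseteq> carrier (contact_group c D1 D2)"
      using walk_closed(1) unfolding vertex_group_def by blast
    show "\<one>\<^bsub>contact_group c D1 D2\<^esub> \<in> vertex_group \<E> c D1 D2 u"
      using walk.empty[OF assms] unfolding vertex_group_def by blast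
  qed (use walk_append walk_reverse in \<open>unfold vertex_group_def, blast+\<close>)
qed

text \<open>The dual group in the second component is what makes the label of a composite walk act
  as the successive left multiplications along its edges.\<close>

lemma walk_mult:
  assumes "walk \<E> c D1 D2 u g v"
    and "h \<in> II (c D1)" "a \<in> carrier (GG (c D1))" "b \<in> carrier (GG (c D2))" "n \<in> LL (c D2)"
  shows "triple (c D1) (h, a, fst u) \<cdot>\<^bsub>IG \<E>\<^esub> triple (c D2) (snd u, b, n) =
    triple (c D1) (h, a \<otimes>\<^bsub>GG (c D1)\<^esub> fst g, fst v) \<cdot>\<^bsub>IG \<E>\<^esub>
    triple (c D2) (snd v, snd g \<otimes>\<^bsub>GG (c D2)\<^esub> b, n)"
proof -
  interpret A: group "GG (c D1)" by (rule group_GG[OF D1])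
  interpret B: group "GG (c D2)" by (rule group_GG[OF D2])
  show ?thesis
    using assms
  proof (induction arbitrary: a b rule: walk.induct)
    case (empty u)
    then show ?case by simp
  next
    case (forward u g v e k w)
    obtain x y p q where k: "k = (x, y)" "g = (p, q)" by (cases k, cases g)
    note cl = walk_closed[OF forward.hyps(1)] contact_edge_closed[OF forward.hyps(2)]
    have "contact_edge \<E> c D1 D2 (fst v, snd v) e (x, y) (fst w, snd w)"
      using forward.hyps(2) k by simp
    from contact_edge_mult[OF this forward.prems(1), of "a \<otimes>\<^bsub>GG (c D1)\<^esub> fst g" "snd g \<otimes>\<^bsub>GG (c D2)\<^esub> b" n]
    show ?case
      using forward.IH[OF forward.prems] forward.prems cl k
      by (simp add: A.m_assoc B.m_assoc mem_Times_iff)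
  next
    case (backward u g v w e k)
    obtain x y p q where k: "k = (x, y)" "g = (p, q)" by (cases k, cases g)
    note cl = walk_closed[OF backward.hyps(1)] contact_edge_closed[OF backward.hyps(2)]
    have xy: "x \<in> carrier (GG (c D1))" "y \<in> carrier (GG (c D2))" using cl(4) k by auto
    have "contact_edge \<E> c D1 D2 (fst w, snd w) e (x, y) (fst v, snd v)"
      using backward.hyps(2) k by simp
    \<comment> \<open>The edge is applied at its source to entries already divided by its label, so
      that its conclusion can be read backwards.\<close>
    from contact_edge_mult[OF this backward.prems(1),
        of "a \<otimes>\<^bsub>GG (c D1)\<^esub> fst g \<otimes>\<^bsub>GG (c D1)\<^esub> inv\<^bsub>GG (c D1)\<^esub> x"
          "inv\<^bsub>GG (c D2)\<^esub> y \<otimes>\<^bsub>GG (c D2)\<^esub> (snd g \<otimes>\<^bsub>GG (c D2)\<^esub> b)" n]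
    have "triple (c D1) (h, a \<otimes>\<^bsub>GG (c D1)\<^esub> fst g \<otimes>\<^bsub>GG (c D1)\<^esub> inv\<^bsub>GG (c D1)\<^esub> x, fst w) \<cdot>\<^bsub>IG \<E>\<^esub>
        triple (c D2) (snd w, inv\<^bsub>GG (c D2)\<^esub> y \<otimes>\<^bsub>GG (c D2)\<^esub> (snd g \<otimes>\<^bsub>GG (c D2)\<^esub> b), n) =
      triple (c D1) (h, a \<otimes>\<^bsub>GG (c D1)\<^esub> fst g, fst v) \<cdot>\<^bsub>IG \<E>\<^esub>
        triple (c D2) (snd v, snd g \<otimes>\<^bsub>GG (c D2)\<^esub> b, n)"
      using backward.prems cl xy
      by (simp add: A.m_assoc B.m_assoc[symmetric] mem_Times_iff)
    then show ?case
      using backward.IH[OF backward.prems] backward.prems cl xy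
      by (simp add: k inv_contact A.m_assoc B.m_assoc mem_Times_iff)
  qed
qed

end

end

section \<open>Equality of decompositions\<close>

context biorder
begin

text \<open>The recursive description of a slide is turned into one by positions, to fit
  decompositions that are indexed sequences. The first alternative covers slides of kind
  \<open>same\<close>.\<close>

lemma slide1_nth:
  assumes "slide1 xs ys"
  shows "length ys = length xs \<and> ((\<forall>n<length xs. xs ! n \<doteq> ys ! n) \<or>
    (\<exists>n e. Suc n < length xs \<and> (\<forall>k<length xs. k \<noteq> n \<longrightarrow> k \<noteq> Suc n \<longrightarrow> ys ! k = xs ! k) \<and>
       Rw (xs ! n) (ys ! n) \<and> Lw (xs ! Suc n) (ys ! Suc n) \<and>
       ((xs ! n \<doteq> ys ! n @ [e] \<and> ys ! Suc n \<doteq> [e] @ xs ! Suc n) \<or>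
        (ys ! n \<doteq> xs ! n @ [e] \<and> xs ! Suc n \<doteq> [e] @ ys ! Suc n))))"
  using assms
proof (induction rule: slide1.induct)
  case (same x x' q)
  then show ?case by (auto simp: nth_Cons')
next
  case (right x x' e y' y q)
  have "(x # y # q) ! k = (x' # y' # q) ! k" if "k \<noteq> 0" "k \<noteq> Suc 0" for k
    using that by (auto simp: nth_Cons')
  with right show ?case 
    by (intro conjI, simp) (rule disjI2, rule exI[of _ 0], rule exI[of _ e], auto)
next
  case (left x' x e y y' q)
  have "(x # y # q) ! k = (x' # y' # q) ! k" if "k \<noteq> 0" "k \<noteq> Suc 0" for k
    using that by (auto simp: nth_Cons')
  with left show ?case 
    by (intro conjI, simp) (rule disjI2, rule exI[of _ 0], rule exI[of _ e], auto)
next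
  case (tail q q' x)
  have len: "length q' = length q" using tail.IH by blast
  from tail.IH consider "\<forall>n<length q. q ! n \<doteq> q' ! n"
    | n e where "Suc n < length q" "\<forall>k<length q. k \<noteq> n \<longrightarrow> k \<noteq> Suc n \<longrightarrow> q' ! k = q ! k"
      "Rw (q ! n) (q' ! n)" "Lw (q ! Suc n) (q' ! Suc n)"
      "(q ! n \<doteq> q' ! n @ [e] \<and> q' ! Suc n \<doteq> [e] @ q ! Suc n) \<or>
        (q' ! n \<doteq> q ! n @ [e] \<and> q ! Suc n \<doteq> [e] @ q' ! Suc n)"
    by blast
  then show ?case
  proof cases
    case 1
    then show ?thesis using len by (auto simp: nth_Cons')
  next
    case 2
    have "(x # q') ! k = (x # q) ! k" if "k < length (x # q)" "k \<noteq> Suc n" "k \<noteq> Suc (Suc n)" for k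
      using that 2(2) by (cases k) auto
    then show ?thesis using 2 len 
      by (intro conjI, simp) (rule disjI2, rule exI[of _ "Suc n"], rule exI[of _ e], auto)
  qed
qed

end

lemma factors_0: "factors p (Suc 0) 0 = []"
  by (simp add: factors_def)

lemma factors_Suc: "factors p (Suc 0) (Suc n) = factors p (Suc 0) n @ p (Suc n)"
  by (simp add: factors_def)

context coord_biorder
begin

text \<open>Coordinates without minimality: slides are followed on this data alone, and
  \<open>irred\<close> is imposed at the end points.\<close>

definition represents ::
  "nat \<Rightarrow> (nat \<Rightarrow> 'e list set set) \<Rightarrow> (nat \<Rightarrow> 'i) \<Rightarrow> (nat \<Rightarrow> 'g) \<Rightarrow> (nat \<Rightarrow> 'l) \<Rightarrow> (nat \<Rightarrow> 'e list) \<Rightarrow> bool"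
where
  "represents m D i a l p \<longleftrightarrow> (\<forall>k\<in>{1..m}. p k \<in> words \<E> \<and> regular_D_class (IG \<E>) (D k) \<and>
     i k \<in> II (c (D k)) \<and> a k \<in> carrier (GG (c (D k))) \<and> l k \<in> LL (c (D k)) \<and>
     bar \<E> (p k) = triple (c (D k)) (i k, a k, l k))"

text \<open>The k-th walk has label (x k, y k); its first part multiplies factor k on the right, its
  second part factor k + 1 on the left. So factor k receives \<open>y (k - 1)\<close> and
  \<open>x k\<close>, and \<open>y 0\<close> and \<open>x m\<close> are identities because nothing
  lies outside the first and last factors.\<close>

definition tuple_walk ::
  "nat \<Rightarrow> (nat \<Rightarrow> 'e list set set) \<Rightarrow> (nat \<Rightarrow> 'i) \<Rightarrow> (nat \<Rightarrow> 'g) \<Rightarrow> (nat \<Rightarrow> 'l) \<Rightarrow>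
   (nat \<Rightarrow> 'i) \<Rightarrow> (nat \<Rightarrow> 'g) \<Rightarrow> (nat \<Rightarrow> 'l) \<Rightarrow> bool"
where
  "tuple_walk m D i a l i' a' l' \<longleftrightarrow> i' 1 = i 1 \<and> l' m = l m \<and>
     (\<exists>x y. y 0 = \<one>\<^bsub>GG (c (D 1))\<^esub> \<and> x m = \<one>\<^bsub>GG (c (D m))\<^esub> \<and>
       (\<forall>k\<in>{1..<m}. walk \<E> c (D k) (D (Suc k)) (l k, i (Suc k)) (x k, y k) (l' k, i' (Suc k))) \<and>
       (\<forall>k\<in>{1..m}. a' k = y (k - 1) \<otimes>\<^bsub>GG (c (D k))\<^esub> a k \<otimes>\<^bsub>GG (c (D k))\<^esub> x k))"

lemma representsD:
  assumes "represents m D i a l p" "1 \<le> k" "k \<le> m"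
  shows "p k \<in> words \<E>" "regular_D_class (IG \<E>) (D k)" "i k \<in> II (c (D k))"
    "a k \<in> carrier (GG (c (D k)))" "l k \<in> LL (c (D k))" "bar \<E> (p k) = triple (c (D k)) (i k, a k, l k)"
  using assms by (auto simp: represents_def)

lemma represents_D_class:
  assumes "represents m D i a l p" "1 \<le> k" "k \<le> m"
  shows "D_class (IG \<E>) (bar \<E> (p k)) = D k" "seed (p k)"
proof -
  note r = representsD[OF assms]
  interpret rees "IG \<E>" "D k" "c (D k)" by (rule rees[OF r(2)])
  show D: "D_class (IG \<E>) (bar \<E> (p k)) = D k"
    using D_class_member[OF r(2,1)] triple_in r by simp
  obtain w where w: "w \<in> words \<E>" "regular_elem (IG \<E>) (bar \<E> w)" "D k = D_class (IG \<E>) (bar \<E> w)"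
    using r(2) by (auto simp: regular_D_class_def regular_elem_def carrier_IG)
  then show "seed (p k)"
    using D_class_eq[OF r(1) w(1)] D seed_Dw regular_iff_seed[OF w(1)] by simp
qed

lemma tuple_walk_refl:
  assumes "represents m D i a l p" "1 \<le> m"
  shows "tuple_walk m D i a l i a l"
proof -
  define y where "y k = \<one>\<^bsub>GG (c (D (Suc k)))\<^esub>" for k
  define x where "x k = \<one>\<^bsub>GG (c (D k))\<^esub>" for k
  have w: "walk \<E> c (D k) (D (Suc k)) (l k, i (Suc k)) (x k, y k) (l k, i (Suc k))" if "k \<in> {1..<m}" for k
  proof -
    have "(l k, i (Suc k)) \<in> LL (c (D k)) \<times> II (c (D (Suc k)))"
      using representsD[OF assms(1)] that by simp
    from walk.empty[of _ c "D k" "D (Suc k)", OF this] show ?thesis by (simp add: x_def y_def)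
  qed
  have "a k = y (k - 1) \<otimes>\<^bsub>GG (c (D k))\<^esub> a k \<otimes>\<^bsub>GG (c (D k))\<^esub> x k" if "k \<in> {1..m}" for k
  proof -
    interpret group "GG (c (D k))" using representsD[OF assms(1)] that by (intro group_GG) simp
    show ?thesis using representsD[OF assms(1)] that by (simp add: x_def y_def)
  qed
  with w show ?thesis unfolding tuple_walk_def
    by (intro conjI refl exI[of _ x] exI[of _ y]) (simp_all add: x_def y_def)
qed

lemma tuple_walk_closed:
  assumes r: "represents m D i a l p"
    and "y 0 = \<one>\<^bsub>GG (c (D 1))\<^esub>" "x m = \<one>\<^bsub>GG (c (D m))\<^esub>"
    and w: "\<forall>k\<in>{1..<m}. walk \<E> c (D k) (D (Suc k)) (l k, i (Suc k)) (x k, y k) (l' k, i' (Suc k))"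
    and k: "1 \<le> k" "k \<le> m"
  shows "x k \<in> carrier (GG (c (D k)))" "y (k - 1) \<in> carrier (GG (c (D k)))"
proof -
  have cl: "x j \<in> carrier (GG (c (D j)))" "y j \<in> carrier (GG (c (D (Suc j))))" if "1 \<le> j" "j < m" for j
    using walk_closed(1)[OF representsD(2)[OF r] representsD(2)[OF r], of j "Suc j"] w that by force+
  interpret group "GG (c (D k))" using representsD(2)[OF r k] by (rule group_GG)
  show "x k \<in> carrier (GG (c (D k)))" using cl(1)[of k] k assms(3) one_closed by (cases "k = m") auto
  show "y (k - 1) \<in> carrier (GG (c (D k)))" using cl(2)[of "k - 1"] k assms(2) one_closed by (cases "k = 1") auto
qed

text \<open>The \<R>-condition of a slide between factors k and k + 1 fixes i_k, the \<L>-condition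
  fixes \<lambda>_{k+1}. What changes is the vertex (\<lambda>_k, i_{k+1}), and it changes along an
  edge, which is appended to the k-th walk.\<close>

lemma slide1_represents:
  assumes r: "represents m D i a l p" and s: "slide1 (map p [1..<Suc m]) zs"
    and r0: "represents m D i0 a0 l0 p0" and t: "tuple_walk m D i0 a0 l0 i a l"
  shows "\<exists>i' a' l'. represents m D i' a' l' (\<lambda>k. zs ! (k - 1)) \<and> tuple_walk m D i0 a0 l0 i' a' l'"
proof -
  let ?xs = "map p [1..<Suc m]"
  have nth: "?xs ! (k - 1) = p k" if "1 \<le> k" "k \<le> m" for k
    using that by (simp del: upt_Suc)
  from slide1_nth[OF s] consider "\<forall>n<m. ?xs ! n \<doteq> zs ! n"
    | n e where "Suc n < m" "\<forall>k<m. k \<noteq> n \<longrightarrow> k \<noteq> Suc n \<longrightarrow> zs ! k = ?xs ! k"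
       "Rw (?xs ! n) (zs ! n)" "Lw (?xs ! Suc n) (zs ! Suc n)"
       "(?xs ! n \<doteq> zs ! n @ [e] \<and> zs ! Suc n \<doteq> [e] @ ?xs ! Suc n) \<or>
        (zs ! n \<doteq> ?xs ! n @ [e] \<and> ?xs ! Suc n \<doteq> [e] @ zs ! Suc n)"
    by (auto simp del: nth_map upt_Suc)
  then show ?thesis
  proof cases
    case 1
    have "zs ! (k - 1) \<in> words \<E> \<and> bar \<E> (zs ! (k - 1)) = bar \<E> (p k)" if "1 \<le> k" "k \<le> m" for k
    proof -
      have pz: "p k \<doteq> zs ! (k - 1)" using 1[rule_format, of "k - 1"] nth[OF that] that by simp
      then have "zs ! (k - 1) \<in> words \<E>" using cong_words[OF pz] representsD(1)[OF r that] by simp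
      then show ?thesis using pz bar_eq_cong[OF representsD(1)[OF r that], of "zs ! (k - 1)"] by auto
    qed
    then have "represents m D i a l (\<lambda>k. zs ! (k - 1))"
      using r unfolding represents_def by simp
    then show ?thesis using t by blast
  next
    case 2
    \<comment> \<open>List positions start at 0, factors at 1.\<close>
    define k where "k = Suc n"
    have k: "1 \<le> k" "k < m" "k \<le> m" "1 \<le> Suc k" "Suc k \<le> m" using 2(1) by (auto simp: k_def)
    define u v where "u = zs ! n" and "v = zs ! Suc n"
    have R: "Rw (p k) u" and L: "Lw (p (Suc k)) v"
      and e: "(p k \<doteq> u @ [e] \<and> v \<doteq> [e] @ p (Suc k)) \<or> (u \<doteq> p k @ [e] \<and> p (Suc k) \<doteq> [e] @ v)"
      using 2(1,3-5) by (simp_all add: k_def u_def v_def del: upt_Suc)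
    note rk = representsD[OF r k(1,3)] and rS = representsD[OF r k(4,5)]
    have uw: "u \<in> words \<E>" and vw: "v \<in> words \<E>"
      using Rw_words[OF R rk(1)] Lw_words[OF L rS(1)] by blast+
    obtain b \<mu> where b: "b \<in> carrier (GG (c (D k)))" "\<mu> \<in> LL (c (D k))"
      "bar \<E> u = triple (c (D k)) (i k, b, \<mu>)"
      using Rw_triple(2)[OF rk(2,1,3-6), of u] uw R by blast
    obtain j d where d: "j \<in> II (c (D (Suc k)))" "d \<in> carrier (GG (c (D (Suc k))))"
      "bar \<E> v = triple (c (D (Suc k))) (j, d, l (Suc k))"
      using Lw_triple(2)[OF rS(2,1,3-6), of v] vw L by blast
    have ec: "e \<in> carrier \<E>"
      using e cong_set[of "p k" "u @ [e]"] cong_set[of "p (Suc k)" "[e] @ v"] rk(1) rS(1)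
      by (auto simp: words_def)
    then have ew: "[e] \<in> words \<E>" by (simp add: words_def)
    interpret A: rees "IG \<E>" "D k" "c (D k)" by (rule rees[OF rk(2)])
    interpret B: rees "IG \<E>" "D (Suc k)" "c (D (Suc k))" by (rule rees[OF rS(2)])
    have bar_snoc: "bar \<E> s = bar \<E> s' \<cdot>\<^bsub>IG \<E>\<^esub> bar \<E> [e]"
      if "s \<doteq> s' @ [e]" "s \<in> words \<E>" "s' \<in> words \<E>" for s s'
      using that bar_eq_cong[of s "s' @ [e]"] bar_mult[OF that(3) ew] bar_mult_append(1)[OF that(3), of "[e]"] ec
      by simp
    have bar_Cons: "bar \<E> s = bar \<E> [e] \<cdot>\<^bsub>IG \<E>\<^esub> bar \<E> s'"
      if "s \<doteq> [e] @ s'" "s \<in> words \<E>" "s' \<in> words \<E>" for s s'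
      using that bar_eq_cong[of s "[e] @ s'"] bar_mult[OF ew that(3)] bar_mult_append(2)[OF that(3), of "[e]"] ec
      by simp
    \<comment> \<open>If factor k loses the letter e, its old last index is the image under \<tau>
      of the new one, which is an edge of type (a); if it gains e, the edge has type (b).\<close>
    obtain g h where edge: "contact_edge \<E> c (D k) (D (Suc k)) (l k, i (Suc k)) e (g, h) (\<mu>, j)"
      and gh: "b = a k \<otimes>\<^bsub>GG (c (D k))\<^esub> g" "d = h \<otimes>\<^bsub>GG (c (D (Suc k)))\<^esub> a (Suc k)"
      using e
    proof (elim disjE conjE)
      assume "p k \<doteq> u @ [e]" "v \<doteq> [e] @ p (Suc k)"
      then have bb: "bar \<E> (p k) = bar \<E> u \<cdot>\<^bsub>IG \<E>\<^esub> bar \<E> [e]"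
        "bar \<E> v = bar \<E> [e] \<cdot>\<^bsub>IG \<E>\<^esub> bar \<E> (p (Suc k))"
        using bar_snoc bar_Cons uw vw rk(1) rS(1) by blast+
      note t = tau_intro[OF rk(2) ec rk(3) b(1,2) rk(3-5)] and s = sigma_intro[OF rS(2) ec rS(3-5) d(1,2) rS(5)]
      have t': "tau \<E> c (D k) \<mu> e = Some (l k)" "a k = b \<otimes>\<^bsub>GG (c (D k))\<^esub> beta \<E> c (D k) \<mu> e"
        and s': "sigma \<E> c (D (Suc k)) e (i (Suc k)) = Some j"
          "d = alpha \<E> c (D (Suc k)) e (i (Suc k)) \<otimes>\<^bsub>GG (c (D (Suc k)))\<^esub> a (Suc k)"
        using t s bb b(3) d(3) rk(6) rS(6) by simp_all
      show ?thesis
      proof (rule that[OF edge_a[OF ec rk(5) b(2) rS(3) d(1) t'(1) s'(1)] _ s'(2)])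
        show "b = a k \<otimes>\<^bsub>GG (c (D k))\<^esub> inv\<^bsub>GG (c (D k))\<^esub> beta \<E> c (D k) \<mu> e"
          using tau_eval(2)[OF rk(2) ec b(2) t'(1)] b(1) t'(2) by (simp add: A.grp.m_assoc)
      qed
    next
      assume "u \<doteq> p k @ [e]" "p (Suc k) \<doteq> [e] @ v"
      then have bb: "bar \<E> u = bar \<E> (p k) \<cdot>\<^bsub>IG \<E>\<^esub> bar \<E> [e]"
        "bar \<E> (p (Suc k)) = bar \<E> [e] \<cdot>\<^bsub>IG \<E>\<^esub> bar \<E> v"
        using bar_snoc bar_Cons uw vw rk(1) rS(1) by blast+
      note t = tau_intro[OF rk(2) ec rk(3-5) rk(3) b(1,2)] and s = sigma_intro[OF rS(2) ec d(1,2) rS(5,3-5)]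
      have t': "tau \<E> c (D k) (l k) e = Some \<mu>" "b = a k \<otimes>\<^bsub>GG (c (D k))\<^esub> beta \<E> c (D k) (l k) e"
        and s': "sigma \<E> c (D (Suc k)) e j = Some (i (Suc k))"
          "a (Suc k) = alpha \<E> c (D (Suc k)) e j \<otimes>\<^bsub>GG (c (D (Suc k)))\<^esub> d"
        using t s bb b(3) d(3) rk(6) rS(6) by simp_all
      show ?thesis
      proof (rule that[OF edge_b[OF ec rk(5) b(2) rS(3) d(1) t'(1) s'(1)] t'(2)])
        show "d = inv\<^bsub>GG (c (D (Suc k)))\<^esub> alpha \<E> c (D (Suc k)) e j \<otimes>\<^bsub>GG (c (D (Suc k)))\<^esub> a (Suc k)"
          using sigma_eval(2)[OF rS(2) ec d(1) s'(1)] d(2) s'(2) by (simp flip: B.grp.m_assoc)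
      qed
    qed
    have gh_in: "g \<in> carrier (GG (c (D k)))" "h \<in> carrier (GG (c (D (Suc k))))"
      using contact_edge_closed(1)[OF rk(2) rS(2) edge] by auto
    let ?i = "i(Suc k := j)" and ?a = "a(k := b, Suc k := d)" and ?l = "l(k := \<mu>)"
    have "represents m D ?i ?a ?l (\<lambda>k. zs ! (k - 1))"
      unfolding represents_def
    proof
      fix q assume q: "q \<in> {1..m}"
      consider "q = k" | "q = Suc k" | "q \<noteq> k" "q \<noteq> Suc k" by blast
      then show "zs ! (q - 1) \<in> words \<E> \<and> regular_D_class (IG \<E>) (D q) \<and>
         ?i q \<in> II (c (D q)) \<and> ?a q \<in> carrier (GG (c (D q))) \<and> ?l q \<in> LL (c (D q)) \<and>
         bar \<E> (zs ! (q - 1)) = triple (c (D q)) (?i q, ?a q, ?l q)"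
      proof cases
        case 1
        then show ?thesis using rk b uw by (simp add: u_def k_def)
      next
        case 2
        then show ?thesis using rS d vw by (simp add: v_def k_def)
      next
        case 3
        then have "q - 1 < m" "q - 1 \<noteq> n" "q - 1 \<noteq> Suc n" using q by (auto simp: k_def)
        then have "zs ! (q - 1) = ?xs ! (q - 1)" using 2(2) by blast
        then have "zs ! (q - 1) = p q" using nth q by simp
        then show ?thesis using representsD[OF r, of q] 3 q by simp
      qed
    qed
    moreover have "tuple_walk m D i0 a0 l0 ?i ?a ?l"
    proof -
      obtain x y where xy: "y 0 = \<one>\<^bsub>GG (c (D 1))\<^esub>" "x m = \<one>\<^bsub>GG (c (D m))\<^esub>"
        and w: "\<forall>k\<in>{1..<m}. walk \<E> c (D k) (D (Suc k)) (l0 k, i0 (Suc k)) (x k, y k) (l k, i (Suc k))"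
        and axy: "\<forall>k\<in>{1..m}. a k = y (k - 1) \<otimes>\<^bsub>GG (c (D k))\<^esub> a0 k \<otimes>\<^bsub>GG (c (D k))\<^esub> x k"
        using t unfolding tuple_walk_def by blast
      note cl = tuple_walk_closed[OF r0 xy w]
      \<comment> \<open>The label of the new edge is appended to the k-th walk: on the right of
        \<open>x k\<close>, but on the left of \<open>y k\<close>, as the second component is
        dual.\<close>
      let ?x = "x(k := x k \<otimes>\<^bsub>GG (c (D k))\<^esub> g)" and ?y = "y(k := h \<otimes>\<^bsub>GG (c (D (Suc k)))\<^esub> y k)"
      have "walk \<E> c (D q) (D (Suc q)) (l0 q, i0 (Suc q)) (?x q, ?y q) (?l q, ?i (Suc q))"
        if q: "q \<in> {1..<m}" for q
      proof (cases "q = k")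
        case True
        have "walk \<E> c (D k) (D (Suc k)) (l0 k, i0 (Suc k)) (x k, y k) (l k, i (Suc k))" using w k by simp
        from walk.forward[OF this edge] show ?thesis using True by simp
      next
        case False
        then show ?thesis using w q by simp
      qed
      moreover have "?a q = ?y (q - 1) \<otimes>\<^bsub>GG (c (D q))\<^esub> a0 q \<otimes>\<^bsub>GG (c (D q))\<^esub> ?x q"
        if q: "q \<in> {1..m}" for q
      proof -
        consider "q = k" | "q = Suc k" | "q \<noteq> k" "q \<noteq> Suc k" by blast
        then show ?thesis
        proof cases
          case 1
          have "k - 1 \<noteq> k" using k by simp
          then show ?thesis
            using 1 axy[rule_format, of k] k gh(1) cl[OF k(1,3)] gh_in representsD(4)[OF r0 k(1,3)]
            by (simp add: A.grp.m_assoc)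
        next
          case 2
          have "y k \<in> carrier (GG (c (D (Suc k))))" using cl(2)[OF k(4,5)] by simp
          then show ?thesis
            using 2 axy[rule_format, of "Suc k"] k gh(2) cl[OF k(4,5)] gh_in representsD(4)[OF r0 k(4,5)]
            by (simp add: B.grp.m_assoc)
        next
          case 3
          then have "q - 1 \<noteq> k" using q by auto
          then show ?thesis using 3 axy q by simp
        qed
      qed
      moreover have "?i 1 = i0 1" "?l m = l0 m" "?y 0 = \<one>\<^bsub>GG (c (D 1))\<^esub>" "?x m = \<one>\<^bsub>GG (c (D m))\<^esub>"
        using t k xy by (auto simp: tuple_walk_def)
      ultimately show ?thesis unfolding tuple_walk_def by blast
    qed
    ultimately show ?thesis by blast
  qed
qed

lemma slide_represents:
  assumes r0: "represents m D i a l p" and m: "1 \<le> m" and s: "slide (map p [1..<Suc m]) zs"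
  shows "\<exists>i' a' l'. represents m D i' a' l' (\<lambda>k. zs ! (k - 1)) \<and> tuple_walk m D i a l i' a' l'"
  using s
proof (induction rule: rtranclp_induct)
  case base
  have "represents m D i a l (\<lambda>k. map p [1..<Suc m] ! (k - 1))"
    using r0 unfolding represents_def by (auto simp del: upt_Suc)
  then show ?case using tuple_walk_refl[OF r0 m] by blast
next
  case (step ys zs)
  then obtain i' a' l' where *: "represents m D i' a' l' (\<lambda>k. ys ! (k - 1))" "tuple_walk m D i a l i' a' l'"
    by blast
  have "length ys = m" using slide_length[OF step.hyps(1)] by simp
  then have "map (\<lambda>k. ys ! (k - 1)) [1..<Suc m] = ys"
    by (intro nth_equalityI) (auto simp del: upt_Suc)
  then show ?case using slide1_represents[OF *(1) _ r0 *(2), of zs] step.hyps(2) by simp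
qed

lemma represents_unique:
  assumes "represents m D i a l p" "represents m D i' a' l' p'" "\<And>k. 1 \<le> k \<Longrightarrow> k \<le> m \<Longrightarrow> p k = p' k"
    and "1 \<le> k" "k \<le> m"
  shows "i k = i' k" "a k = a' k" "l k = l' k"
proof -
  note r = representsD[OF assms(1,4,5)] and r' = representsD[OF assms(2,4,5)]
  interpret rees "IG \<E>" "D k" "c (D k)" by (rule rees[OF r(2)])
  show "i k = i' k" "a k = a' k" "l k = l' k"
    using triple_eq_iff[OF r(3-5) r'(3-5)] r(6) r'(6) assms(3)[OF assms(4,5)] by simp_all
qed

lemma tuple_walk_cong:
  assumes "\<And>k. 1 \<le> k \<Longrightarrow> k \<le> m \<Longrightarrow> i1 k = i2 k" "\<And>k. 1 \<le> k \<Longrightarrow> k \<le> m \<Longrightarrow> a1 k = a2 k"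
    "\<And>k. 1 \<le> k \<Longrightarrow> k \<le> m \<Longrightarrow> l1 k = l2 k" "1 \<le> m"
  shows "tuple_walk m D i a l i1 a1 l1 \<longleftrightarrow> tuple_walk m D i a l i2 a2 l2"
  using assms unfolding tuple_walk_def by simp

text \<open>The walks are applied from left to right, each one turning the next factor of the first
  decomposition into that of the second.\<close>

lemma tuple_walk_product:
  assumes r: "represents m D i a l p" and r': "represents m D i' a' l' p'"
    and t: "tuple_walk m D i a l i' a' l'" and m: "1 \<le> m"
  shows "factors p 1 m \<doteq> factors p' 1 m"
proof -
  obtain x y where xy: "y 0 = \<one>\<^bsub>GG (c (D 1))\<^esub>" "x m = \<one>\<^bsub>GG (c (D m))\<^esub>"
    and w: "\<forall>k\<in>{1..<m}. walk \<E> c (D k) (D (Suc k)) (l k, i (Suc k)) (x k, y k) (l' k, i' (Suc k))"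
    and axy: "\<forall>k\<in>{1..m}. a' k = y (k - 1) \<otimes>\<^bsub>GG (c (D k))\<^esub> a k \<otimes>\<^bsub>GG (c (D k))\<^esub> x k"
    and ends: "i' 1 = i 1" "l' m = l m"
    using t unfolding tuple_walk_def by blast
  note cl = tuple_walk_closed[OF r xy w]
  \<comment> \<open>The word t is the factor in transit: it already has the new first index and the
    left multiplier y n, but still the old last index and no right multiplier.\<close>
  have "\<exists>t\<in>words \<E>. bar \<E> t = triple (c (D (Suc n))) (i' (Suc n), y n \<otimes>\<^bsub>GG (c (D (Suc n)))\<^esub> a (Suc n), l (Suc n))
    \<and> factors p 1 (Suc n) \<doteq> factors p' 1 n @ t" if "Suc n \<le> m" for n
    using that
  proof (induction n)
    case 0
    interpret group "GG (c (D (Suc 0)))" using representsD(2)[OF r _ m] by (intro group_GG) simp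
    have "bar \<E> (p 1) = triple (c (D 1)) (i' 1, y 0 \<otimes>\<^bsub>GG (c (D 1))\<^esub> a 1, l 1)"
      using representsD[OF r _ m] xy(1) ends by simp
    then show ?case using representsD(1)[OF r _ m] by (auto simp: factors_0 factors_Suc)
  next
    case (Suc n)
    let ?k = "Suc n" and ?K = "Suc (Suc n)"
    have k: "1 \<le> ?k" "?k \<le> m" "1 \<le> ?K" "?K \<le> m" using Suc.prems by auto
    note rk = representsD[OF r k(1,2)] and rK = representsD[OF r k(3,4)]
      and rk' = representsD[OF r' k(1,2)] and rK' = representsD[OF r' k(3,4)]
    interpret A: rees "IG \<E>" "D ?k" "c (D ?k)" by (rule rees[OF rk(2)])
    interpret B: rees "IG \<E>" "D ?K" "c (D ?K)" by (rule rees[OF rK(2)])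
    obtain t where t: "t \<in> words \<E>" "bar \<E> t = triple (c (D ?k)) (i' ?k, y n \<otimes>\<^bsub>GG (c (D ?k))\<^esub> a ?k, l ?k)"
      "factors p 1 ?k \<doteq> factors p' 1 n @ t"
      using Suc.IH k by auto
    have yn: "y n \<in> carrier (GG (c (D ?k)))" and yk: "y ?k \<in> carrier (GG (c (D ?K)))"
      using cl(2)[OF k(1,2)] cl(2)[OF k(3,4)] by simp_all
    have "B.T (i' ?K) (y ?k \<otimes>\<^bsub>GG (c (D ?K))\<^esub> a ?K) (l ?K) \<in> carrier (IG \<E>)"
      using rK rK' yk by (intro B.triple_carrier) auto
    then obtain s where s: "s \<in> words \<E>"
      "bar \<E> s = B.T (i' ?K) (y ?k \<otimes>\<^bsub>GG (c (D ?K))\<^esub> a ?K) (l ?K)"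
      by (auto simp: carrier_IG)
    have "walk \<E> c (D ?k) (D ?K) (l ?k, i ?K) (x ?k, y ?k) (l' ?k, i' ?K)" using w k by simp
    from walk_mult[OF rk(2) rK(2) this rk'(3), of "y n \<otimes>\<^bsub>GG (c (D ?k))\<^esub> a ?k" "a ?K" "l ?K"]
    have "bar \<E> t \<cdot>\<^bsub>IG \<E>\<^esub> bar \<E> (p ?K) = bar \<E> (p' ?k) \<cdot>\<^bsub>IG \<E>\<^esub> bar \<E> s"
      using t(2) s(2) rk rK rk' yn axy[rule_format, of ?k] k by simp
    then have "bar \<E> (t @ p ?K) = bar \<E> (p' ?k @ s)"
      using bar_mult[OF t(1) rK(1)] bar_mult[OF rk'(1) s(1)] by simp
    then have "t @ p ?K \<doteq> p' ?k @ s"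
      using t(1) rK(1) rk'(1) s(1) by (subst (asm) bar_eq_cong) (auto simp: words_def)
    have "factors p 1 ?K = factors p 1 ?k @ p ?K" by (simp add: factors_Suc)
    also have "\<dots> \<doteq> (factors p' 1 n @ t) @ p ?K" by (rule cong_append_right[OF t(3)])
    also have "\<dots> = factors p' 1 n @ t @ p ?K" by simp
    also have "\<dots> \<doteq> factors p' 1 n @ p' ?k @ s" by (rule cong_append_left[OF \<open>t @ p ?K \<doteq> p' ?k @ s\<close>])
    also have "\<dots> = factors p' 1 ?k @ s" by (simp add: factors_Suc)
    finally show ?case using s by auto
  qed
  from this[of "m - 1"] m obtain t where t: "t \<in> words \<E>"
    "bar \<E> t = triple (c (D m)) (i' m, y (m - 1) \<otimes>\<^bsub>GG (c (D m))\<^esub> a m, l m)"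
    "factors p 1 m \<doteq> factors p' 1 (m - 1) @ t"
    by auto
  note r'm = representsD[OF r' m order_refl] and rm = representsD[OF r m order_refl]
  interpret group "GG (c (D m))" using rm(2) by (rule group_GG)
  have "bar \<E> t = bar \<E> (p' m)"
    using t(2) r'm(6) axy[rule_format, of m] m xy(2) ends cl(2)[OF m order_refl] rm(4) by simp
  then have "t \<doteq> p' m" using bar_eq_cong t(1) r'm(1) by blast
  then have "factors p' 1 (m - 1) @ t \<doteq> factors p' 1 (m - 1) @ p' m" by (rule cong_append_left)
  then have "factors p 1 m \<doteq> factors p' 1 (m - 1) @ p' m" using t(3) cong_trans by blast
  also have "factors p' 1 (m - 1) @ p' m = factors p' 1 m"
    using factors_Suc[of p' "m - 1"] m by simp
  finally show ?thesis .
qed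

text \<open>Irreducibility only speaks of adjacent blocks, whereas minimality speaks of all
  intervals. An interval of an irreducible list is irreducible, and \<open>irred_not_seed\<close>
  applies to it.\<close>

lemma irred_factors:
  assumes r: "represents m D i a l p" and irr: "irred (map p [1..<Suc m])" and jk: "1 \<le> j" "j < k" "k \<le> m"
  shows "\<not> seed (factors p j k)"
proof -
  have "irred (map p [j..<Suc k])"
    unfolding irred_iff
  proof (intro allI impI)
    fix n assume n: "Suc n < length (map p [j..<Suc k])"
    have nm: "Suc (j - 1 + n) < length (map p [1..<Suc m])" using n jk by simp
    have "\<not> seed (map p [1..<Suc m] ! (j - 1 + n) @ map p [1..<Suc m] ! Suc (j - 1 + n))"
      using irr nm unfolding irred_iff by blast
    then show "\<not> seed (map p [j..<Suc k] ! n @ map p [j..<Suc k] ! Suc n)"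
      using n jk by (simp del: upt_Suc)
  qed
  then have "\<not> seed (concat (map p [j..<Suc k]))"
    using jk represents_D_class(2)[OF r] by (intro irred_not_seed) (auto simp del: upt_Suc)
  then show ?thesis by (simp add: factors_def)
qed

lemma factors_words:
  assumes "\<forall>q\<in>{j..k}. p q \<in> words \<E>" "j \<le> k"
  shows "factors p j k \<in> words \<E>"
  using assms by (force simp: factors_def words_def)

text \<open>Replacing regular by seeded turns minimality of the r-factorisation into irreducibility
  for merges.\<close>

lemma is_decomposition_iff:
  "is_decomposition \<E> c m D i a l x \<longleftrightarrow>
    (\<exists>p. 1 \<le> m \<and> represents m D i a l p \<and> irred (map p [1..<Suc m]) \<and> bar \<E> (factors p 1 m) = x)"
proof
  assume "is_decomposition \<E> c m D i a l x"
  then obtain p w where mr: "minimal_r_factorisation \<E> m p w" and xw: "bar \<E> w = x"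
    and co: "\<forall>k\<in>{1..m}. D k = D_class (IG \<E>) (bar \<E> (p k)) \<and>
          i k \<in> II (c (D k)) \<and> a k \<in> carrier (GG (c (D k))) \<and> l k \<in> LL (c (D k)) \<and>
          bar \<E> (p k) = triple (c (D k)) (i k, a k, l k)"
    unfolding is_decomposition_def by (elim exE conjE)
  have m: "1 \<le> m" and w: "w = factors p 1 m"
    and reg: "\<forall>k\<in>{1..m}. p k \<in> words \<E> \<and> regular_elem (IG \<E>) (bar \<E> (p k))"
    and min: "\<forall>j k. 1 \<le> j \<and> j < k \<and> k \<le> m \<longrightarrow> \<not> regular_elem (IG \<E>) (bar \<E> (factors p j k))"
    using mr unfolding minimal_r_factorisation_def r_factorisation_def by - (elim conjE, assumption)+
  have x: "bar \<E> (factors p 1 m) = x" using xw unfolding w .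
  have "represents m D i a l p"
    unfolding represents_def
  proof
    fix k assume k: "k \<in> {1..m}"
    have "regular_D_class (IG \<E>) (D k)"
      unfolding regular_D_class_def using reg[rule_format, OF k] co[rule_format, OF k] by blast
    then show "p k \<in> words \<E> \<and> regular_D_class (IG \<E>) (D k) \<and>
        i k \<in> II (c (D k)) \<and> a k \<in> carrier (GG (c (D k))) \<and> l k \<in> LL (c (D k)) \<and>
        bar \<E> (p k) = triple (c (D k)) (i k, a k, l k)"
      using reg[rule_format, OF k] co[rule_format, OF k] by blast
  qed
  moreover have "irred (map p [1..<Suc m])"
    unfolding irred_iff
  proof (intro allI impI)
    fix n assume "Suc n < length (map p [1..<Suc m])"
    then have n: "Suc n < m" by (simp del: upt_Suc)
    have "\<not> regular_elem (IG \<E>) (bar \<E> (factors p (Suc n) (Suc (Suc n))))"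
      using min n by simp
    moreover have "factors p (Suc n) (Suc (Suc n)) = p (Suc n) @ p (Suc (Suc n))"
      by (simp add: factors_def)
    moreover have "p (Suc n) @ p (Suc (Suc n)) \<in> words \<E>" using reg n by (simp add: words_def)
    ultimately show "\<not> seed (map p [1..<Suc m] ! n @ map p [1..<Suc m] ! Suc n)"
      using regular_iff_seed[of "p (Suc n) @ p (Suc (Suc n))"] n by (simp del: upt_Suc)
  qed
  ultimately show "\<exists>p. 1 \<le> m \<and> represents m D i a l p \<and> irred (map p [1..<Suc m]) \<and> bar \<E> (factors p 1 m) = x"
    using m x by blast
next
  assume "\<exists>p. 1 \<le> m \<and> represents m D i a l p \<and> irred (map p [1..<Suc m]) \<and> bar \<E> (factors p 1 m) = x"
  then obtain p where m: "1 \<le> m" and r: "represents m D i a l p" and irr: "irred (map p [1..<Suc m])"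
    and x: "bar \<E> (factors p 1 m) = x" by blast
  have reg: "p k \<in> words \<E> \<and> regular_elem (IG \<E>) (bar \<E> (p k))" if "k \<in> {1..m}" for k
    using represents_D_class(2)[OF r] representsD(1)[OF r] regular_iff_seed that by simp
  have min: "\<not> regular_elem (IG \<E>) (bar \<E> (factors p j k))" if "1 \<le> j \<and> j < k \<and> k \<le> m" for j k
  proof -
    have "factors p j k \<in> words \<E>" using reg that by (intro factors_words) auto
    then show ?thesis using regular_iff_seed irred_factors[OF r irr] that by simp
  qed
  have co: "D k = D_class (IG \<E>) (bar \<E> (p k)) \<and>
          i k \<in> II (c (D k)) \<and> a k \<in> carrier (GG (c (D k))) \<and> l k \<in> LL (c (D k)) \<and>
          bar \<E> (p k) = triple (c (D k)) (i k, a k, l k)" if "k \<in> {1..m}" for k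
    using represents_D_class(1)[OF r, of k] representsD[OF r, of k] that by auto
  have mr: "minimal_r_factorisation \<E> m p (factors p 1 m)"
    unfolding minimal_r_factorisation_def r_factorisation_def using reg min m by blast
  show "is_decomposition \<E> c m D i a l x"
    unfolding is_decomposition_def
    by (intro exI[of _ p] exI[of _ "factors p 1 m"] conjI[OF mr] conjI[OF x] ballI) (rule co)
qed

theorem decomposition_eq_iff:
  assumes "is_decomposition \<E> c m D i a l x" "is_decomposition \<E> c m D i' a' l' x'"
  shows "x = x' \<longleftrightarrow> tuple_walk m D i a l i' a' l'"
proof -
  obtain p where m: "1 \<le> m" and r: "represents m D i a l p" and irr: "irred (map p [1..<Suc m])"
    and x: "bar \<E> (factors p 1 m) = x" using assms(1) is_decomposition_iff by blast
  obtain p' where r': "represents m D i' a' l' p'" and irr': "irred (map p' [1..<Suc m])"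
    and x': "bar \<E> (factors p' 1 m) = x'" using assms(2) is_decomposition_iff by blast
  have fw: "factors p 1 m \<in> words \<E>" "factors p' 1 m \<in> words \<E>"
    using representsD(1)[OF r] representsD(1)[OF r'] m by (auto intro: factors_words)
  have eq: "x = x' \<longleftrightarrow> factors p 1 m \<doteq> factors p' 1 m"
    using bar_eq_cong[OF fw] x x' by simp
  show ?thesis
  proof
    assume "x = x'"
    then have "slide (map p [1..<Suc m]) (map p' [1..<Suc m])"
      using eq irr irr' represents_D_class(2)[OF r] represents_D_class(2)[OF r']
      by (intro irred_unique) (auto simp: factors_def simp del: upt_Suc)
    from slide_represents[OF r m this] obtain i'' a'' l'' where
      r'': "represents m D i'' a'' l'' (\<lambda>k. map p' [1..<Suc m] ! (k - 1))" "tuple_walk m D i a l i'' a'' l''"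
      by blast
    have "map p' [1..<Suc m] ! (k - 1) = p' k" if "1 \<le> k" "k \<le> m" for k
      using that by (simp del: upt_Suc)
    from represents_unique[OF r''(1) r' this] show "tuple_walk m D i a l i' a' l'"
      using tuple_walk_cong[of m i'' i' a'' a' l'' l'] r''(2) m by blast
  next
    assume "tuple_walk m D i a l i' a' l'"
    then show "x = x'" using eq tuple_walk_product[OF r r' _ m] by blast
  qed
qed

lemma decomposition_unique:
  assumes "is_decomposition \<E> c m D i a l x" "is_decomposition \<E> c m D i a l x'"
  shows "x = x'"
proof -
  obtain p where "represents m D i a l p" "1 \<le> m" using assms(1) is_decomposition_iff by blast
  then show ?thesis using decomposition_eq_iff[OF assms] tuple_walk_refl by simp
qed

section \<open>Changing the last or the first factor\<close>

lemma upt_last: "1 \<le> m \<Longrightarrow> [Suc 0..<Suc m] = [Suc 0..<m] @ [m]"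
  by simp

lemma upt_first: "1 \<le> m \<Longrightarrow> [Suc 0..<Suc m] = Suc 0 # [2..<Suc m]"
  by (simp add: upt_conv_Cons numeral_2_eq_2 del: upt_Suc)

lemma irred_snoc_Rw: "irred (q @ [x]) \<Longrightarrow> Rw x y \<Longrightarrow> irred (q @ [y])"
proof (cases q rule: rev_cases)
  case (snoc r z)
  assume "irred (q @ [x])" "Rw x y"
  then show ?thesis using snoc seed_Rw[OF Rw_append[of x y z]] by (simp add: irred_snoc_snoc)
qed simp

lemma irred_Cons_Lw: "irred (x # q) \<Longrightarrow> Lw x y \<Longrightarrow> irred (y # q)"
proof (cases q)
  case (Cons z r)
  assume "irred (x # q)" "Lw x y"
  then show ?thesis using Cons seed_Lw[OF Lw_append[of x y z]] by (simp add: irred_Cons_Cons)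
qed simp

lemma factors_update_last:
  "1 \<le> m \<Longrightarrow> factors (p(m := v)) 1 m = factors p 1 (m - 1) @ v"
  by (cases m) (auto simp: factors_def)

lemma factors_update_first:
  "1 \<le> m \<Longrightarrow> factors (p(1 := v)) 1 m = v @ factors p 2 m"
  by (simp add: factors_def upt_first del: upt_Suc)

text \<open>The new last block is \<R>-related to the old one, and only the \<R>-class of the last
  block matters for merging it with its left neighbour.\<close>

lemma decomposition_update_last:
  assumes r: "represents m D i a l p" and m: "1 \<le> m" and irr: "irred (map p [1..<Suc m])"
    and bk: "b \<in> carrier (GG (c (D m)))" "k \<in> LL (c (D m))"
    and v: "v \<in> words \<E>" "bar \<E> v = triple (c (D m)) (i m, b, k)"
  shows "is_decomposition \<E> c m D i (a(m := b)) (l(m := k)) (bar \<E> (factors p 1 (m - 1) @ v))"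
proof -
  let ?p = "p(m := v)"
  note rm = representsD[OF r m order_refl]
  have R: "Rw (p m) v" using Rw_triple(2)[OF rm(2,1,3-6), of v] v bk by blast
  have "map ?p [1..<Suc m] = map p [1..<m] @ [v]" using m by (simp add: upt_last del: upt_Suc)
  moreover have "irred (map p [1..<m] @ [p m])" using irr m by (simp add: upt_last del: upt_Suc)
  ultimately have "irred (map ?p [1..<Suc m])" using irred_snoc_Rw[OF _ R] by simp
  moreover have "represents m D i (a(m := b)) (l(m := k)) ?p"
    using r bk v unfolding represents_def by simp
  ultimately show ?thesis unfolding is_decomposition_iff
    using m factors_update_last[OF m, of p v] by (intro exI[of _ ?p]) simp
qed

lemma decomposition_update_first:
  assumes r: "represents m D i a l p" and m: "1 \<le> m" and irr: "irred (map p [1..<Suc m])"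
    and jb: "j \<in> II (c (D 1))" "b \<in> carrier (GG (c (D 1)))"
    and v: "v \<in> words \<E>" "bar \<E> v = triple (c (D 1)) (j, b, l 1)"
  shows "is_decomposition \<E> c m D (i(1 := j)) (a(1 := b)) l (bar \<E> (v @ factors p 2 m))"
proof -
  let ?p = "p(1 := v)"
  note r1 = representsD[OF r order_refl m]
  have L: "Lw (p 1) v" using Lw_triple(2)[OF r1(2,1,3-6), of v] v jb by blast
  have "map ?p [1..<Suc m] = v # map p [2..<Suc m]" using m by (simp add: upt_first del: upt_Suc)
  moreover have "irred (p 1 # map p [2..<Suc m])" using irr m by (simp add: upt_first del: upt_Suc)
  ultimately have "irred (map ?p [1..<Suc m])" using irred_Cons_Lw[OF _ L] by simp
  moreover have "represents m D (i(1 := j)) (a(1 := b)) l ?p"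
    using r jb v unfolding represents_def by simp
  ultimately show ?thesis unfolding is_decomposition_iff
    using m factors_update_first[OF m, of p v] by (intro exI[of _ ?p]) simp
qed

lemma decomposition_last_exists:
  assumes "is_decomposition \<E> c m D i a l x" "b \<in> carrier (GG (c (D m)))" "k \<in> LL (c (D m))"
  shows "\<exists>y. is_decomposition \<E> c m D i (a(m := b)) (l(m := k)) y"
proof -
  obtain p where p: "1 \<le> m" "represents m D i a l p" "irred (map p [1..<Suc m])"
    using assms(1) is_decomposition_iff by blast
  note rm = representsD[OF p(2,1) order_refl]
  interpret rees "IG \<E>" "D m" "c (D m)" by (rule rees[OF rm(2)])
  obtain v where "v \<in> words \<E>" "bar \<E> v = T (i m) b k"
    using triple_carrier[OF rm(3) assms(2,3)] by (auto simp: carrier_IG)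
  then show ?thesis using decomposition_update_last[OF p(2,1,3) assms(2,3)] by blast
qed

lemma decomposition_first_exists:
  assumes "is_decomposition \<E> c m D i a l x" "j \<in> II (c (D 1))" "b \<in> carrier (GG (c (D 1)))"
  shows "\<exists>y. is_decomposition \<E> c m D (i(1 := j)) (a(1 := b)) l y"
proof -
  obtain p where p: "1 \<le> m" "represents m D i a l p" "irred (map p [1..<Suc m])"
    using assms(1) is_decomposition_iff by blast
  note r1 = representsD[OF p(2) order_refl p(1)]
  interpret rees "IG \<E>" "D 1" "c (D 1)" by (rule rees[OF r1(2)])
  obtain v where "v \<in> words \<E>" "bar \<E> v = T j b (l 1)"
    using triple_carrier[OF assms(2,3) r1(5)] by (auto simp: carrier_IG)
  then show ?thesis using decomposition_update_first[OF p(2,1,3) assms(2,3)] by blast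
qed

text \<open>If y = xs and yt = x, then xst = x. By \<open>last_block\<close> the last factor
  satisfies p_m s t \<R> p_m, hence p_m s \<R> p_m: the multiplier s is absorbed by the last factor
  alone.\<close>

theorem R_class_decomposition:
  assumes x: "is_decomposition \<E> c m D i a l x"
  shows "y \<in> R_class (IG \<E>) x \<longleftrightarrow> (\<exists>b\<in>carrier (GG (c (D m))). \<exists>k\<in>LL (c (D m)).
    is_decomposition \<E> c m D i (a(m := b)) (l(m := k)) y)"
proof -
  obtain p where m: "1 \<le> m" and r: "represents m D i a l p" and irr: "irred (map p [1..<Suc m])"
    and xp: "bar \<E> (factors p 1 m) = x" using x is_decomposition_iff by blast
  note rm = representsD[OF r m order_refl]
  interpret rees "IG \<E>" "D m" "c (D m)" by (rule rees[OF rm(2)])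
  have pw: "\<forall>k\<in>{1..m}. p k \<in> words \<E>" using representsD(1)[OF r] by simp
  have w: "factors p 1 m \<in> words \<E>" using pw m by (intro factors_words) auto
  have split: "factors p 1 m = factors p 1 (m - 1) @ p m"
    using factors_update_last[OF m, of p "p m"] by simp
  have app: "factors p 1 (m - 1) @ v \<in> words \<E>" if "v \<in> words \<E>" for v
    using w that unfolding split by (auto simp: words_def)
  show ?thesis
  proof
    assume y: "y \<in> R_class (IG \<E>) x"
    then obtain u where u: "u \<in> words \<E>" "y = bar \<E> u" using R_class_cases by blast
    have "Rw (factors p 1 m) u" using y R_class_bar[OF w u(1)] xp u by simp
    then obtain s t where s: "factors p 1 m @ s \<doteq> u" and t: "u @ t \<doteq> factors p 1 m"
      by (auto simp: Rw_def)
    have "factors p 1 m @ s @ t \<doteq> factors p 1 m"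
      using cong_trans[OF cong_append_right[OF s, of t] t] by simp
    then have "Rw (last (map p [1..<Suc m]) @ s @ t) (last (map p [1..<Suc m]))"
      using represents_D_class(2)[OF r] pw m irr
      by (intro last_block) (auto simp: factors_def simp del: upt_Suc)
    then have "Rw (p m @ s @ t) (p m)" using m by simp
    then have R: "Rw (p m) (p m @ s)" using Rw_prefix Rw_sym by blast
    then have v: "p m @ s \<in> words \<E>" using Rw_words rm(1) by blast
    then obtain b k where bk: "b \<in> G" "k \<in> \<Lambda>" "bar \<E> (p m @ s) = T (i m) b k"
      using Rw_triple(2)[OF rm(2,1,3-6), of "p m @ s"] R by blast
    have "bar \<E> (factors p 1 (m - 1) @ p m @ s) = y"
      using bar_eq_cong[OF app[OF v] u(1)] s u split by simp
    then show "\<exists>b\<in>G. \<exists>k\<in>\<Lambda>. is_decomposition \<E> c m D i (a(m := b)) (l(m := k)) y"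
      using decomposition_update_last[OF r m irr bk(1,2) v bk(3)] bk by blast
  next
    assume "\<exists>b\<in>G. \<exists>k\<in>\<Lambda>. is_decomposition \<E> c m D i (a(m := b)) (l(m := k)) y"
    then obtain b k where bk: "b \<in> G" "k \<in> \<Lambda>" "is_decomposition \<E> c m D i (a(m := b)) (l(m := k)) y"
      by blast
    obtain v where v: "v \<in> words \<E>" "bar \<E> v = T (i m) b k"
      using triple_carrier[OF rm(3) bk(1,2)] by (auto simp: carrier_IG)
    have y: "y = bar \<E> (factors p 1 (m - 1) @ v)"
      using decomposition_unique[OF bk(3) decomposition_update_last[OF r m irr bk(1,2) v]] .
    have "Rw (p m) v" using Rw_triple(2)[OF rm(2,1,3-6), of v] v bk by blast
    then have "Rw (factors p 1 m) (factors p 1 (m - 1) @ v)" unfolding split by (rule Rw_append)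
    then show "y \<in> R_class (IG \<E>) x" using R_class_bar[OF w app[OF v(1)]] y xp by simp
  qed
qed

text \<open>The left-right dual, resting on \<open>first_block\<close>.\<close>

theorem L_class_decomposition:
  assumes x: "is_decomposition \<E> c m D i a l x"
  shows "y \<in> L_class (IG \<E>) x \<longleftrightarrow> (\<exists>j\<in>II (c (D 1)). \<exists>b\<in>carrier (GG (c (D 1))).
    is_decomposition \<E> c m D (i(1 := j)) (a(1 := b)) l y)"
proof -
  obtain p where m: "1 \<le> m" and r: "represents m D i a l p" and irr: "irred (map p [1..<Suc m])"
    and xp: "bar \<E> (factors p 1 m) = x" using x is_decomposition_iff by blast
  note r1 = representsD[OF r order_refl m]
  interpret rees "IG \<E>" "D 1" "c (D 1)" by (rule rees[OF r1(2)])
  have pw: "\<forall>k\<in>{1..m}. p k \<in> words \<E>" using representsD(1)[OF r] by simp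
  have w: "factors p 1 m \<in> words \<E>" using pw m by (intro factors_words) auto
  have split: "factors p 1 m = p 1 @ factors p 2 m"
    using factors_update_first[OF m, of p "p 1"] by simp
  have app: "v @ factors p 2 m \<in> words \<E>" if "v \<in> words \<E>" for v
    using w that unfolding split by (auto simp: words_def)
  show ?thesis
  proof
    assume y: "y \<in> L_class (IG \<E>) x"
    then obtain u where u: "u \<in> words \<E>" "y = bar \<E> u" using L_class_cases by blast
    have "Lw (factors p 1 m) u" using y L_class_bar[OF w u(1)] xp u by simp
    then obtain s t where s: "s @ factors p 1 m \<doteq> u" and t: "t @ u \<doteq> factors p 1 m"
      by (auto simp: Lw_def)
    have "(t @ s) @ factors p 1 m \<doteq> factors p 1 m"
      using cong_trans[OF cong_append_left[OF s, of t] t] by simp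
    then have "Lw ((t @ s) @ hd (map p [1..<Suc m])) (hd (map p [1..<Suc m]))"
      using represents_D_class(2)[OF r] pw m irr
      by (intro first_block) (auto simp: factors_def simp del: upt_Suc)
    then have "Lw (t @ s @ p 1) (p 1)" using m by (simp add: upt_first del: upt_Suc)
    then have L: "Lw (p 1) (s @ p 1)" using Lw_suffix Lw_sym by blast
    then have v: "s @ p 1 \<in> words \<E>" using Lw_words r1(1) by blast
    then obtain j b where jb: "j \<in> I" "b \<in> G" "bar \<E> (s @ p 1) = T j b (l 1)"
      using Lw_triple(2)[OF r1(2,1,3-6), of "s @ p 1"] L by blast
    have "bar \<E> ((s @ p 1) @ factors p 2 m) = y"
      using bar_eq_cong[OF app[OF v] u(1)] s u split by simp
    then show "\<exists>j\<in>I. \<exists>b\<in>G. is_decomposition \<E> c m D (i(1 := j)) (a(1 := b)) l y"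
      using decomposition_update_first[OF r m irr jb(1,2) v jb(3)] jb by blast
  next
    assume "\<exists>j\<in>I. \<exists>b\<in>G. is_decomposition \<E> c m D (i(1 := j)) (a(1 := b)) l y"
    then obtain j b where jb: "j \<in> I" "b \<in> G" "is_decomposition \<E> c m D (i(1 := j)) (a(1 := b)) l y"
      by blast
    obtain v where v: "v \<in> words \<E>" "bar \<E> v = T j b (l 1)"
      using triple_carrier[OF jb(1,2) r1(5)] by (auto simp: carrier_IG)
    have y: "y = bar \<E> (v @ factors p 2 m)"
      using decomposition_unique[OF jb(3) decomposition_update_first[OF r m irr jb(1,2) v]] .
    have "Lw (p 1) v" using Lw_triple(2)[OF r1(2,1,3-6), of v] v jb by blast
    then have "Lw (factors p 1 m) (v @ factors p 2 m)" unfolding split by (rule Lw_append)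
    then show "y \<in> L_class (IG \<E>) x" using L_class_bar[OF w app[OF v(1)]] y xp by simp
  qed
qed

end

section \<open>The maps \<open>\<theta>\<close> and closed walks\<close>

text \<open>The equation says that an inner entry a is left unchanged by the walks on both sides of
  it. Solving it for x produces the conjugation in the recursion for \<theta>, solving for y the one
  in the recursion for the dual map.\<close>

lemma (in group) conj_shift:
  assumes "a \<in> carrier G" "x \<in> carrier G" "y \<in> carrier G"
  shows "a = y \<otimes> a \<otimes> x \<longleftrightarrow> x = inv a \<otimes> inv y \<otimes> a"
    and "a = y \<otimes> a \<otimes> x \<longleftrightarrow> y = a \<otimes> inv x \<otimes> inv a"
  using assms inv_solve_left[of x "y \<otimes> a" a] inv_solve_right[of y a "a \<otimes> x"]
  by (auto simp: inv_mult_group m_assoc)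

lemma snd_image_Int: "(\<And>g h. (g, h) \<in> W \<Longrightarrow> h \<in> C) \<Longrightarrow> snd ` (f ` A \<times> C \<inter> W) = {h. \<exists>g\<in>A. (f g, h) \<in> W}"
  and fst_image_Int: "(\<And>g h. (g, h) \<in> W \<Longrightarrow> g \<in> C) \<Longrightarrow> fst ` (C \<times> f ` A \<inter> W) = {g. \<exists>h\<in>A. (g, f h) \<in> W}"
  by force+

locale decomposed = coord_biorder \<E> c
  for \<E> :: "'e partial_alg" and c :: "('e, 'g, 'i, 'l) coord_choice" +
  fixes m D i a l z
  assumes dec: "is_decomposition \<E> c m D i a l z"
begin

(* Keeps the index 1 in GG (c (D 1)) from being rewritten, so that the group rules apply. *)
declare One_nat_def [simp del]

lemma m_pos: "1 \<le> m"
  using dec is_decomposition_iff by blast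

lemma factor_data:
  assumes "1 \<le> k" "k \<le> m"
  shows "regular_D_class (IG \<E>) (D k)" "i k \<in> II (c (D k))"
    "a k \<in> carrier (GG (c (D k)))" "l k \<in> LL (c (D k))" "group (GG (c (D k)))"
proof -
  obtain p where "represents m D i a l p" using dec is_decomposition_iff by blast
  from representsD[OF this assms] show "regular_D_class (IG \<E>) (D k)" "i k \<in> II (c (D k))"
    "a k \<in> carrier (GG (c (D k)))" "l k \<in> LL (c (D k))" "group (GG (c (D k)))"
    by (auto intro: group_GG)
qed

abbreviation W :: "nat \<Rightarrow> ('g \<times> 'g) set" where
  "W k \<equiv> vertex_group \<E> c (D k) (D (Suc k)) (l k, i (Suc k))"

lemma W_subgroup: "1 \<le> k \<Longrightarrow> k < m \<Longrightarrow> subgroup (W k) (contact_group c (D k) (D (Suc k)))"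
  using factor_data[of k] factor_data[of "Suc k"] by (intro subgroup_vertex_group) auto

lemma W_closed:
  assumes "(g, h) \<in> W k" "1 \<le> k" "k < m"
  shows "g \<in> carrier (GG (c (D k)))" "h \<in> carrier (GG (c (D (Suc k))))"
  using subgroup.subset[OF W_subgroup[OF assms(2,3)]] assms(1) by auto

definition chain :: "(nat \<Rightarrow> 'g) \<Rightarrow> (nat \<Rightarrow> 'g) \<Rightarrow> bool" where
  "chain x y \<longleftrightarrow> (\<forall>k\<in>{1..<m}. (x k, y k) \<in> W k) \<and>
     (\<forall>k. 1 < k \<and> k < m \<longrightarrow> a k = y (k - 1) \<otimes>\<^bsub>GG (c (D k))\<^esub> a k \<otimes>\<^bsub>GG (c (D k))\<^esub> x k)"

text \<open>The closed walks that fix all inner entries relate a right translation of the first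
  group entry to a left translation of the last one. For a single factor both act on the same
  entry.\<close>

definition \<Gamma> :: "('g \<times> 'g) set" where
  "\<Gamma> = (if m = 1 then {(p, q). p \<in> carrier (GG (c (D 1))) \<and> q \<in> carrier (GG (c (D 1))) \<and>
            q \<otimes>\<^bsub>GG (c (D 1))\<^esub> a 1 \<otimes>\<^bsub>GG (c (D 1))\<^esub> p = a 1}
        else {(x 1, y (m - 1)) |x y. chain x y})"

lemma \<Gamma>_single: "m = 1 \<Longrightarrow> (p, q) \<in> \<Gamma> \<longleftrightarrow> p \<in> carrier (GG (c (D 1))) \<and>
    q \<in> carrier (GG (c (D 1))) \<and> q \<otimes>\<^bsub>GG (c (D 1))\<^esub> a 1 \<otimes>\<^bsub>GG (c (D 1))\<^esub> p = a 1"
  and \<Gamma>_chain: "m \<noteq> 1 \<Longrightarrow> (p, q) \<in> \<Gamma> \<longleftrightarrow> (\<exists>x y. p = x 1 \<and> q = y (m - 1) \<and> chain x y)"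
  unfolding \<Gamma>_def by auto

lemma chain_eq:
  assumes "chain x y" "1 \<le> j" "Suc j < m"
  shows "y j \<otimes>\<^bsub>GG (c (D (Suc j)))\<^esub> a (Suc j) \<otimes>\<^bsub>GG (c (D (Suc j)))\<^esub> x (Suc j) = a (Suc j)"
proof -
  have "1 < Suc j \<and> Suc j < m" using assms(2,3) by simp
  then have "a (Suc j) = y (Suc j - 1) \<otimes>\<^bsub>GG (c (D (Suc j)))\<^esub> a (Suc j) \<otimes>\<^bsub>GG (c (D (Suc j)))\<^esub> x (Suc j)"
    using assms(1) unfolding chain_def by blast
  then show ?thesis unfolding diff_Suc_1 by (rule HOL.sym)
qed

text \<open>Unrolling the recursion: its elements are the second labels at the end of partial chains
  whose first label lies in A. Each stage adds one closed walk, and the condition on the inner entry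
  between two walks determines the next x from the previous y.\<close>

lemma theta_seq_chain:
  assumes "1 \<le> n" "n < m"
  shows "theta_seq \<E> c D i a l A (Suc n) = {y n |x y. x 1 \<in> A \<and> (\<forall>k\<in>{1..n}. (x k, y k) \<in> W k) \<and>
    (\<forall>k. 1 < k \<and> k \<le> n \<longrightarrow> a k = y (k - 1) \<otimes>\<^bsub>GG (c (D k))\<^esub> a k \<otimes>\<^bsub>GG (c (D k))\<^esub> x k)}"
  using assms
proof (induction n rule: dec_induct)
  case base
  \<comment> \<open>The identity image brings the stage without conjugation into the form of
    \<open>snd_image_Int\<close>.\<close>
  have "theta_seq \<E> c D i a l A (Suc 1) = snd ` ((\<lambda>g. g) ` A \<times> carrier (GG (c (D (Suc 1)))) \<inter> W 1)"
    unfolding One_nat_def theta_seq.simps(3) Let_def by (simp add: One_nat_def)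
  also have "\<dots> = {h. \<exists>g\<in>A. (g, h) \<in> W 1}"
    by (rule snd_image_Int) (use W_closed(2)[of _ _ 1] base in blast)
  also have "\<dots> = {y 1 |x y. x 1 \<in> A \<and> (\<forall>k\<in>{1..1}. (x k, y k) \<in> W k) \<and>
    (\<forall>k. 1 < k \<and> k \<le> 1 \<longrightarrow> a k = y (k - 1) \<otimes>\<^bsub>GG (c (D k))\<^esub> a k \<otimes>\<^bsub>GG (c (D k))\<^esub> x k)}"
  proof (intro equalityI subsetI; elim CollectE bexE exE conjE)
    fix h g assume "g \<in> A" "(g, h) \<in> W 1"
    then show "h \<in> {y 1 |x y. x 1 \<in> A \<and> (\<forall>k\<in>{1..1}. (x k, y k) \<in> W k) \<and>
      (\<forall>k. 1 < k \<and> k \<le> 1 \<longrightarrow> a k = y (k - 1) \<otimes>\<^bsub>GG (c (D k))\<^esub> a k \<otimes>\<^bsub>GG (c (D k))\<^esub> x k)}"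
      by (intro CollectI exI[of _ "\<lambda>_. g"] exI[of _ "\<lambda>_. h"]) auto
  qed auto
  finally show ?case .
next
  case (step n)
  let ?k = "Suc n"
  let ?G = "GG (c (D ?k))"
  have k: "1 \<le> ?k" "?k < m" "?k \<noteq> 1" using step by auto
  interpret group ?G using factor_data[of ?k] k by simp
  have ak: "a ?k \<in> carrier ?G" using factor_data[of ?k] k by simp
  let ?T = "theta_seq \<E> c D i a l A ?k"
  have "theta_seq \<E> c D i a l A (Suc ?k) =
    {h. \<exists>g\<in>?T. (inv\<^bsub>?G\<^esub> (a ?k) \<otimes>\<^bsub>?G\<^esub> inv\<^bsub>?G\<^esub> g \<otimes>\<^bsub>?G\<^esub> a ?k, h) \<in> W ?k}"
    unfolding theta_seq.simps(3) Let_def if_not_P[OF k(3)] Suc_eq_plus1[symmetric]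
    by (rule snd_image_Int) (use W_closed(2)[of _ _ ?k] k in blast)
  also have "\<dots> = {y ?k |x y. x 1 \<in> A \<and> (\<forall>k\<in>{1..?k}. (x k, y k) \<in> W k) \<and>
    (\<forall>k. 1 < k \<and> k \<le> ?k \<longrightarrow> a k = y (k - 1) \<otimes>\<^bsub>GG (c (D k))\<^esub> a k \<otimes>\<^bsub>GG (c (D k))\<^esub> x k)}"
    (is "_ = ?R")
  proof (intro equalityI subsetI; elim CollectE bexE exE conjE)
    fix h g assume g: "g \<in> ?T" and gh: "(inv\<^bsub>?G\<^esub> (a ?k) \<otimes>\<^bsub>?G\<^esub> inv\<^bsub>?G\<^esub> g \<otimes>\<^bsub>?G\<^esub> a ?k, h) \<in> W ?k"
    obtain x y where xy: "g = y n" "x 1 \<in> A" "\<forall>k\<in>{1..n}. (x k, y k) \<in> W k"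
      "\<forall>k. 1 < k \<and> k \<le> n \<longrightarrow> a k = y (k - 1) \<otimes>\<^bsub>GG (c (D k))\<^esub> a k \<otimes>\<^bsub>GG (c (D k))\<^esub> x k"
      using g step.IH k by auto
    have yn: "y n \<in> carrier ?G" using W_closed(2)[of "x n" "y n" n] xy(3) step k by auto
    \<comment> \<open>The partial chain is extended by the walk with label (x' (n + 1), h), whose
      first part is forced by the condition at a_{n+1}.\<close>
    define x' y' where "x' = x(?k := inv\<^bsub>?G\<^esub> (a ?k) \<otimes>\<^bsub>?G\<^esub> inv\<^bsub>?G\<^esub> g \<otimes>\<^bsub>?G\<^esub> a ?k)" and "y' = y(?k := h)"
    have "a ?k = y n \<otimes>\<^bsub>?G\<^esub> a ?k \<otimes>\<^bsub>?G\<^esub> x' ?k"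
      using conj_shift(1)[OF ak _ yn, of "x' ?k"] ak yn by (simp add: x'_def xy(1))
    then have "a k = y' (k - 1) \<otimes>\<^bsub>GG (c (D k))\<^esub> a k \<otimes>\<^bsub>GG (c (D k))\<^esub> x' k" if "1 < k" "k \<le> ?k" for k
      using xy(4) that by (cases "k = ?k") (auto simp: x'_def y'_def)
    moreover have "(x' k, y' k) \<in> W k" if "k \<in> {1..?k}" for k
      using xy(3) gh that by (cases "k = ?k") (auto simp: x'_def y'_def)
    moreover have "h = y' ?k" "x' 1 \<in> A" using xy(2) k by (auto simp: x'_def y'_def)
    ultimately show "h \<in> ?R" by blast
  next
    fix h x y assume h: "h = y ?k" and x1: "x 1 \<in> A" and w: "\<forall>k\<in>{1..?k}. (x k, y k) \<in> W k"
      and e: "\<forall>k. 1 < k \<and> k \<le> ?k \<longrightarrow> a k = y (k - 1) \<otimes>\<^bsub>GG (c (D k))\<^esub> a k \<otimes>\<^bsub>GG (c (D k))\<^esub> x k"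
    have yn: "y n \<in> carrier ?G" using W_closed(2)[of "x n" "y n" n] w step k by auto
    have xk: "x ?k \<in> carrier ?G" using W_closed(1)[of "x ?k" "y ?k" ?k] w k by auto
    have "a ?k = y n \<otimes>\<^bsub>?G\<^esub> a ?k \<otimes>\<^bsub>?G\<^esub> x ?k" using e[rule_format, of ?k] k by simp
    then have "x ?k = inv\<^bsub>?G\<^esub> (a ?k) \<otimes>\<^bsub>?G\<^esub> inv\<^bsub>?G\<^esub> (y n) \<otimes>\<^bsub>?G\<^esub> a ?k"
      using conj_shift(1)[OF ak xk yn] by blast
    then have "(inv\<^bsub>?G\<^esub> (a ?k) \<otimes>\<^bsub>?G\<^esub> inv\<^bsub>?G\<^esub> (y n) \<otimes>\<^bsub>?G\<^esub> a ?k, h) \<in> W ?k"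
      using w[rule_format, of ?k] h by simp
    moreover have "y n \<in> ?T"
      unfolding step.IH[OF Suc_lessD[OF k(2)]] using x1 w e by force
    ultimately show "h \<in> {h. \<exists>g\<in>?T. (inv\<^bsub>?G\<^esub> (a ?k) \<otimes>\<^bsub>?G\<^esub> inv\<^bsub>?G\<^esub> g \<otimes>\<^bsub>?G\<^esub> a ?k, h) \<in> W ?k}"
      by blast
  qed
  finally show ?case .
qed

lemma theta_dual_seq_chain:
  assumes "1 \<le> n" "n < m"
  shows "theta_dual_seq \<E> c m D i a l B (Suc n) =
    {x (m - n) |x y. y (m - 1) \<in> B \<and> (\<forall>k\<in>{m - n..<m}. (x k, y k) \<in> W k) \<and>
      (\<forall>k. m - n < k \<and> k < m \<longrightarrow> a k = y (k - 1) \<otimes>\<^bsub>GG (c (D k))\<^esub> a k \<otimes>\<^bsub>GG (c (D k))\<^esub> x k)}"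
  using assms
proof (induction n rule: dec_induct)
  case base
  obtain r where r: "m = Suc r" "1 \<le> r" using base by (cases m) auto
  have "theta_dual_seq \<E> c m D i a l B (Suc 1) = fst ` (carrier (GG (c (D r))) \<times> (\<lambda>g. g) ` B \<inter> W r)"
    unfolding One_nat_def theta_dual_seq.simps(3) Let_def r(1) by (simp add: One_nat_def)
  also have "\<dots> = {g. \<exists>h\<in>B. (g, h) \<in> W r}"
    by (rule fst_image_Int) (use W_closed(1)[of _ _ r] r in auto)
  also have "\<dots> = {x (m - 1) |x y. y (m - 1) \<in> B \<and> (\<forall>k\<in>{m - 1..<m}. (x k, y k) \<in> W k) \<and>
      (\<forall>k. m - 1 < k \<and> k < m \<longrightarrow> a k = y (k - 1) \<otimes>\<^bsub>GG (c (D k))\<^esub> a k \<otimes>\<^bsub>GG (c (D k))\<^esub> x k)}"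
    (is "_ = ?R")
  proof (intro equalityI subsetI; elim CollectE bexE exE conjE)
    fix g h assume "h \<in> B" "(g, h) \<in> W r"
    then show "g \<in> ?R"
      using r by (intro CollectI exI[of _ "\<lambda>_. g"] exI[of _ "\<lambda>_. h"]) auto
  qed (use r in auto)
  finally show ?case .
next
  case (step n)
  \<comment> \<open>The dual recursion runs leftwards: s is the automaton whose walk is added now,
    and the conjugation takes place at factor s + 1.\<close>
  define s where "s = m - Suc n"
  have s: "1 \<le> s" "s < m" "m - n = Suc s" "Suc s < m" "Suc n \<noteq> 1" "m + 1 - Suc n = Suc s"
    using step by (auto simp: s_def)
  let ?r = "Suc s"
  let ?G = "GG (c (D ?r))"
  interpret group ?G using factor_data[of ?r] s by simp
  have ar: "a ?r \<in> carrier ?G" using factor_data[of ?r] s by simp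
  let ?T = "theta_dual_seq \<E> c m D i a l B (Suc n)"
  have IH: "?T = {x ?r |x y. y (m - 1) \<in> B \<and> (\<forall>k\<in>{?r..<m}. (x k, y k) \<in> W k) \<and>
      (\<forall>k. ?r < k \<and> k < m \<longrightarrow> a k = y (k - 1) \<otimes>\<^bsub>GG (c (D k))\<^esub> a k \<otimes>\<^bsub>GG (c (D k))\<^esub> x k)}"
    using step s(3) by simp
  have "theta_dual_seq \<E> c m D i a l B (Suc (Suc n)) =
    {h. \<exists>g\<in>?T. (h, a ?r \<otimes>\<^bsub>?G\<^esub> inv\<^bsub>?G\<^esub> g \<otimes>\<^bsub>?G\<^esub> inv\<^bsub>?G\<^esub> (a ?r)) \<in> W s}"
    unfolding theta_dual_seq.simps(3) Let_def s(6) s_def[symmetric] if_not_P[OF s(5)]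
    by (rule fst_image_Int) (use W_closed(1)[of _ _ s] s in blast)
  also have "\<dots> = {x s |x y. y (m - 1) \<in> B \<and> (\<forall>k\<in>{s..<m}. (x k, y k) \<in> W k) \<and>
      (\<forall>k. s < k \<and> k < m \<longrightarrow> a k = y (k - 1) \<otimes>\<^bsub>GG (c (D k))\<^esub> a k \<otimes>\<^bsub>GG (c (D k))\<^esub> x k)}"
    (is "_ = ?R")
  proof (intro equalityI subsetI; elim CollectE bexE exE conjE)
    fix h g assume g: "g \<in> ?T" and gh: "(h, a ?r \<otimes>\<^bsub>?G\<^esub> inv\<^bsub>?G\<^esub> g \<otimes>\<^bsub>?G\<^esub> inv\<^bsub>?G\<^esub> (a ?r)) \<in> W s"
    obtain x y where xy: "g = x ?r" "y (m - 1) \<in> B" "\<forall>k\<in>{?r..<m}. (x k, y k) \<in> W k"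
      "\<forall>k. ?r < k \<and> k < m \<longrightarrow> a k = y (k - 1) \<otimes>\<^bsub>GG (c (D k))\<^esub> a k \<otimes>\<^bsub>GG (c (D k))\<^esub> x k"
      using g unfolding IH by blast
    have xr: "x ?r \<in> carrier ?G" using W_closed(1)[of "x ?r" "y ?r" ?r] xy(3) s by auto
    define x' y' where "x' = x(s := h)" and "y' = y(s := a ?r \<otimes>\<^bsub>?G\<^esub> inv\<^bsub>?G\<^esub> g \<otimes>\<^bsub>?G\<^esub> inv\<^bsub>?G\<^esub> (a ?r))"
    have "a ?r = y' s \<otimes>\<^bsub>?G\<^esub> a ?r \<otimes>\<^bsub>?G\<^esub> x ?r"
      using conj_shift(2)[OF ar xr, of "y' s"] ar xr by (simp add: y'_def xy(1))
    then have "a k = y' (k - 1) \<otimes>\<^bsub>GG (c (D k))\<^esub> a k \<otimes>\<^bsub>GG (c (D k))\<^esub> x' k" if "s < k" "k < m" for k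
      using xy(4) that by (cases "k = ?r") (auto simp: x'_def y'_def)
    moreover have "(x' k, y' k) \<in> W k" if "k \<in> {s..<m}" for k
      using xy(3) gh that by (cases "k = s") (auto simp: x'_def y'_def)
    moreover have "h = x' s" "y' (m - 1) \<in> B" using xy(2) s by (auto simp: x'_def y'_def)
    ultimately show "h \<in> ?R" by blast
  next
    fix h x y assume h: "h = x s" and ym: "y (m - 1) \<in> B" and w: "\<forall>k\<in>{s..<m}. (x k, y k) \<in> W k"
      and e: "\<forall>k. s < k \<and> k < m \<longrightarrow> a k = y (k - 1) \<otimes>\<^bsub>GG (c (D k))\<^esub> a k \<otimes>\<^bsub>GG (c (D k))\<^esub> x k"
    have xr: "x ?r \<in> carrier ?G" using W_closed(1)[of "x ?r" "y ?r" ?r] w s by auto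
    have ys: "y s \<in> carrier ?G" using W_closed(2)[of "x s" "y s" s] w s by auto
    have "a ?r = y s \<otimes>\<^bsub>?G\<^esub> a ?r \<otimes>\<^bsub>?G\<^esub> x ?r" using e[rule_format, of ?r] s by simp
    then have "y s = a ?r \<otimes>\<^bsub>?G\<^esub> inv\<^bsub>?G\<^esub> (x ?r) \<otimes>\<^bsub>?G\<^esub> inv\<^bsub>?G\<^esub> (a ?r)"
      using conj_shift(2)[OF ar xr ys] by blast
    then have "(h, a ?r \<otimes>\<^bsub>?G\<^esub> inv\<^bsub>?G\<^esub> (x ?r) \<otimes>\<^bsub>?G\<^esub> inv\<^bsub>?G\<^esub> (a ?r)) \<in> W s"
      using w[rule_format, of s] h s by simp
    moreover have "x ?r \<in> ?T" unfolding IH using ym w e by force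
    ultimately show "h \<in> {h. \<exists>g\<in>?T. (h, a ?r \<otimes>\<^bsub>?G\<^esub> inv\<^bsub>?G\<^esub> g \<otimes>\<^bsub>?G\<^esub> inv\<^bsub>?G\<^esub> (a ?r)) \<in> W s}"
      by blast
  qed
  finally show ?case by (simp only: s_def)
qed

section \<open>\<theta> and its dual in terms of \<Gamma>\<close>

abbreviation G1 where "G1 \<equiv> GG (c (D 1))"
abbreviation Gm where "Gm \<equiv> GG (c (D m))"

sublocale G1: group G1
  using factor_data[OF order_refl m_pos] by simp

sublocale Gm: group Gm
  using factor_data[OF m_pos order_refl] by simp

lemma a1_closed [simp]: "a 1 \<in> carrier G1" and am_closed [simp]: "a m \<in> carrier Gm"
  using factor_data[OF order_refl m_pos] factor_data[OF m_pos order_refl] by auto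

lemma theta_single:
  assumes "m = 1"
  shows "theta \<E> c m D i a l A = A" "theta_dual \<E> c m D i a l B = B"
  unfolding theta_def theta_dual_def assms by (simp_all add: One_nat_def)

lemma theta_chain:
  assumes "m \<noteq> 1"
  shows "theta \<E> c m D i a l A = {q. \<exists>p\<in>A. (p, q) \<in> \<Gamma>}"
proof -
  have n: "1 \<le> m - 1" "m - 1 < m" "Suc (m - 1) = m" "{1..m - 1} = {1..<m}" "\<And>k. k \<le> m - 1 \<longleftrightarrow> k < m"
    using m_pos assms by auto
  show ?thesis
    using theta_seq_chain[OF n(1,2), of A]
    unfolding n(3-5) theta_def \<Gamma>_chain[OF assms] chain_def by blast
qed

lemma theta_dual_chain:
  assumes "m \<noteq> 1"
  shows "theta_dual \<E> c m D i a l B = {p. \<exists>q\<in>B. (p, q) \<in> \<Gamma>}"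
proof -
  have n: "1 \<le> m - 1" "m - 1 < m" "Suc (m - 1) = m" "m - (m - 1) = 1"
    using m_pos assms by auto
  show ?thesis
    using theta_dual_seq_chain[OF n(1,2), of B]
    unfolding n(3,4) theta_dual_def \<Gamma>_chain[OF assms] chain_def by blast
qed

lemma \<Gamma>_closed: "(p, q) \<in> \<Gamma> \<Longrightarrow> p \<in> carrier G1 \<and> q \<in> carrier Gm"
proof (cases "m = 1")
  case True
  assume "(p, q) \<in> \<Gamma>"
  then have "p \<in> carrier G1 \<and> q \<in> carrier G1" unfolding \<Gamma>_single[OF True] by blast
  then show ?thesis unfolding True .
next
  case False
  assume "(p, q) \<in> \<Gamma>"
  then obtain x y where xy: "p = x 1" "q = y (m - 1)" "\<forall>k\<in>{1..<m}. (x k, y k) \<in> W k"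
    using False by (auto simp: \<Gamma>_def chain_def)
  have n: "1 \<in> {1..<m}" "m - 1 \<in> {1..<m}" "Suc (m - 1) = m" using m_pos False by auto
  have "(x 1, y 1) \<in> W 1" "(x (m - 1), y (m - 1)) \<in> W (m - 1)" using xy(3) n by blast+
  then have "x 1 \<in> carrier G1" "y (m - 1) \<in> carrier (GG (c (D (Suc (m - 1)))))"
    using W_closed(1)[of "x 1" "y 1" 1] W_closed(2)[of "x (m - 1)" "y (m - 1)" "m - 1"] n(1,2) by auto
  then show ?thesis unfolding n(3) xy(1,2) by blast
qed

text \<open>For a single factor \<open>theta\<close> is the identity map and not the image under
  \<Gamma>. On the whole group the two agree, since q is matched by a^{-1} q^{-1} a with a the group
  entry.\<close>

lemma theta_full: "theta \<E> c m D i a l (carrier G1) = {q. \<exists>p. (p, q) \<in> \<Gamma>}"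
proof (cases "m = 1")
  case True
  have "\<exists>p. (p, q) \<in> \<Gamma>" if "q \<in> carrier G1" for q
    using that True G1.conj_shift(1)[of "a 1" "inv\<^bsub>G1\<^esub> a 1 \<otimes>\<^bsub>G1\<^esub> inv\<^bsub>G1\<^esub> q \<otimes>\<^bsub>G1\<^esub> a 1" q] a1_closed
    unfolding \<Gamma>_single[OF True]
    by (intro exI[of _ "inv\<^bsub>G1\<^esub> a 1 \<otimes>\<^bsub>G1\<^esub> inv\<^bsub>G1\<^esub> q \<otimes>\<^bsub>G1\<^esub> a 1"]) simp
  then show ?thesis unfolding theta_single(1)[OF True] using \<Gamma>_closed True by blast
next
  case False
  then show ?thesis using theta_chain \<Gamma>_closed by blast
qed

lemma theta_dual_full: "theta_dual \<E> c m D i a l (carrier Gm) = {p. \<exists>q. (p, q) \<in> \<Gamma>}"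
proof (cases "m = 1")
  case True
  have "\<exists>q. (p, q) \<in> \<Gamma>" if "p \<in> carrier G1" for p
    using that True G1.conj_shift(2)[of "a 1" p "a 1 \<otimes>\<^bsub>G1\<^esub> inv\<^bsub>G1\<^esub> p \<otimes>\<^bsub>G1\<^esub> inv\<^bsub>G1\<^esub> a 1"] a1_closed
    unfolding \<Gamma>_single[OF True]
    by (intro exI[of _ "a 1 \<otimes>\<^bsub>G1\<^esub> inv\<^bsub>G1\<^esub> p \<otimes>\<^bsub>G1\<^esub> inv\<^bsub>G1\<^esub> a 1"]) simp
  then show ?thesis unfolding theta_single(2)[OF True] using \<Gamma>_closed True by blast
next
  case False
  then show ?thesis using theta_dual_chain \<Gamma>_closed by blast
qed

text \<open>For a single factor the fibre over the identity consists of the q with q a = a, so it is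
  trivial, as is the value of \<open>theta\<close>.\<close>

lemma theta_one: "theta \<E> c m D i a l {\<one>\<^bsub>G1\<^esub>} = {q. (\<one>\<^bsub>G1\<^esub>, q) \<in> \<Gamma>}"
proof (cases "m = 1")
  case True
  show ?thesis unfolding theta_single(1)[OF True] \<Gamma>_single[OF True] by auto
next
  case False
  then show ?thesis using theta_chain by blast
qed

lemma theta_dual_one: "theta_dual \<E> c m D i a l {\<one>\<^bsub>Gm\<^esub>} = {p. (p, \<one>\<^bsub>Gm\<^esub>) \<in> \<Gamma>}"
proof (cases "m = 1")
  case True
  have "\<one>\<^bsub>Gm\<^esub> = \<one>\<^bsub>G1\<^esub>" unfolding True ..
  then show ?thesis unfolding theta_single(2)[OF True] \<Gamma>_single[OF True] by auto
next
  case False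
  then show ?thesis using theta_dual_chain by blast
qed

section \<open>The group structure of \<Gamma>\<close>

text \<open>The inner conditions nest: y' (y a x) x' = a. This is why the second components multiply
  in reverse order.\<close>

lemma chain_mult:
  assumes "chain x y" "chain x' y'"
  shows "chain (\<lambda>k. x k \<otimes>\<^bsub>GG (c (D k))\<^esub> x' k) (\<lambda>k. y' k \<otimes>\<^bsub>GG (c (D (Suc k)))\<^esub> y k)"
  unfolding chain_def
proof (intro conjI ballI allI impI)
  fix k assume k: "k \<in> {1..<m}"
  have "(x k, y k) \<in> W k" "(x' k, y' k) \<in> W k" using assms k unfolding chain_def by blast+
  then have "(x k, y k) \<otimes>\<^bsub>contact_group c (D k) (D (Suc k))\<^esub> (x' k, y' k) \<in> W k"
    using k by (intro subgroup.m_closed[OF W_subgroup]) auto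
  then show "(x k \<otimes>\<^bsub>GG (c (D k))\<^esub> x' k, y' k \<otimes>\<^bsub>GG (c (D (Suc k)))\<^esub> y k) \<in> W k" by simp
next
  fix k assume k: "1 < k \<and> k < m"
  let ?G = "GG (c (D k))"
  interpret group ?G using factor_data[of k] k by simp
  have ak: "a k \<in> carrier ?G" using factor_data[of k] k by simp
  obtain j where j: "k = Suc j" "1 \<le> j" "j < m" using k by (cases k) auto
  have cl: "x k \<in> carrier ?G" "y j \<in> carrier ?G" "x' k \<in> carrier ?G" "y' j \<in> carrier ?G"
    using W_closed(1)[of "x k" "y k" k] W_closed(1)[of "x' k" "y' k" k]
      W_closed(2)[of "x j" "y j" j] W_closed(2)[of "x' j" "y' j" j] assms k j by (auto simp: chain_def)
  have 1: "y j \<otimes>\<^bsub>?G\<^esub> a k \<otimes>\<^bsub>?G\<^esub> x k = a k" and 2: "y' j \<otimes>\<^bsub>?G\<^esub> a k \<otimes>\<^bsub>?G\<^esub> x' k = a k"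
    unfolding j(1) using assms k j by (auto intro: chain_eq)
  have "(y' j \<otimes>\<^bsub>?G\<^esub> y j) \<otimes>\<^bsub>?G\<^esub> a k \<otimes>\<^bsub>?G\<^esub> (x k \<otimes>\<^bsub>?G\<^esub> x' k) =
      y' j \<otimes>\<^bsub>?G\<^esub> (y j \<otimes>\<^bsub>?G\<^esub> a k \<otimes>\<^bsub>?G\<^esub> x k) \<otimes>\<^bsub>?G\<^esub> x' k"
    using cl ak by (simp add: m_assoc)
  then have "a k = (y' j \<otimes>\<^bsub>?G\<^esub> y j) \<otimes>\<^bsub>?G\<^esub> a k \<otimes>\<^bsub>?G\<^esub> (x k \<otimes>\<^bsub>?G\<^esub> x' k)"
    using 1 2 by simp
  then show "a k = y' (k - 1) \<otimes>\<^bsub>GG (c (D (Suc (k - 1))))\<^esub> y (k - 1) \<otimes>\<^bsub>?G\<^esub> a k \<otimes>\<^bsub>?G\<^esub> (x k \<otimes>\<^bsub>?G\<^esub> x' k)"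
    by (simp add: j(1))
qed

lemma chain_inv:
  assumes "chain x y"
  shows "chain (\<lambda>k. inv\<^bsub>GG (c (D k))\<^esub> x k) (\<lambda>k. inv\<^bsub>GG (c (D (Suc k)))\<^esub> y k)"
  unfolding chain_def
proof (intro conjI ballI allI impI)
  fix k assume k: "k \<in> {1..<m}"
  have xy: "(x k, y k) \<in> W k" using assms k by (simp add: chain_def)
  then have "inv\<^bsub>contact_group c (D k) (D (Suc k))\<^esub> (x k, y k) \<in> W k"
    using k subgroup.m_inv_closed[OF W_subgroup[of k]] by simp
  then show "(inv\<^bsub>GG (c (D k))\<^esub> x k, inv\<^bsub>GG (c (D (Suc k)))\<^esub> y k) \<in> W k"
    using W_closed[OF xy] factor_data[of k] factor_data[of "Suc k"] k by (simp add: inv_contact)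
next
  fix k assume k: "1 < k \<and> k < m"
  let ?G = "GG (c (D k))"
  interpret group ?G using factor_data[of k] k by simp
  have ak: "a k \<in> carrier ?G" using factor_data[of k] k by simp
  obtain j where j: "k = Suc j" "1 \<le> j" "j < m" using k by (cases k) auto
  have cl: "x k \<in> carrier ?G" "y j \<in> carrier ?G"
    using W_closed(1)[of "x k" "y k" k] W_closed(2)[of "x j" "y j" j] assms k j by (auto simp: chain_def)
  have e: "y j \<otimes>\<^bsub>?G\<^esub> a k \<otimes>\<^bsub>?G\<^esub> x k = a k"
    unfolding j(1) using assms k j by (auto intro: chain_eq)
  have "inv\<^bsub>?G\<^esub> y j \<otimes>\<^bsub>?G\<^esub> (y j \<otimes>\<^bsub>?G\<^esub> a k \<otimes>\<^bsub>?G\<^esub> x k) \<otimes>\<^bsub>?G\<^esub> inv\<^bsub>?G\<^esub> x k = a k"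
    using cl ak by (simp add: m_assoc inv_solve_left')
  then have "a k = inv\<^bsub>?G\<^esub> y j \<otimes>\<^bsub>?G\<^esub> a k \<otimes>\<^bsub>?G\<^esub> inv\<^bsub>?G\<^esub> x k" using e by simp
  then show "a k = inv\<^bsub>GG (c (D (Suc (k - 1))))\<^esub> y (k - 1) \<otimes>\<^bsub>?G\<^esub> a k \<otimes>\<^bsub>?G\<^esub> inv\<^bsub>?G\<^esub> x k"
    by (simp add: j(1))
qed

lemma chain_one: "chain (\<lambda>k. \<one>\<^bsub>GG (c (D k))\<^esub>) (\<lambda>k. \<one>\<^bsub>GG (c (D (Suc k)))\<^esub>)"
  unfolding chain_def
proof (intro conjI ballI allI impI)
  fix k assume "k \<in> {1..<m}"
  then show "(\<one>\<^bsub>GG (c (D k))\<^esub>, \<one>\<^bsub>GG (c (D (Suc k)))\<^esub>) \<in> W k"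
    using subgroup.one_closed[OF W_subgroup[of k]] by simp
next
  fix k assume k: "1 < k \<and> k < m"
  then interpret group "GG (c (D k))" using factor_data[of k] by simp
  show "a k = \<one>\<^bsub>GG (c (D (Suc (k - 1))))\<^esub> \<otimes>\<^bsub>GG (c (D k))\<^esub> a k \<otimes>\<^bsub>GG (c (D k))\<^esub> \<one>\<^bsub>GG (c (D k))\<^esub>"
    using factor_data[of k] k by simp
qed

lemma \<Gamma>_one: "(\<one>\<^bsub>G1\<^esub>, \<one>\<^bsub>Gm\<^esub>) \<in> \<Gamma>"
proof (cases "m = 1")
  case True
  then show ?thesis unfolding \<Gamma>_single[OF True] by simp
next
  case False
  then obtain r where "m = Suc r" using m_pos by (cases m) auto
  then show ?thesis unfolding \<Gamma>_chain[OF False] using chain_one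
    by (intro exI[of _ "\<lambda>k. \<one>\<^bsub>GG (c (D k))\<^esub>"] exI[of _ "\<lambda>k. \<one>\<^bsub>GG (c (D (Suc k)))\<^esub>"]) simp
qed

lemma \<Gamma>_mult:
  assumes "(p, q) \<in> \<Gamma>" "(p', q') \<in> \<Gamma>"
  shows "(p \<otimes>\<^bsub>G1\<^esub> p', q' \<otimes>\<^bsub>Gm\<^esub> q) \<in> \<Gamma>"
proof (cases "m = 1")
  case True
  note cl = \<Gamma>_closed[OF assms(1)] \<Gamma>_closed[OF assms(2)]
  have e: "q \<otimes>\<^bsub>G1\<^esub> a 1 \<otimes>\<^bsub>G1\<^esub> p = a 1" "q' \<otimes>\<^bsub>G1\<^esub> a 1 \<otimes>\<^bsub>G1\<^esub> p' = a 1"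
    using assms unfolding \<Gamma>_single[OF True] by auto
  have "(q' \<otimes>\<^bsub>G1\<^esub> q) \<otimes>\<^bsub>G1\<^esub> a 1 \<otimes>\<^bsub>G1\<^esub> (p \<otimes>\<^bsub>G1\<^esub> p') = q' \<otimes>\<^bsub>G1\<^esub> (q \<otimes>\<^bsub>G1\<^esub> a 1 \<otimes>\<^bsub>G1\<^esub> p) \<otimes>\<^bsub>G1\<^esub> p'"
    using cl True a1_closed by (simp add: G1.m_assoc)
  then show ?thesis unfolding \<Gamma>_single[OF True] using e cl True by simp
next
  case False
  then obtain x y x' y' where "p = x 1" "q = y (m - 1)" "chain x y" "p' = x' 1" "q' = y' (m - 1)" "chain x' y'"
    using assms unfolding \<Gamma>_chain[OF False] by auto
  moreover have "Suc (m - 1) = m" using m_pos by simp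
  ultimately show ?thesis unfolding \<Gamma>_chain[OF False] using chain_mult[of x y x' y']
    by (intro exI[of _ "\<lambda>k. x k \<otimes>\<^bsub>GG (c (D k))\<^esub> x' k"] exI[of _ "\<lambda>k. y' k \<otimes>\<^bsub>GG (c (D (Suc k)))\<^esub> y k"]) simp
qed

lemma \<Gamma>_inv:
  assumes "(p, q) \<in> \<Gamma>"
  shows "(inv\<^bsub>G1\<^esub> p, inv\<^bsub>Gm\<^esub> q) \<in> \<Gamma>"
proof (cases "m = 1")
  case True
  note cl = \<Gamma>_closed[OF assms(1)]
  have e: "q \<otimes>\<^bsub>G1\<^esub> a 1 \<otimes>\<^bsub>G1\<^esub> p = a 1"
    using assms unfolding \<Gamma>_single[OF True] by auto
  have "inv\<^bsub>G1\<^esub> q \<otimes>\<^bsub>G1\<^esub> (q \<otimes>\<^bsub>G1\<^esub> a 1 \<otimes>\<^bsub>G1\<^esub> p) \<otimes>\<^bsub>G1\<^esub> inv\<^bsub>G1\<^esub> p = a 1"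
    using cl True a1_closed by (simp add: G1.m_assoc G1.inv_solve_left')
  then show ?thesis unfolding \<Gamma>_single[OF True] using e cl True by simp
next
  case False
  then obtain x y where "p = x 1" "q = y (m - 1)" "chain x y"
    using assms unfolding \<Gamma>_chain[OF False] by auto
  moreover have "Suc (m - 1) = m" using m_pos by simp
  ultimately show ?thesis unfolding \<Gamma>_chain[OF False] using chain_inv[of x y]
    by (intro exI[of _ "\<lambda>k. inv\<^bsub>GG (c (D k))\<^esub> x k"] exI[of _ "\<lambda>k. inv\<^bsub>GG (c (D (Suc k)))\<^esub> y k"]) simp
qed

lemma subgroup_\<Gamma>_snd:
  assumes "subgroup A G1"
  shows "subgroup {q. \<exists>p\<in>A. (p, q) \<in> \<Gamma>} Gm"
proof
  show "{q. \<exists>p\<in>A. (p, q) \<in> \<Gamma>} \<subseteq> carrier Gm" using \<Gamma>_closed by blast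
  show "\<one>\<^bsub>Gm\<^esub> \<in> {q. \<exists>p\<in>A. (p, q) \<in> \<Gamma>}" using \<Gamma>_one subgroup.one_closed[OF assms] by blast
  fix q assume "q \<in> {q. \<exists>p\<in>A. (p, q) \<in> \<Gamma>}"
  then show "inv\<^bsub>Gm\<^esub> q \<in> {q. \<exists>p\<in>A. (p, q) \<in> \<Gamma>}" using \<Gamma>_inv subgroup.m_inv_closed[OF assms] by blast
  fix q' assume "q' \<in> {q. \<exists>p\<in>A. (p, q) \<in> \<Gamma>}"
  with \<open>q \<in> _\<close> show "q \<otimes>\<^bsub>Gm\<^esub> q' \<in> {q. \<exists>p\<in>A. (p, q) \<in> \<Gamma>}"
    using \<Gamma>_mult subgroup.m_closed[OF assms] by blast
qed

lemma subgroup_\<Gamma>_fst: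
  assumes "subgroup B Gm"
  shows "subgroup {p. \<exists>q\<in>B. (p, q) \<in> \<Gamma>} G1"
proof
  show "{p. \<exists>q\<in>B. (p, q) \<in> \<Gamma>} \<subseteq> carrier G1" using \<Gamma>_closed by blast
  show "\<one>\<^bsub>G1\<^esub> \<in> {p. \<exists>q\<in>B. (p, q) \<in> \<Gamma>}" using \<Gamma>_one subgroup.one_closed[OF assms] by blast
  fix p assume "p \<in> {p. \<exists>q\<in>B. (p, q) \<in> \<Gamma>}"
  then show "inv\<^bsub>G1\<^esub> p \<in> {p. \<exists>q\<in>B. (p, q) \<in> \<Gamma>}" using \<Gamma>_inv subgroup.m_inv_closed[OF assms] by blast
  fix p' assume "p' \<in> {p. \<exists>q\<in>B. (p, q) \<in> \<Gamma>}"
  with \<open>p \<in> _\<close> show "p \<otimes>\<^bsub>G1\<^esub> p' \<in> {p. \<exists>q\<in>B. (p, q) \<in> \<Gamma>}"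
    using \<Gamma>_mult subgroup.m_closed[OF assms] by blast
qed

lemma subgroup_theta:
  "subgroup (theta \<E> c m D i a l (carrier G1)) Gm" "subgroup (theta \<E> c m D i a l {\<one>\<^bsub>G1\<^esub>}) Gm"
  "theta \<E> c m D i a l {\<one>\<^bsub>G1\<^esub>} \<subseteq> theta \<E> c m D i a l (carrier G1)"
proof -
  have "theta \<E> c m D i a l (carrier G1) = {q. \<exists>p\<in>carrier G1. (p, q) \<in> \<Gamma>}"
    "theta \<E> c m D i a l {\<one>\<^bsub>G1\<^esub>} = {q. \<exists>p\<in>{\<one>\<^bsub>G1\<^esub>}. (p, q) \<in> \<Gamma>}"
    unfolding theta_full theta_one using \<Gamma>_closed by blast+
  then show "subgroup (theta \<E> c m D i a l (carrier G1)) Gm" "subgroup (theta \<E> c m D i a l {\<one>\<^bsub>G1\<^esub>}) Gm"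
    using subgroup_\<Gamma>_snd[OF G1.subgroup_self] subgroup_\<Gamma>_snd[OF G1.triv_subgroup] by simp_all
  show "theta \<E> c m D i a l {\<one>\<^bsub>G1\<^esub>} \<subseteq> theta \<E> c m D i a l (carrier G1)"
    unfolding theta_full theta_one by blast
qed

lemma subgroup_theta_dual:
  "subgroup (theta_dual \<E> c m D i a l (carrier Gm)) G1" "subgroup (theta_dual \<E> c m D i a l {\<one>\<^bsub>Gm\<^esub>}) G1"
  "theta_dual \<E> c m D i a l {\<one>\<^bsub>Gm\<^esub>} \<subseteq> theta_dual \<E> c m D i a l (carrier Gm)"
proof -
  have "theta_dual \<E> c m D i a l (carrier Gm) = {p. \<exists>q\<in>carrier Gm. (p, q) \<in> \<Gamma>}"
    "theta_dual \<E> c m D i a l {\<one>\<^bsub>Gm\<^esub>} = {p. \<exists>q\<in>{\<one>\<^bsub>Gm\<^esub>}. (p, q) \<in> \<Gamma>}"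
    unfolding theta_dual_full theta_dual_one using \<Gamma>_closed by blast+
  then show "subgroup (theta_dual \<E> c m D i a l (carrier Gm)) G1"
    "subgroup (theta_dual \<E> c m D i a l {\<one>\<^bsub>Gm\<^esub>}) G1"
    using subgroup_\<Gamma>_fst[OF Gm.subgroup_self] subgroup_\<Gamma>_fst[OF Gm.triv_subgroup] by simp_all
  show "theta_dual \<E> c m D i a l {\<one>\<^bsub>Gm\<^esub>} \<subseteq> theta_dual \<E> c m D i a l (carrier Gm)"
    unfolding theta_dual_full theta_dual_one by blast
qed

end

section \<open>Counting\<close>

text \<open>Both images are copies of the quotient of A by the common kernel; the bijection picks a
  preimage under f and applies g.\<close>

lemma image_eqpoll_image:
  assumes "\<And>p q. p \<in> A \<Longrightarrow> q \<in> A \<Longrightarrow> f p = f q \<longleftrightarrow> g p = g q"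
  shows "f ` A \<approx> g ` A"
proof -
  have "bij_betw (\<lambda>y. g (inv_into A f y)) (f ` A) (g ` A)"
    unfolding bij_betw_def
  proof
    show "inj_on (\<lambda>y. g (inv_into A f y)) (f ` A)"
      using assms inv_into_into[of _ f A] by (auto intro!: inj_onI simp: f_inv_into_f) (metis f_inv_into_f inv_into_into imageI)
    have "g (inv_into A f (f p)) = g p" if "p \<in> A" for p
      using assms[of "inv_into A f (f p)" p] that by (simp add: f_inv_into_f inv_into_into)
    then show "(\<lambda>y. g (inv_into A f y)) ` f ` A = g ` A" by (simp add: image_image)
  qed
  then show ?thesis unfolding eqpoll_def by blast
qed

context group
begin

lemma rcos_eq_iff:
  assumes "subgroup K G" "g \<in> carrier G" "h \<in> carrier G"
  shows "K #> g = K #> h \<longleftrightarrow> h \<otimes> inv g \<in> K"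
proof
  assume "K #> g = K #> h"
  then have "h \<in> K #> g" using rcos_self[OF assms(3,1)] by simp
  then obtain k where "k \<in> K" "h = k \<otimes> g" by (auto simp: r_coset_def)
  then show "h \<otimes> inv g \<in> K"
    using assms subgroup.mem_carrier[OF assms(1)] by (simp add: m_assoc)
next
  assume k: "h \<otimes> inv g \<in> K"
  have "h = (h \<otimes> inv g) \<otimes> g" using assms by (simp add: m_assoc)
  then have "h \<in> K #> g" using k unfolding r_coset_def by blast
  then show "K #> g = K #> h" using assms by (intro repr_independence)
qed

lemma eqpoll_Times_index_right:
  assumes K: "subgroup K G" and H: "H \<subseteq> carrier G"
    and eq: "\<And>i j g h. \<lbrakk>i \<in> I; j \<in> I; g \<in> H; h \<in> H\<rbrakk> \<Longrightarrow> f i g = f j h \<longleftrightarrow> j = i \<and> h \<otimes> inv g \<in> K"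
  shows "(\<lambda>(i, g). f i g) ` (I \<times> H) \<approx> I \<times> rcosets\<^bsub>G\<lparr>carrier := H\<rparr>\<^esub> K"
proof -
  have "(\<lambda>(i, g). f i g) ` (I \<times> H) \<approx> (\<lambda>(i, g). (i, K #> g)) ` (I \<times> H)"
  proof (rule image_eqpoll_image; clarify)
    fix i g j h assume *: "i \<in> I" "g \<in> H" "j \<in> I" "h \<in> H"
    then show "f i g = f j h \<longleftrightarrow> (i, K #> g) = (j, K #> h)"
      using eq[OF *(1,3,2,4)] rcos_eq_iff[OF K, of g h] subsetD[OF H] by auto
  qed
  also have "(\<lambda>(i, g). (i, K #> g)) ` (I \<times> H) = I \<times> rcosets\<^bsub>G\<lparr>carrier := H\<rparr>\<^esub> K"
    by (force simp: RCOSETS_def r_coset_def)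
  finally show ?thesis .
qed

text \<open>The fibres are left cosets here, while \<open>index_set\<close> consists of right
  cosets. Inversion of H exchanges the two; it is used for G_1, on which labels act from the
  right.\<close>

lemma eqpoll_Times_index_left:
  assumes K: "subgroup K G" and H: "subgroup H G"
    and eq: "\<And>i j g h. \<lbrakk>i \<in> I; j \<in> I; g \<in> H; h \<in> H\<rbrakk> \<Longrightarrow> f i g = f j h \<longleftrightarrow> j = i \<and> inv g \<otimes> h \<in> K"
  shows "(\<lambda>(i, g). f i g) ` (I \<times> H) \<approx> I \<times> rcosets\<^bsub>G\<lparr>carrier := H\<rparr>\<^esub> K"
proof -
  note Hc = subgroup.mem_carrier[OF H] and Hi = subgroup.m_inv_closed[OF H]
  have "(\<lambda>(i, g). f i g) ` (I \<times> H) = (\<lambda>(i, g). f i (inv g)) ` (I \<times> H)"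
  proof (intro equalityI subsetI; clarify)
    fix i g assume "i \<in> I" "g \<in> H"
    then show "f i g \<in> (\<lambda>(i, g). f i (inv g)) ` (I \<times> H)"
      using Hi Hc by (intro image_eqI[of _ _ "(i, inv g)"]) auto
  next
    fix i g assume "i \<in> I" "g \<in> H"
    then show "f i (inv g) \<in> (\<lambda>(i, g). f i g) ` (I \<times> H)"
      using Hi by (intro image_eqI[of _ _ "(i, inv g)"]) auto
  qed
  also have "\<dots> \<approx> I \<times> rcosets\<^bsub>G\<lparr>carrier := H\<rparr>\<^esub> K"
  proof (rule eqpoll_Times_index_right[OF K subgroup.subset[OF H]])
    fix i j g h assume *: "i \<in> I" "j \<in> I" "g \<in> H" "h \<in> H"
    have "g \<otimes> inv h \<in> K \<longleftrightarrow> h \<otimes> inv g \<in> K"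
      using subgroup.m_inv_closed[OF K, of "g \<otimes> inv h"] subgroup.m_inv_closed[OF K, of "h \<otimes> inv g"] *
      by (auto simp: inv_mult_group Hc)
    then show "f i (inv g) = f j (inv h) \<longleftrightarrow> j = i \<and> h \<otimes> inv g \<in> K"
      using eq[of i j "inv g" "inv h"] * by (simp add: Hi Hc)
  qed
  finally show ?thesis .
qed

lemma finite_index_set: "finite (carrier G) \<Longrightarrow> H \<subseteq> carrier G \<Longrightarrow> finite (rcosets\<^bsub>G\<lparr>carrier := H\<rparr>\<^esub> K)"
  by (auto simp: RCOSETS_def finite_subset)

end

lemma R_class_eq_iff:
  "x \<in> carrier S \<Longrightarrow> y \<in> carrier S \<Longrightarrow> R_class S x = R_class S y \<longleftrightarrow> y \<in> R_class S x"
  and L_class_eq_iff: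
  "x \<in> carrier S \<Longrightarrow> y \<in> carrier S \<Longrightarrow> L_class S x = L_class S y \<longleftrightarrow> y \<in> L_class S x"
  by (auto simp: R_class_def L_class_def)

lemma R_class_subset: "R_class S x \<subseteq> carrier S" and L_class_subset: "L_class S x \<subseteq> carrier S"
  by (auto simp: R_class_def L_class_def)

lemma R_class_disjoint:
  "A \<subseteq> carrier S \<Longrightarrow> pairwise (\<lambda>X Y. disjnt X Y) (R_class S ` A)"
  and L_class_disjoint:
  "A \<subseteq> carrier S \<Longrightarrow> pairwise (\<lambda>X Y. disjnt X Y) (L_class S ` A)"
  by (auto simp: pairwise_def disjnt_def R_class_def L_class_def)

lemma Times_rearrange:
  "(A \<times> B) \<times> C \<times> E \<approx> C \<times> A \<times> E \<times> B" "(A \<times> B) \<times> C \<times> E \<approx> A \<times> C \<times> B \<times> E"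
proof -
  have "bij_betw (\<lambda>((a, b), c, d). (c, a, d, b)) ((A \<times> B) \<times> C \<times> E) (C \<times> A \<times> E \<times> B)"
    by (rule bij_betwI[of _ _ _ "\<lambda>(c, a, d, b). ((a, b), c, d)"]) auto
  then show "(A \<times> B) \<times> C \<times> E \<approx> C \<times> A \<times> E \<times> B" unfolding eqpoll_def by blast
  have "bij_betw (\<lambda>((a, b), c, d). (a, c, b, d)) ((A \<times> B) \<times> C \<times> E) (A \<times> C \<times> B \<times> E)"
    by (rule bij_betwI[of _ _ _ "\<lambda>(a, c, b, d). ((a, b), c, d)"]) auto
  then show "(A \<times> B) \<times> C \<times> E \<approx> A \<times> C \<times> B \<times> E" unfolding eqpoll_def by blast
qed

context biorder
begin

text \<open>\<open>D_class\<close> is defined as a union of \<L>-classes along an \<R>-class.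
  Counting with \<R>-classes needs the composite in the other order.\<close>

lemma D_class_union_R:
  assumes x: "x \<in> carrier (IG \<E>)"
  shows "D_class (IG \<E>) x = (\<Union>z\<in>L_class (IG \<E>) x. R_class (IG \<E>) z)"
proof -
  obtain u where u: "u \<in> words \<E>" "x = bar \<E> u" using x by (auto simp: carrier_IG)
  have iff: "bar \<E> v \<in> D_class (IG \<E>) x \<longleftrightarrow> bar \<E> v \<in> (\<Union>z\<in>L_class (IG \<E>) x. R_class (IG \<E>) z)"
    if v: "v \<in> words \<E>" for v
  proof
    assume "bar \<E> v \<in> D_class (IG \<E>) x"
    then obtain z where "Rw u z" "Lw z v" using D_class_bar[OF u(1) v] u(2) by (auto simp: Dw_def)
    then obtain y where y: "Lw u y" "Rw y v" using Rw_Lw_commute by blast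
    have yw: "y \<in> words \<E>" using Lw_words[OF y(1) u(1)] .
    show "bar \<E> v \<in> (\<Union>z\<in>L_class (IG \<E>) x. R_class (IG \<E>) z)"
      using L_class_bar[OF u(1) yw] R_class_bar[OF yw v] y u(2) by blast
  next
    assume "bar \<E> v \<in> (\<Union>z\<in>L_class (IG \<E>) x. R_class (IG \<E>) z)"
    then obtain z where z: "z \<in> L_class (IG \<E>) x" "bar \<E> v \<in> R_class (IG \<E>) z" by blast
    obtain y where y: "y \<in> words \<E>" "z = bar \<E> y" using L_class_cases[OF z(1)] by blast
    have "Lw u y" "Rw y v" using L_class_bar[OF u(1) y(1)] R_class_bar[OF y(1) v] z y(2) u(2) by simp_all
    then have "Dw u v" unfolding Dw_def using Lw_Rw_commute by blast
    then show "bar \<E> v \<in> D_class (IG \<E>) x" using D_class_bar[OF u(1) v] u(2) by simp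
  qed
  have sub: "D_class (IG \<E>) x \<subseteq> carrier (IG \<E>)" "(\<Union>z\<in>L_class (IG \<E>) x. R_class (IG \<E>) z) \<subseteq> carrier (IG \<E>)"
    by (rule D_class_carrier, intro UN_least R_class_subset)
  show ?thesis
  proof (intro equalityI subsetI)
    fix y assume y: "y \<in> D_class (IG \<E>) x"
    then obtain v where "v \<in> words \<E>" "y = bar \<E> v" using subsetD[OF sub(1)] unfolding carrier_IG by blast
    then show "y \<in> (\<Union>z\<in>L_class (IG \<E>) x. R_class (IG \<E>) z)" using iff y by simp
  next
    fix y assume y: "y \<in> (\<Union>z\<in>L_class (IG \<E>) x. R_class (IG \<E>) z)"
    then obtain v where "v \<in> words \<E>" "y = bar \<E> v" using subsetD[OF sub(2)] unfolding carrier_IG by blast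
    then show "y \<in> D_class (IG \<E>) x" using iff y by simp
  qed
qed

text \<open>Every \<R>-class in the \<D>-class of x meets the \<L>-class of x, so the latter
  supplies representatives.\<close>

lemma R_classes_in_D:
  assumes x: "x \<in> carrier (IG \<E>)"
  shows "R_classes_in (IG \<E>) (D_class (IG \<E>) x) = R_class (IG \<E>) ` L_class (IG \<E>) x"
proof (intro equalityI subsetI)
  fix X assume "X \<in> R_classes_in (IG \<E>) (D_class (IG \<E>) x)"
  then obtain y where y: "y \<in> carrier (IG \<E>)" "X = R_class (IG \<E>) y" "X \<subseteq> D_class (IG \<E>) x"
    by (auto simp: R_classes_in_def)
  have "y \<in> X" using y by (simp add: R_class_def)
  then obtain z where z: "z \<in> L_class (IG \<E>) x" "y \<in> R_class (IG \<E>) z"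
    using y(3) D_class_union_R[OF x] by blast
  have "X = R_class (IG \<E>) z"
    using y(2) R_class_eq_iff[OF subsetD[OF L_class_subset z(1)] y(1)] z(2) by simp
  then show "X \<in> R_class (IG \<E>) ` L_class (IG \<E>) x" using z(1) by blast
next
  fix X assume "X \<in> R_class (IG \<E>) ` L_class (IG \<E>) x"
  then show "X \<in> R_classes_in (IG \<E>) (D_class (IG \<E>) x)"
    using D_class_union_R[OF x] L_class_subset[of "IG \<E>" x] by (auto simp: R_classes_in_def)
qed

lemma L_classes_in_D:
  "L_classes_in (IG \<E>) (D_class (IG \<E>) x) = L_class (IG \<E>) ` R_class (IG \<E>) x"
proof (intro equalityI subsetI)
  fix X assume "X \<in> L_classes_in (IG \<E>) (D_class (IG \<E>) x)"
  then obtain y where y: "y \<in> carrier (IG \<E>)" "X = L_class (IG \<E>) y" "X \<subseteq> D_class (IG \<E>) x"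
    by (auto simp: L_classes_in_def)
  have "y \<in> X" using y by (simp add: L_class_def)
  then obtain z where z: "z \<in> R_class (IG \<E>) x" "y \<in> L_class (IG \<E>) z"
    using y(3) by (auto simp: D_class_def)
  have "X = L_class (IG \<E>) z"
    using y(2) L_class_eq_iff[OF subsetD[OF R_class_subset z(1)] y(1)] z(2) by simp
  then show "X \<in> L_class (IG \<E>) ` R_class (IG \<E>) x" using z(1) by blast
next
  fix X assume "X \<in> L_class (IG \<E>) ` R_class (IG \<E>) x"
  then show "X \<in> L_classes_in (IG \<E>) (D_class (IG \<E>) x)"
    using R_class_subset[of "IG \<E>" x] by (auto simp: L_classes_in_def D_class_def)
qed

end

text \<open>The recursion reads the first indices from factor 2 on and conjugates only from factor 2
  on. Hence \<theta> is the same for all elements of an \<L>-class, whose decompositions may differ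
  in the first triple only.\<close>

lemma theta_seq_cong:
  assumes "\<And>k. k \<noteq> 1 \<Longrightarrow> i' k = i k" "\<And>k. k \<noteq> 1 \<Longrightarrow> a' k = a k"
  shows "theta_seq \<E> c D i' a' l A n = theta_seq \<E> c D i a l A n"
proof (induction n rule: less_induct)
  case (less n)
  consider "n = 0" | "n = Suc 0" | k where "n = Suc (Suc k)" by (metis not0_implies_Suc)
  then show ?case
  proof cases
    case (3 k)
    show ?thesis
    proof (cases "k = 0")
      case True
      then show ?thesis using 3 assms(1)[of "Suc (Suc k)"] by (simp add: Let_def)
    next
      case False
      then show ?thesis
        using 3 assms(1)[of "Suc (Suc k)"] assms(2)[of "Suc k"] less.IH[of "Suc k"] by (simp add: Let_def)
    qed
  qed simp_all
qed

text \<open>Dually, the last triple's group entry and last index are never read, so the dual map is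
  constant along an \<R>-class.\<close>

lemma theta_dual_seq_cong:
  assumes "\<And>k. k \<noteq> m \<Longrightarrow> l' k = l k" "\<And>k. k \<noteq> m \<Longrightarrow> a' k = a k" "1 \<le> m"
  shows "theta_dual_seq \<E> c m D i a' l' B n = theta_dual_seq \<E> c m D i a l B n"
proof (induction n rule: less_induct)
  case (less n)
  consider "n = 0" | "n = Suc 0" | k where "n = Suc (Suc k)" by (metis not0_implies_Suc)
  then show ?case
  proof cases
    case (3 k)
    \<comment> \<open>The subtraction may be truncated to 0, which still differs from m because m is
      positive.\<close>
    have "m - Suc k \<noteq> m" using assms(3) by simp
    then have l: "l' (m - Suc k) = l (m - Suc k)" using assms(1) by blast
    show ?thesis
    proof (cases "k = 0")
      case True
      then show ?thesis using 3 l by (simp add: Let_def)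
    next
      case False
      then have "m + 1 - Suc k \<noteq> m" using assms(3) by simp
      then have "a' (m + 1 - Suc k) = a (m + 1 - Suc k)" using assms(2) by blast
      then show ?thesis using 3 l less.IH[of "Suc k"] by (simp add: Let_def)
    qed
  qed simp_all
qed

context decomposed
begin

lemma tuple_walk_single:
  assumes "m = 1" "b 1 \<in> carrier G1"
  shows "tuple_walk m D j b k j' b' k' \<longleftrightarrow> j' 1 = j 1 \<and> k' 1 = k 1 \<and> b' 1 = b 1"
proof
  assume "tuple_walk m D j b k j' b' k'"
  then obtain x y :: "nat \<Rightarrow> 'g" where "j' 1 = j 1" "k' 1 = k 1" "y 0 = \<one>\<^bsub>G1\<^esub>" "x 1 = \<one>\<^bsub>G1\<^esub>"
    "b' 1 = y 0 \<otimes>\<^bsub>G1\<^esub> b 1 \<otimes>\<^bsub>G1\<^esub> x 1"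
    unfolding tuple_walk_def assms(1) by auto
  then show "j' 1 = j 1 \<and> k' 1 = k 1 \<and> b' 1 = b 1" using assms(2) by simp
next
  assume *: "j' 1 = j 1 \<and> k' 1 = k 1 \<and> b' 1 = b 1"
  show "tuple_walk m D j b k j' b' k'"
    unfolding tuple_walk_def assms(1) using * assms(2)
    by (auto intro!: exI[of _ "\<lambda>_. \<one>\<^bsub>G1\<^esub>"])
qed

text \<open>When two decompositions differ only in the outer data, all linking walks are closed and
  the inner entries are fixed, so the walks form a chain. At the ends the conditions read p' = p x_1
  and b' = y_{m-1} b, which gives the quotients.\<close>

lemma tuple_walk_\<Gamma>:
  assumes m: "m \<noteq> 1" and p: "p \<in> carrier G1" "p' \<in> carrier G1" and b: "b \<in> carrier Gm" "b' \<in> carrier Gm"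
  shows "tuple_walk m D (i(1 := j)) (a(1 := p, m := b)) (l(m := k)) (i(1 := j')) (a(1 := p', m := b')) (l(m := k'))
    \<longleftrightarrow> j' = j \<and> k' = k \<and> (inv\<^bsub>G1\<^esub> p \<otimes>\<^bsub>G1\<^esub> p', b' \<otimes>\<^bsub>Gm\<^esub> inv\<^bsub>Gm\<^esub> b) \<in> \<Gamma>"
    (is "?T \<longleftrightarrow> ?R")
proof -
  have m2: "1 < m" using m m_pos by simp
  let ?walks = "\<lambda>x y. \<forall>q\<in>{1..<m}. walk \<E> c (D q) (D (Suc q)) ((l(m := k)) q, (i(1 := j)) (Suc q)) (x q, y q)
      ((l(m := k')) q, (i(1 := j')) (Suc q))"
  have walks: "?walks x y \<longleftrightarrow> (\<forall>q\<in>{1..<m}. (x q, y q) \<in> W q)" for x y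
  proof -
    \<comment> \<open>The vertices visited are (\<lambda>_q, i_{q+1}) with 1 \<le> q < m, which
      involve neither i_1 nor \<lambda>_m.\<close>
    have "(l(m := h)) q = l q" "(i(1 := h')) (Suc q) = i (Suc q)" if "q \<in> {1..<m}" for q h h'
      using that by (auto simp: One_nat_def)
    then show ?thesis unfolding vertex_group_def by simp
  qed
  let ?eqs = "\<lambda>x y. \<forall>q\<in>{1..m}. (a(1 := p', m := b')) q =
      y (q - 1) \<otimes>\<^bsub>GG (c (D q))\<^esub> (a(1 := p, m := b)) q \<otimes>\<^bsub>GG (c (D q))\<^esub> x q"
  have eqs: "?eqs x y \<longleftrightarrow> p' = y 0 \<otimes>\<^bsub>G1\<^esub> p \<otimes>\<^bsub>G1\<^esub> x 1 \<and> b' = y (m - 1) \<otimes>\<^bsub>Gm\<^esub> b \<otimes>\<^bsub>Gm\<^esub> x m \<and>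
      (\<forall>q. 1 < q \<and> q < m \<longrightarrow> a q = y (q - 1) \<otimes>\<^bsub>GG (c (D q))\<^esub> a q \<otimes>\<^bsub>GG (c (D q))\<^esub> x q)" for x y
  proof -
    have "{1..m} = insert 1 (insert m {1<..<m})" using m2 by auto
    then have split: "(\<forall>q\<in>{1..m}. P q) \<longleftrightarrow> P 1 \<and> P m \<and> (\<forall>q. 1 < q \<and> q < m \<longrightarrow> P q)" for P
      by auto
    have upd: "(a(1 := g, m := h)) 1 = g" "(a(1 := g, m := h)) m = h"
      "1 < q \<and> q < m \<Longrightarrow> (a(1 := g, m := h)) q = a q" for q g h
      using m by auto
    have "(\<forall>q. 1 < q \<and> q < m \<longrightarrow> (a(1 := p', m := b')) q =
        y (q - 1) \<otimes>\<^bsub>GG (c (D q))\<^esub> (a(1 := p, m := b)) q \<otimes>\<^bsub>GG (c (D q))\<^esub> x q) \<longleftrightarrow>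
      (\<forall>q. 1 < q \<and> q < m \<longrightarrow> a q = y (q - 1) \<otimes>\<^bsub>GG (c (D q))\<^esub> a q \<otimes>\<^bsub>GG (c (D q))\<^esub> x q)"
      by (intro all_cong1 imp_cong HOL.refl) (simp only: upd)
    then show ?thesis unfolding split upd(1,2) diff_self_eq_0 by (rule arg_cong)
  qed
  have T: "?T \<longleftrightarrow> j' = j \<and> k' = k \<and> (\<exists>x y. y 0 = \<one>\<^bsub>G1\<^esub> \<and> x m = \<one>\<^bsub>Gm\<^esub> \<and> chain x y \<and>
      p' = y 0 \<otimes>\<^bsub>G1\<^esub> p \<otimes>\<^bsub>G1\<^esub> x 1 \<and> b' = y (m - 1) \<otimes>\<^bsub>Gm\<^esub> b \<otimes>\<^bsub>Gm\<^esub> x m)"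
    unfolding tuple_walk_def walks eqs chain_def fun_upd_same by blast
  show ?thesis
  proof
    assume ?T
    then obtain x y where jk: "j' = j" "k' = k" and xy: "y 0 = \<one>\<^bsub>G1\<^esub>" "x m = \<one>\<^bsub>Gm\<^esub>" "chain x y"
      "p' = y 0 \<otimes>\<^bsub>G1\<^esub> p \<otimes>\<^bsub>G1\<^esub> x 1" "b' = y (m - 1) \<otimes>\<^bsub>Gm\<^esub> b \<otimes>\<^bsub>Gm\<^esub> x m"
      unfolding T by blast
    have G: "(x 1, y (m - 1)) \<in> \<Gamma>" unfolding \<Gamma>_chain[OF m] using xy(3) by blast
    have "inv\<^bsub>G1\<^esub> p \<otimes>\<^bsub>G1\<^esub> p' = x 1" "b' \<otimes>\<^bsub>Gm\<^esub> inv\<^bsub>Gm\<^esub> b = y (m - 1)"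
      using xy p b \<Gamma>_closed[OF G] by (simp_all add: G1.m_assoc[symmetric] Gm.m_assoc)
    then show ?R using G jk by simp
  next
    assume R: ?R
    then obtain x y where xy: "inv\<^bsub>G1\<^esub> p \<otimes>\<^bsub>G1\<^esub> p' = x 1" "b' \<otimes>\<^bsub>Gm\<^esub> inv\<^bsub>Gm\<^esub> b = y (m - 1)" "chain x y"
      unfolding \<Gamma>_chain[OF m] by blast
    \<comment> \<open>A chain puts no condition on the values \<open>x m\<close> and
      \<open>y 0\<close>, so they may be reset to the identities that \<open>tuple_walk\<close>
      demands.\<close>
    have "chain (x(m := \<one>\<^bsub>Gm\<^esub>)) (y(0 := \<one>\<^bsub>G1\<^esub>))"
      using xy(3) unfolding chain_def by simp
    moreover have "p' = \<one>\<^bsub>G1\<^esub> \<otimes>\<^bsub>G1\<^esub> p \<otimes>\<^bsub>G1\<^esub> x 1" "b' = y (m - 1) \<otimes>\<^bsub>Gm\<^esub> b \<otimes>\<^bsub>Gm\<^esub> \<one>\<^bsub>Gm\<^esub>"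
      unfolding xy(1,2)[symmetric] using p b by (simp_all add: G1.m_assoc[symmetric] Gm.m_assoc)
    ultimately show ?T
      unfolding T using R m2
      by (intro conjI exI[of _ "x(m := \<one>\<^bsub>Gm\<^esub>)"] exI[of _ "y(0 := \<one>\<^bsub>G1\<^esub>)"]) auto
  qed
qed

abbreviation last_dec where
  "last_dec b k y \<equiv> is_decomposition \<E> c m D i (a(m := b)) (l(m := k)) y"

abbreviation first_dec where
  "first_dec j p y \<equiv> is_decomposition \<E> c m D (i(1 := j)) (a(1 := p)) l y"

lemma last_dec_eq:
  assumes "last_dec b k y" "last_dec b' k' y'" and b: "b \<in> carrier Gm" "b' \<in> carrier Gm"
  shows "y = y' \<longleftrightarrow> k' = k \<and> b' \<otimes>\<^bsub>Gm\<^esub> inv\<^bsub>Gm\<^esub> b \<in> theta \<E> c m D i a l {\<one>\<^bsub>G1\<^esub>}"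
proof (cases "m = 1")
  case True
  have "b' \<otimes>\<^bsub>Gm\<^esub> inv\<^bsub>Gm\<^esub> b = \<one>\<^bsub>Gm\<^esub> \<longleftrightarrow> b' = b"
    using b Gm.inv_solve_right'[of "\<one>\<^bsub>Gm\<^esub>" b' b] by simp
  then show ?thesis
    unfolding decomposition_eq_iff[OF assms(1,2)] theta_single(1)[OF True]
    using tuple_walk_single[OF True, of "a(m := b)"] b True by simp
next
  case False
  have "a(1 := a 1, m := h) = a(m := h)" for h by simp
  then show ?thesis
    unfolding decomposition_eq_iff[OF assms(1,2)] theta_one
    using tuple_walk_\<Gamma>[OF False a1_closed a1_closed b, of "i 1" k "i 1" k'] by simp
qed

lemma first_dec_eq:
  assumes "first_dec j p y" "first_dec j' p' y'" and p: "p \<in> carrier G1" "p' \<in> carrier G1"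
  shows "y = y' \<longleftrightarrow> j' = j \<and> inv\<^bsub>G1\<^esub> p \<otimes>\<^bsub>G1\<^esub> p' \<in> theta_dual \<E> c m D i a l {\<one>\<^bsub>Gm\<^esub>}"
proof (cases "m = 1")
  case True
  have "inv\<^bsub>G1\<^esub> p \<otimes>\<^bsub>G1\<^esub> p' = \<one>\<^bsub>G1\<^esub> \<longleftrightarrow> p' = p"
    using p G1.inv_solve_left'[of "\<one>\<^bsub>G1\<^esub>" p p'] by simp
  then show ?thesis
    unfolding decomposition_eq_iff[OF assms(1,2)] theta_single(2)[OF True]
    using tuple_walk_single[OF True, of "a(1 := p)"] p True by simp
next
  case False
  have u: "a(1 := h, m := a m) = a(1 := h)" for h using False by (auto simp: fun_eq_iff)
  show ?thesis
    unfolding decomposition_eq_iff[OF assms(1,2)] theta_dual_one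
    using tuple_walk_\<Gamma>[OF False p am_closed am_closed, of j "l m" j' "l m"] by (simp add: u)
qed

text \<open>An element \<R>-related to y arises by changing the last triple of y. With the last
  group entry left free, membership in \<Gamma> weakens to membership in its first
  projection.\<close>

lemma first_dec_R_class:
  assumes "first_dec j p y" "first_dec j' p' y'" and p: "p \<in> carrier G1" "p' \<in> carrier G1"
  shows "y' \<in> R_class (IG \<E>) y \<longleftrightarrow> j' = j \<and> inv\<^bsub>G1\<^esub> p \<otimes>\<^bsub>G1\<^esub> p' \<in> theta_dual \<E> c m D i a l (carrier Gm)"
proof -
  let ?dec = "\<lambda>b k. is_decomposition \<E> c m D (i(1 := j)) (a(1 := p, m := b)) (l(m := k))"
  have R: "y' \<in> R_class (IG \<E>) y \<longleftrightarrow> (\<exists>b\<in>carrier Gm. \<exists>k\<in>LL (c (D m)). ?dec b k y')"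
    by (rule R_class_decomposition[OF assms(1)])
  have lm: "l m \<in> LL (c (D m))" using factor_data[OF m_pos order_refl] by simp
  show ?thesis
  proof (cases "m = 1")
    case True
    have "(\<exists>b\<in>carrier Gm. \<exists>k\<in>LL (c (D m)). ?dec b k y') \<longleftrightarrow> j' = j"
    proof
      assume "\<exists>b\<in>carrier Gm. \<exists>k\<in>LL (c (D m)). ?dec b k y'"
      then obtain b k where b: "b \<in> carrier Gm" "?dec b k y'" by blast
      show "j' = j"
        using decomposition_eq_iff[OF b(2) assms(2)]
          tuple_walk_single[OF True, of "a(1 := p, m := b)"] b(1) True by simp
    next
      assume "j' = j"
      then have "?dec p' (l m) y'" using assms(2) True by simp
      then show "\<exists>b\<in>carrier Gm. \<exists>k\<in>LL (c (D m)). ?dec b k y'" using p(2) lm True by blast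
    qed
    then show ?thesis unfolding R theta_single(2)[OF True] using p True by simp
  next
    case False
    have u: "a(1 := h, m := a m) = a(1 := h)" for h using False by (auto simp: fun_eq_iff)
    have eq: "y'' = y' \<longleftrightarrow> j' = j \<and> l m = k \<and> (inv\<^bsub>G1\<^esub> p \<otimes>\<^bsub>G1\<^esub> p', a m \<otimes>\<^bsub>Gm\<^esub> inv\<^bsub>Gm\<^esub> b) \<in> \<Gamma>"
      if "b \<in> carrier Gm" "?dec b k y''" for b k y''
      using decomposition_eq_iff[OF that(2) assms(2)]
        tuple_walk_\<Gamma>[OF False p that(1) am_closed, of j k j' "l m"] by (simp add: u)
    show ?thesis
      unfolding R theta_dual_full
    proof (intro iffI; elim bexE conjE CollectE exE)
      fix b k assume "b \<in> carrier Gm" "?dec b k y'"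
      then show "j' = j \<and> inv\<^bsub>G1\<^esub> p \<otimes>\<^bsub>G1\<^esub> p' \<in> {p. \<exists>q. (p, q) \<in> \<Gamma>}" using eq by blast
    next
      fix q assume j: "j' = j" and q: "(inv\<^bsub>G1\<^esub> p \<otimes>\<^bsub>G1\<^esub> p', q) \<in> \<Gamma>"
      \<comment> \<open>The last entry is chosen so that its quotient with a_m is the prescribed
        q.\<close>
      let ?b = "inv\<^bsub>Gm\<^esub> q \<otimes>\<^bsub>Gm\<^esub> a m"
      have qc: "q \<in> carrier Gm" using \<Gamma>_closed[OF q] by simp
      have b: "?b \<in> carrier Gm" "a m \<otimes>\<^bsub>Gm\<^esub> inv\<^bsub>Gm\<^esub> ?b = q"
        using qc by (simp_all add: Gm.inv_mult_group flip: Gm.m_assoc)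
      obtain y'' where y'': "?dec ?b (l m) y''" using decomposition_last_exists[OF assms(1) b(1) lm] by blast
      then have "y'' = y'" using eq[OF b(1) y''] j q b(2) by simp
      then show "\<exists>b\<in>carrier Gm. \<exists>k\<in>LL (c (D m)). ?dec b k y'" using y'' b(1) lm by blast
    qed
  qed
qed

lemma last_dec_L_class:
  assumes "last_dec b k y" "last_dec b' k' y'" and b: "b \<in> carrier Gm" "b' \<in> carrier Gm"
  shows "y' \<in> L_class (IG \<E>) y \<longleftrightarrow> k' = k \<and> b' \<otimes>\<^bsub>Gm\<^esub> inv\<^bsub>Gm\<^esub> b \<in> theta \<E> c m D i a l (carrier G1)"
proof -
  let ?dec = "\<lambda>j p. is_decomposition \<E> c m D (i(1 := j)) (a(m := b, 1 := p)) (l(m := k))"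
  have L: "y' \<in> L_class (IG \<E>) y \<longleftrightarrow> (\<exists>j\<in>II (c (D 1)). \<exists>p\<in>carrier G1. ?dec j p y')"
    by (rule L_class_decomposition[OF assms(1)])
  have i1: "i 1 \<in> II (c (D 1))" using factor_data[OF order_refl m_pos] by simp
  show ?thesis
  proof (cases "m = 1")
    case True
    have "(\<exists>j\<in>II (c (D 1)). \<exists>p\<in>carrier G1. ?dec j p y') \<longleftrightarrow> k' = k"
    proof
      assume "\<exists>j\<in>II (c (D 1)). \<exists>p\<in>carrier G1. ?dec j p y'"
      then obtain j p where p: "p \<in> carrier G1" "?dec j p y'" by blast
      show "k' = k"
        using decomposition_eq_iff[OF p(2) assms(2)]
          tuple_walk_single[OF True, of "a(m := b, 1 := p)"] p(1) True by simp
    next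
      assume "k' = k"
      then have "?dec (i 1) b' y'" using assms(2) True by simp
      then show "\<exists>j\<in>II (c (D 1)). \<exists>p\<in>carrier G1. ?dec j p y'" using b(2) i1 True by blast
    qed
    then show ?thesis unfolding L theta_single(1)[OF True] using b True by simp
  next
    case False
    have u: "a(m := h, 1 := p) = a(1 := p, m := h)" "a(1 := a 1, m := h) = a(m := h)" for h p
      using False by (auto simp: fun_eq_iff)
    have eq: "y'' = y' \<longleftrightarrow> i 1 = j \<and> k' = k \<and> (inv\<^bsub>G1\<^esub> p \<otimes>\<^bsub>G1\<^esub> a 1, b' \<otimes>\<^bsub>Gm\<^esub> inv\<^bsub>Gm\<^esub> b) \<in> \<Gamma>"
      if "p \<in> carrier G1" "?dec j p y''" for j p y''
      using decomposition_eq_iff[OF that(2) assms(2)]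
        tuple_walk_\<Gamma>[OF False that(1) a1_closed b, of j k "i 1" k'] by (simp add: u)
    show ?thesis
      unfolding L theta_full
    proof (intro iffI; elim bexE conjE CollectE exE)
      fix j p assume "p \<in> carrier G1" "?dec j p y'"
      then show "k' = k \<and> b' \<otimes>\<^bsub>Gm\<^esub> inv\<^bsub>Gm\<^esub> b \<in> {q. \<exists>p. (p, q) \<in> \<Gamma>}" using eq by blast
    next
      fix q assume k: "k' = k" and q: "(q, b' \<otimes>\<^bsub>Gm\<^esub> inv\<^bsub>Gm\<^esub> b) \<in> \<Gamma>"
      \<comment> \<open>The first entry whose quotient with a_1 is q.\<close>
      let ?p = "a 1 \<otimes>\<^bsub>G1\<^esub> inv\<^bsub>G1\<^esub> q"
      have qc: "q \<in> carrier G1" using \<Gamma>_closed[OF q] by simp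
      have p: "?p \<in> carrier G1" "inv\<^bsub>G1\<^esub> ?p \<otimes>\<^bsub>G1\<^esub> a 1 = q"
        using qc by (simp_all add: G1.inv_mult_group G1.m_assoc)
      obtain y'' where y'': "?dec (i 1) ?p y''" using decomposition_first_exists[OF assms(1) i1 p(1)] by blast
      then have "y'' = y'" using eq[OF p(1) y''] k q p(2) by simp
      then show "\<exists>j\<in>II (c (D 1)). \<exists>p\<in>carrier G1. ?dec j p y'" using y'' p(1) i1 by blast
    qed
  qed
qed

section \<open>The cardinalities\<close>

definition last_elem where "last_elem k b = (SOME y. last_dec b k y)"
definition first_elem where "first_elem j p = (SOME y. first_dec j p y)"

lemma last_elem: "k \<in> LL (c (D m)) \<Longrightarrow> b \<in> carrier Gm \<Longrightarrow> last_dec b k (last_elem k b)"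
  unfolding last_elem_def using decomposition_last_exists[OF dec] by (blast intro: someI_ex)

lemma first_elem: "j \<in> II (c (D 1)) \<Longrightarrow> p \<in> carrier G1 \<Longrightarrow> first_dec j p (first_elem j p)"
  unfolding first_elem_def using decomposition_first_exists[OF dec] by (blast intro: someI_ex)

lemma R_class_image: "R_class (IG \<E>) z = (\<lambda>(k, b). last_elem k b) ` (LL (c (D m)) \<times> carrier Gm)"
proof (intro equalityI subsetI)
  fix y assume "y \<in> R_class (IG \<E>) z"
  then obtain b k where bk: "b \<in> carrier Gm" "k \<in> LL (c (D m))" "last_dec b k y"
    using R_class_decomposition[OF dec] by blast
  then have "y = last_elem k b" using decomposition_unique[OF bk(3) last_elem] by blast
  then show "y \<in> (\<lambda>(k, b). last_elem k b) ` (LL (c (D m)) \<times> carrier Gm)" using bk by blast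
next
  fix y assume "y \<in> (\<lambda>(k, b). last_elem k b) ` (LL (c (D m)) \<times> carrier Gm)"
  then obtain k b where kb: "k \<in> LL (c (D m))" "b \<in> carrier Gm" "y = last_elem k b" by auto
  then show "y \<in> R_class (IG \<E>) z" unfolding R_class_decomposition[OF dec] using last_elem[OF kb(1,2)] by blast
qed

lemma L_class_image: "L_class (IG \<E>) z = (\<lambda>(j, p). first_elem j p) ` (II (c (D 1)) \<times> carrier G1)"
proof (intro equalityI subsetI)
  fix y assume "y \<in> L_class (IG \<E>) z"
  then obtain j p where jp: "j \<in> II (c (D 1))" "p \<in> carrier G1" "first_dec j p y"
    using L_class_decomposition[OF dec] by blast
  then have "y = first_elem j p" using decomposition_unique[OF jp(3) first_elem] by blast
  then show "y \<in> (\<lambda>(j, p). first_elem j p) ` (II (c (D 1)) \<times> carrier G1)" using jp by blast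
next
  fix y assume "y \<in> (\<lambda>(j, p). first_elem j p) ` (II (c (D 1)) \<times> carrier G1)"
  then obtain j p where jp: "j \<in> II (c (D 1))" "p \<in> carrier G1" "y = first_elem j p" by auto
  then show "y \<in> L_class (IG \<E>) z" unfolding L_class_decomposition[OF dec] using first_elem[OF jp(1,2)] by blast
qed

lemma R_class_size:
  "R_class (IG \<E>) z \<approx> LL (c (D m)) \<times> index_set Gm (carrier Gm) (theta \<E> c m D i a l {\<one>\<^bsub>G1\<^esub>})"
  unfolding R_class_image
  by (rule Gm.eqpoll_Times_index_right[OF subgroup_theta(2) order_refl])
    (rule last_dec_eq; (assumption | rule last_elem))

lemma L_class_size:
  "L_class (IG \<E>) z \<approx> II (c (D 1)) \<times> index_set G1 (carrier G1) (theta_dual \<E> c m D i a l {\<one>\<^bsub>Gm\<^esub>})"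
  unfolding L_class_image
  by (rule G1.eqpoll_Times_index_left[OF subgroup_theta_dual(2) G1.subgroup_self])
    (rule first_dec_eq; (assumption | rule first_elem))

lemma z_carrier: "z \<in> carrier (IG \<E>)"
proof -
  obtain p where p: "represents m D i a l p" "bar \<E> (factors p 1 m) = z"
    using dec is_decomposition_iff by blast
  have "factors p 1 m \<in> words \<E>" using representsD(1)[OF p(1)] m_pos by (auto intro: factors_words)
  then show ?thesis using p(2) by (auto simp: carrier_IG)
qed

lemma first_elem_carrier:
  assumes "j \<in> II (c (D 1))" "p \<in> carrier G1"
  shows "first_elem j p \<in> carrier (IG \<E>)"
proof -
  have "first_elem j p \<in> L_class (IG \<E>) z" using L_class_image assms by blast
  then show ?thesis by (rule subsetD[OF L_class_subset])
qed

lemma last_elem_carrier: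
  assumes "k \<in> LL (c (D m))" "b \<in> carrier Gm"
  shows "last_elem k b \<in> carrier (IG \<E>)"
proof -
  have "last_elem k b \<in> R_class (IG \<E>) z" using R_class_image assms by blast
  then show ?thesis by (rule subsetD[OF R_class_subset])
qed

lemma R_classes_size:
  "R_classes_in (IG \<E>) (D_class (IG \<E>) z) \<approx>
    II (c (D 1)) \<times> index_set G1 (carrier G1) (theta_dual \<E> c m D i a l (carrier Gm))"
proof -
  have "R_classes_in (IG \<E>) (D_class (IG \<E>) z) =
      (\<lambda>(j, p). R_class (IG \<E>) (first_elem j p)) ` (II (c (D 1)) \<times> carrier G1)"
    unfolding R_classes_in_D[OF z_carrier] L_class_image by (simp add: image_image split_def)
  also have "\<dots> \<approx> II (c (D 1)) \<times> index_set G1 (carrier G1) (theta_dual \<E> c m D i a l (carrier Gm))"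
  proof (rule G1.eqpoll_Times_index_left[OF subgroup_theta_dual(1) G1.subgroup_self])
    fix j j' p p' assume *: "j \<in> II (c (D 1))" "j' \<in> II (c (D 1))" "p \<in> carrier G1" "p' \<in> carrier G1"
    show "R_class (IG \<E>) (first_elem j p) = R_class (IG \<E>) (first_elem j' p') \<longleftrightarrow>
      j' = j \<and> inv\<^bsub>G1\<^esub> p \<otimes>\<^bsub>G1\<^esub> p' \<in> theta_dual \<E> c m D i a l (carrier Gm)"
      using R_class_eq_iff[OF first_elem_carrier first_elem_carrier]
        first_dec_R_class[OF first_elem first_elem] * by simp
  qed
  finally show ?thesis .
qed

lemma L_classes_size:
  "L_classes_in (IG \<E>) (D_class (IG \<E>) z) \<approx>
    LL (c (D m)) \<times> index_set Gm (carrier Gm) (theta \<E> c m D i a l (carrier G1))"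
proof -
  have "L_classes_in (IG \<E>) (D_class (IG \<E>) z) =
      (\<lambda>(k, b). L_class (IG \<E>) (last_elem k b)) ` (LL (c (D m)) \<times> carrier Gm)"
    unfolding L_classes_in_D R_class_image by (simp add: image_image split_def)
  also have "\<dots> \<approx> LL (c (D m)) \<times> index_set Gm (carrier Gm) (theta \<E> c m D i a l (carrier G1))"
  proof (rule Gm.eqpoll_Times_index_right[OF subgroup_theta(1) order_refl])
    fix k k' b b' assume *: "k \<in> LL (c (D m))" "k' \<in> LL (c (D m))" "b \<in> carrier Gm" "b' \<in> carrier Gm"
    show "L_class (IG \<E>) (last_elem k b) = L_class (IG \<E>) (last_elem k' b') \<longleftrightarrow>
      k' = k \<and> b' \<otimes>\<^bsub>Gm\<^esub> inv\<^bsub>Gm\<^esub> b \<in> theta \<E> c m D i a l (carrier G1)"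
      using L_class_eq_iff[OF last_elem_carrier last_elem_carrier]
        last_dec_L_class[OF last_elem last_elem] * by simp
  qed
  finally show ?thesis .
qed

text \<open>Inside the \<R>-class, the \<L>-related elements keep the last index and have last entry
  b with b a_m^{-1} in \<theta>(G_1). Writing b = u a_m parametrises them by that subgroup, and two
  parameters give the same element when they lie in the same coset of \<theta>(1).\<close>

lemma H_class_size:
  "H_class (IG \<E>) z \<approx> index_set Gm (theta \<E> c m D i a l (carrier G1)) (theta \<E> c m D i a l {\<one>\<^bsub>G1\<^esub>})"
proof -
  let ?U = "theta \<E> c m D i a l (carrier G1)"
  have lm: "l m \<in> LL (c (D m))" using factor_data[OF m_pos order_refl] by simp
  note Uc = subgroup.mem_carrier[OF subgroup_theta(1)]
  have mem: "last_elem k b \<in> L_class (IG \<E>) z \<longleftrightarrow> k = l m \<and> b \<otimes>\<^bsub>Gm\<^esub> inv\<^bsub>Gm\<^esub> a m \<in> ?U"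
    if "k \<in> LL (c (D m))" "b \<in> carrier Gm" for k b
    using last_dec_L_class[OF _ last_elem[OF that], of "a m" "l m" z] dec that by simp
  \<comment> \<open>The dummy factor \<open>{()}\<close> stands for the fixed last index and lets
    the product lemma apply.\<close>
  have H: "H_class (IG \<E>) z = (\<lambda>(_, u). last_elem (l m) (u \<otimes>\<^bsub>Gm\<^esub> a m)) ` ({()} \<times> ?U)"
  proof (intro equalityI subsetI)
    fix y assume "y \<in> H_class (IG \<E>) z"
    then obtain k b where y: "k \<in> LL (c (D m))" "b \<in> carrier Gm" "y = last_elem k b" "y \<in> L_class (IG \<E>) z"
      using R_class_image by (auto simp: H_class_def)
    then have kb: "k = l m" "b \<otimes>\<^bsub>Gm\<^esub> inv\<^bsub>Gm\<^esub> a m \<in> ?U" using mem by auto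
    have "b = (b \<otimes>\<^bsub>Gm\<^esub> inv\<^bsub>Gm\<^esub> a m) \<otimes>\<^bsub>Gm\<^esub> a m" using y(2) by (simp add: Gm.m_assoc)
    then show "y \<in> (\<lambda>(_, u). last_elem (l m) (u \<otimes>\<^bsub>Gm\<^esub> a m)) ` ({()} \<times> ?U)"
      using y(3) kb by (intro image_eqI[of _ _ "((), b \<otimes>\<^bsub>Gm\<^esub> inv\<^bsub>Gm\<^esub> a m)"]) auto
  next
    fix y assume "y \<in> (\<lambda>(_, u). last_elem (l m) (u \<otimes>\<^bsub>Gm\<^esub> a m)) ` ({()} \<times> ?U)"
    then obtain u where u: "u \<in> ?U" "y = last_elem (l m) (u \<otimes>\<^bsub>Gm\<^esub> a m)" by auto
    have "y \<in> L_class (IG \<E>) z" using mem[OF lm] u Uc[OF u(1)] by (simp add: Gm.m_assoc)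
    moreover have "y \<in> R_class (IG \<E>) z" using R_class_image u Uc[OF u(1)] lm by auto
    ultimately show "y \<in> H_class (IG \<E>) z" by (simp add: H_class_def)
  qed
  have "H_class (IG \<E>) z \<approx> {()} \<times> index_set Gm ?U (theta \<E> c m D i a l {\<one>\<^bsub>G1\<^esub>})"
    unfolding H
  proof (rule Gm.eqpoll_Times_index_right[OF subgroup_theta(2) subgroup.subset[OF subgroup_theta(1)]])
    fix j j' :: unit and u u' assume u: "u \<in> ?U" "u' \<in> ?U"
    have "a m \<otimes>\<^bsub>Gm\<^esub> (inv\<^bsub>Gm\<^esub> a m \<otimes>\<^bsub>Gm\<^esub> inv\<^bsub>Gm\<^esub> u) = inv\<^bsub>Gm\<^esub> u"
      using Uc u by (simp flip: Gm.m_assoc)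
    then have "u' \<otimes>\<^bsub>Gm\<^esub> a m \<otimes>\<^bsub>Gm\<^esub> inv\<^bsub>Gm\<^esub> (u \<otimes>\<^bsub>Gm\<^esub> a m) = u' \<otimes>\<^bsub>Gm\<^esub> inv\<^bsub>Gm\<^esub> u"
      using Uc u by (simp add: Gm.inv_mult_group Gm.m_assoc)
    then show "last_elem (l m) (u \<otimes>\<^bsub>Gm\<^esub> a m) = last_elem (l m) (u' \<otimes>\<^bsub>Gm\<^esub> a m) \<longleftrightarrow>
      j' = j \<and> u' \<otimes>\<^bsub>Gm\<^esub> inv\<^bsub>Gm\<^esub> u \<in> theta \<E> c m D i a l {\<one>\<^bsub>G1\<^esub>}"
      using last_dec_eq[OF last_elem[OF lm] last_elem[OF lm]] Uc u by simp
  qed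
  then show ?thesis by (rule eqpoll_trans[OF _ times_singleton_eqpoll])
qed

text \<open>The same count from the \<L>-class, with first entries a_1 v and left cosets in
  G_1.\<close>

lemma H_class_size_dual:
  "H_class (IG \<E>) z \<approx>
    index_set G1 (theta_dual \<E> c m D i a l (carrier Gm)) (theta_dual \<E> c m D i a l {\<one>\<^bsub>Gm\<^esub>})"
proof -
  let ?V = "theta_dual \<E> c m D i a l (carrier Gm)"
  have i1: "i 1 \<in> II (c (D 1))" using factor_data[OF order_refl m_pos] by simp
  note Vc = subgroup.mem_carrier[OF subgroup_theta_dual(1)]
  have mem: "first_elem j p \<in> R_class (IG \<E>) z \<longleftrightarrow> j = i 1 \<and> inv\<^bsub>G1\<^esub> a 1 \<otimes>\<^bsub>G1\<^esub> p \<in> ?V"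
    if "j \<in> II (c (D 1))" "p \<in> carrier G1" for j p
    using first_dec_R_class[OF _ first_elem[OF that], of "i 1" "a 1" z] dec that by simp
  have H: "H_class (IG \<E>) z = (\<lambda>(_, v). first_elem (i 1) (a 1 \<otimes>\<^bsub>G1\<^esub> v)) ` ({()} \<times> ?V)"
  proof (intro equalityI subsetI)
    fix y assume "y \<in> H_class (IG \<E>) z"
    then obtain j p where y: "j \<in> II (c (D 1))" "p \<in> carrier G1" "y = first_elem j p" "y \<in> R_class (IG \<E>) z"
      using L_class_image by (auto simp: H_class_def)
    then have jp: "j = i 1" "inv\<^bsub>G1\<^esub> a 1 \<otimes>\<^bsub>G1\<^esub> p \<in> ?V" using mem by auto
    have "p = a 1 \<otimes>\<^bsub>G1\<^esub> (inv\<^bsub>G1\<^esub> a 1 \<otimes>\<^bsub>G1\<^esub> p)" using y(2) by (simp flip: G1.m_assoc)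
    then show "y \<in> (\<lambda>(_, v). first_elem (i 1) (a 1 \<otimes>\<^bsub>G1\<^esub> v)) ` ({()} \<times> ?V)"
      using y(3) jp by (intro image_eqI[of _ _ "((), inv\<^bsub>G1\<^esub> a 1 \<otimes>\<^bsub>G1\<^esub> p)"]) auto
  next
    fix y assume "y \<in> (\<lambda>(_, v). first_elem (i 1) (a 1 \<otimes>\<^bsub>G1\<^esub> v)) ` ({()} \<times> ?V)"
    then obtain v where v: "v \<in> ?V" "y = first_elem (i 1) (a 1 \<otimes>\<^bsub>G1\<^esub> v)" by auto
    have "inv\<^bsub>G1\<^esub> a 1 \<otimes>\<^bsub>G1\<^esub> (a 1 \<otimes>\<^bsub>G1\<^esub> v) = v" using Vc[OF v(1)] by (simp flip: G1.m_assoc)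
    then have "y \<in> R_class (IG \<E>) z" using mem[OF i1] v Vc[OF v(1)] by simp
    moreover have "y \<in> L_class (IG \<E>) z" using L_class_image v Vc[OF v(1)] i1 by auto
    ultimately show "y \<in> H_class (IG \<E>) z" by (simp add: H_class_def)
  qed
  have "H_class (IG \<E>) z \<approx> {()} \<times> index_set G1 ?V (theta_dual \<E> c m D i a l {\<one>\<^bsub>Gm\<^esub>})"
    unfolding H
  proof (rule G1.eqpoll_Times_index_left[OF subgroup_theta_dual(2) subgroup_theta_dual(1)])
    fix j j' :: unit and v v' assume v: "v \<in> ?V" "v' \<in> ?V"
    have "inv\<^bsub>G1\<^esub> a 1 \<otimes>\<^bsub>G1\<^esub> (a 1 \<otimes>\<^bsub>G1\<^esub> v') = v'"
      using Vc v by (simp flip: G1.m_assoc)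
    then have "inv\<^bsub>G1\<^esub> (a 1 \<otimes>\<^bsub>G1\<^esub> v) \<otimes>\<^bsub>G1\<^esub> (a 1 \<otimes>\<^bsub>G1\<^esub> v') = inv\<^bsub>G1\<^esub> v \<otimes>\<^bsub>G1\<^esub> v'"
      using Vc v by (simp add: G1.inv_mult_group G1.m_assoc)
    then show "first_elem (i 1) (a 1 \<otimes>\<^bsub>G1\<^esub> v) = first_elem (i 1) (a 1 \<otimes>\<^bsub>G1\<^esub> v') \<longleftrightarrow>
      j' = j \<and> inv\<^bsub>G1\<^esub> v \<otimes>\<^bsub>G1\<^esub> v' \<in> theta_dual \<E> c m D i a l {\<one>\<^bsub>Gm\<^esub>}"
      using first_dec_eq[OF first_elem[OF i1] first_elem[OF i1]] Vc v by simp
  qed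
  then show ?thesis by (rule eqpoll_trans[OF _ times_singleton_eqpoll])
qed

text \<open>The \<D>-class is the disjoint union of the \<L>-classes that meet the \<R>-class of z,
  and these all have the same size.\<close>

lemma D_class_size:
  "D_class (IG \<E>) z \<approx> II (c (D 1)) \<times> LL (c (D m)) \<times>
    index_set G1 (carrier G1) (theta_dual \<E> c m D i a l {\<one>\<^bsub>Gm\<^esub>}) \<times>
    index_set Gm (carrier Gm) (theta \<E> c m D i a l (carrier G1))"
proof -
  let ?K = "II (c (D 1)) \<times> index_set G1 (carrier G1) (theta_dual \<E> c m D i a l {\<one>\<^bsub>Gm\<^esub>})"
  let ?A = "L_class (IG \<E>) ` R_class (IG \<E>) z"
  have size: "X \<approx> ?K" if X: "X \<in> ?A" for X
  proof -
    obtain y where y: "y \<in> R_class (IG \<E>) z" "X = L_class (IG \<E>) y" using X by blast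
    obtain b k where "last_dec b k y" using y(1) R_class_decomposition[OF dec] by blast
    then interpret Y: decomposed \<E> c m D i "a(m := b)" "l(m := k)" y by unfold_locales
    \<comment> \<open>The size of the \<L>-class of y is computed with the decomposition of y as
      base point; the subgroup involved is that of z.\<close>
    have "theta_dual \<E> c m D i (a(m := b)) (l(m := k)) B = theta_dual \<E> c m D i a l B" for B
      unfolding theta_dual_def by (rule theta_dual_seq_cong) (use m_pos in auto)
    then show ?thesis using Y.L_class_size y(2) by simp
  qed
  have "D_class (IG \<E>) z = (\<Union>X\<in>?A. X)" by (simp add: D_class_def)
  also have "\<dots> \<approx> ?A \<times> ?K"
    by (rule Union_eqpoll_Times[OF size _]) (assumption, rule L_class_disjoint[OF R_class_subset])
  also have "\<dots> \<approx> (LL (c (D m)) \<times> index_set Gm (carrier Gm) (theta \<E> c m D i a l (carrier G1))) \<times> ?K"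
    using L_classes_size unfolding L_classes_in_D by (rule times_eqpoll_cong) simp
  also have "\<dots> \<approx> II (c (D 1)) \<times> LL (c (D m)) \<times>
    index_set G1 (carrier G1) (theta_dual \<E> c m D i a l {\<one>\<^bsub>Gm\<^esub>}) \<times>
    index_set Gm (carrier Gm) (theta \<E> c m D i a l (carrier G1))"
    by (rule Times_rearrange(1))
  finally show ?thesis .
qed

lemma D_class_size_dual:
  "D_class (IG \<E>) z \<approx> II (c (D 1)) \<times> LL (c (D m)) \<times>
    index_set G1 (carrier G1) (theta_dual \<E> c m D i a l (carrier Gm)) \<times>
    index_set Gm (carrier Gm) (theta \<E> c m D i a l {\<one>\<^bsub>G1\<^esub>})"
proof -
  let ?K = "LL (c (D m)) \<times> index_set Gm (carrier Gm) (theta \<E> c m D i a l {\<one>\<^bsub>G1\<^esub>})"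
  let ?A = "R_class (IG \<E>) ` L_class (IG \<E>) z"
  have size: "X \<approx> ?K" if X: "X \<in> ?A" for X
  proof -
    obtain y where y: "y \<in> L_class (IG \<E>) z" "X = R_class (IG \<E>) y" using X by blast
    obtain j p where "first_dec j p y" using y(1) L_class_decomposition[OF dec] by blast
    then interpret Y: decomposed \<E> c m D "i(1 := j)" "a(1 := p)" l y by unfold_locales
    have "theta \<E> c m D (i(1 := j)) (a(1 := p)) l A = theta \<E> c m D i a l A" for A
      unfolding theta_def by (rule theta_seq_cong) auto
    then show ?thesis using Y.R_class_size y(2) by simp
  qed
  have "D_class (IG \<E>) z = (\<Union>X\<in>?A. X)" by (simp add: D_class_union_R[OF z_carrier])
  also have "\<dots> \<approx> ?A \<times> ?K"
    by (rule Union_eqpoll_Times[OF size _]) (assumption, rule R_class_disjoint[OF L_class_subset])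
  also have "\<dots> \<approx> (II (c (D 1)) \<times> index_set G1 (carrier G1) (theta_dual \<E> c m D i a l (carrier Gm))) \<times> ?K"
    using R_classes_size unfolding R_classes_in_D[OF z_carrier] by (rule times_eqpoll_cong) simp
  also have "\<dots> \<approx> II (c (D 1)) \<times> LL (c (D m)) \<times>
    index_set G1 (carrier G1) (theta_dual \<E> c m D i a l (carrier Gm)) \<times>
    index_set Gm (carrier Gm) (theta \<E> c m D i a l {\<one>\<^bsub>G1\<^esub>})"
    by (rule Times_rearrange(2))
  finally show ?thesis .
qed

lemma D_class_finite:
  assumes "finite (carrier G1)" "finite (carrier Gm)"
  shows "finite (D_class (IG \<E>) z)"
proof -
  have "finite (II (c (D 1)))" "finite (LL (c (D m)))"
    using coord_choice factor_data(1)[OF order_refl m_pos] factor_data(1)[OF m_pos order_refl]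
    by (auto simp: is_coord_choice_def is_rees_coords_def)
  then show ?thesis
    unfolding eqpoll_finite_iff[OF D_class_size]
    using assms by (intro finite_cartesian_product G1.finite_index_set Gm.finite_index_set) auto
qed

end

section \<open>From biordered sets to the axioms used above\<close>

text \<open>Both axioms are pulled back along the isomorphism. Being a basic pair is symmetric, so
  if ef is defined then fe is too, and its value can be read off in S.\<close>

lemma biorder_if_biordered_set:
  assumes "biordered_set TYPE('s) \<E>"
  shows "biorder \<E>"
proof -
  obtain S :: "'s semigrp" and \<phi> where alg: "is_partial_alg \<E>" and iso: "partial_alg_iso \<phi> \<E> (idempotent_alg S)"
    using assms unfolding biordered_set_def by blast
  have inj: "\<phi> e = \<phi> f \<longleftrightarrow> e = f" if "e \<in> carrier \<E>" "f \<in> carrier \<E>" for e f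
    using iso that unfolding partial_alg_iso_def by (meson bij_betw_imp_inj_on inj_on_eq_iff)
  have closed: "g \<in> carrier \<E>" if "e \<in> carrier \<E>" "f \<in> carrier \<E>" "pmult \<E> e f = Some g" for e f g
    using alg that unfolding is_partial_alg_def by blast
  let ?basic = "\<lambda>e f. {\<phi> e \<cdot>\<^bsub>S\<^esub> \<phi> f, \<phi> f \<cdot>\<^bsub>S\<^esub> \<phi> e} \<inter> {\<phi> e, \<phi> f} \<noteq> {}"
  have mult: "map_option \<phi> (pmult \<E> e f) = (if ?basic e f then Some (\<phi> e \<cdot>\<^bsub>S\<^esub> \<phi> f) else None)"
    if "e \<in> carrier \<E>" "f \<in> carrier \<E>" for e f
    using iso that by (simp add: partial_alg_iso_def idempotent_alg_def)
  have val: "pmult \<E> e f = Some g" if "e \<in> carrier \<E>" "f \<in> carrier \<E>" "g \<in> carrier \<E>"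
    "?basic e f" "\<phi> e \<cdot>\<^bsub>S\<^esub> \<phi> f = \<phi> g" for e f g
  proof -
    have "map_option \<phi> (pmult \<E> e f) = Some (\<phi> g)" using mult that by simp
    then show ?thesis using closed[OF that(1,2)] inj that by fastforce
  qed
  show ?thesis
  proof
    fix e assume e: "e \<in> carrier \<E>"
    have "\<phi> e \<in> idempotents S"
      using iso e bij_betwE by (fastforce simp: partial_alg_iso_def idempotent_alg_def)
    then have "\<phi> e \<cdot>\<^bsub>S\<^esub> \<phi> e = \<phi> e" by (simp add: idempotents_def)
    then show "pmult \<E> e e = Some e" using val e by simp
  next
    fix e f g assume ef: "e \<in> carrier \<E>" "f \<in> carrier \<E>" "pmult \<E> e f = Some g"
    have g: "g \<in> carrier \<E>" using closed ef by blast
    have b: "?basic e f" and g': "\<phi> g = \<phi> e \<cdot>\<^bsub>S\<^esub> \<phi> f"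
      using mult[OF ef(1,2)] ef(3) by (auto split: if_splits)
    have b': "?basic f e" using b by blast
    consider "\<phi> g = \<phi> e" | "\<phi> g = \<phi> f" | "\<phi> f \<cdot>\<^bsub>S\<^esub> \<phi> e = \<phi> e" | "\<phi> f \<cdot>\<^bsub>S\<^esub> \<phi> e = \<phi> f"
      using b g' by auto
    then show "g = e \<or> g = f \<or> pmult \<E> f e = Some e \<or> pmult \<E> f e = Some f"
      using inj g ef val[OF ef(2,1) _ b'] by cases blast+
  qed
qed

theorem theorem4p12:
  fixes \<E> :: "'e partial_alg"
    and c :: "('e, 'g, 'i, 'l) coord_choice"
    and m :: nat
    and D :: "nat \<Rightarrow> 'e list set set"
    and i :: "nat \<Rightarrow> 'i" and a :: "nat \<Rightarrow> 'g" and l :: "nat \<Rightarrow> 'l"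
    and x :: "'e list set"
  assumes "biordered_set TYPE('s) \<E>"
    and "finite (carrier \<E>)"
    and "is_coord_choice \<E> c"
    and "is_decomposition \<E> c m D i a l x"
  shows
    "let S = IG \<E>;
         G\<^sub>1 = GG (c (D 1)); G\<^sub>m = GG (c (D m)); I\<^sub>1 = II (c (D 1)); \<Lambda>\<^sub>m = LL (c (D m));
         \<theta> = theta \<E> c m D i a l; \<theta>' = theta_dual \<E> c m D i a l
     in
       (R_classes_in S (D_class S x)
          \<approx> I\<^sub>1 \<times> index_set G\<^sub>1 (carrier G\<^sub>1) (\<theta>' (carrier G\<^sub>m))) \<and>
       (L_classes_in S (D_class S x)
          \<approx> \<Lambda>\<^sub>m \<times> index_set G\<^sub>m (carrier G\<^sub>m) (\<theta> (carrier G\<^sub>1))) \<and>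
       (H_class S x \<approx> index_set G\<^sub>m (\<theta> (carrier G\<^sub>1)) (\<theta> {\<one>\<^bsub>G\<^sub>1\<^esub>})) \<and>
       (H_class S x \<approx> index_set G\<^sub>1 (\<theta>' (carrier G\<^sub>m)) (\<theta>' {\<one>\<^bsub>G\<^sub>m\<^esub>})) \<and>
       (R_class S x \<approx> \<Lambda>\<^sub>m \<times> index_set G\<^sub>m (carrier G\<^sub>m) (\<theta> {\<one>\<^bsub>G\<^sub>1\<^esub>})) \<and>
       (L_class S x \<approx> I\<^sub>1 \<times> index_set G\<^sub>1 (carrier G\<^sub>1) (\<theta>' {\<one>\<^bsub>G\<^sub>m\<^esub>})) \<and>
       (D_class S x
          \<approx> I\<^sub>1 \<times> \<Lambda>\<^sub>m \<times> index_set G\<^sub>1 (carrier G\<^sub>1) (\<theta>' {\<one>\<^bsub>G\<^sub>m\<^esub>})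
              \<times> index_set G\<^sub>m (carrier G\<^sub>m) (\<theta> (carrier G\<^sub>1))) \<and>
       (D_class S x
          \<approx> I\<^sub>1 \<times> \<Lambda>\<^sub>m \<times> index_set G\<^sub>1 (carrier G\<^sub>1) (\<theta>' (carrier G\<^sub>m))
              \<times> index_set G\<^sub>m (carrier G\<^sub>m) (\<theta> {\<one>\<^bsub>G\<^sub>1\<^esub>})) \<and>
       (finite (carrier G\<^sub>1) \<and> finite (carrier G\<^sub>m) \<longrightarrow> finite (D_class S x))"
proof -
  interpret biorder \<E> by (rule biorder_if_biordered_set[OF assms(1)])
  interpret decomposed \<E> c m D i a l x
    by unfold_locales (fact assms(3), fact assms(4))
  show ?thesis
    unfolding Let_def
    by (intro conjI impI R_classes_size L_classes_size H_class_size H_class_size_dual R_class_size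
        L_class_size D_class_size D_class_size_dual) (blast intro: D_class_finite)
qed

end
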